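(* Let $M,\rho,\mu,\sigma,T\in(0,\infty)$ with $\mu>\rho$, and let $B=(B_t)_{t\ge0}$ be a standard one-dimensional Brownian motion. Let $\bar S_0,\bar S_1$ be the solutions of $$d\bar S_0=\rho\,\bar S_0\,dt,\quad \bar S_0(0)=1,\qquad\qquad d\bar S_1=\mu\,\bar S_1\,dt+\sigma\,\bar S_1\,dB_t\ \text{(Itô)},\quad \bar S_1(0)=1 .$$ Let $S_0$ be the solution on $[0,T]$ of the random initial value problem $$dS_0=\rho\,S_0\,dt,\qquad S_0(0)=M\,\mathbf 1\{\bar S_1(T)\le \bar S_0(T)\}.$$ (a) Let $S_1$ be the solution on $[0,T]$ of the Skorokhod stochastic differential equation $$\delta S_1=\mu\,S_1\,dt+\sigma\,S_1\,\delta B_t,\qquad S_1(0)=M\,\mathbf 1\{\bar S_1(T)> \bar S_0(T)\},$$ and let $S(t)=S_0(t)+S_1(t)$ (the total wealth of the insider). Then $$\mathbb E[S(T)]=\frac M2\left\{1+\operatorname{erf}\left[\frac{(\sigma^2+2\rho-2\mu)\sqrt T}{2\sqrt2\,\sigma}\right]\right\}e^{\rho T}+\frac M2\left\{1-\operatorname{erf}\left[\frac{(\sigma^2+2\rho-2\mu)\sqrt T}{2\sqrt2\,\sigma}\right]\right\}e^{\mu T}.$$ (b) Let instead $S_1$ be the solution on $[0,T]$ of the Russo-Vallois forward stochastic differential equation $$d^-S_1=\mu\,S_1\,dt+\sigma\,S_1\,d^-B_t,\qquad S_1(0)=M\,\mathbf 1\{\bar S_1(T)> \bar S_0(T)\},$$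 and let $S(t)=S_0(t)+S_1(t)$. Then $$\mathbb E[S(T)]=\frac M2\left\{1+\operatorname{erf}\left[\frac{(\sigma^2+2\rho-2\mu)\sqrt T}{2\sqrt2\,\sigma}\right]\right\}e^{\rho T}+\frac M2\left\{1+\operatorname{erf}\left[\frac{(\sigma^2-2\rho+2\mu)\sqrt T}{2\sqrt2\,\sigma}\right]\right\}e^{\mu T}.$$
   Context: $\mathbf 1\{A\}$ is the indicator of the event $A$, and $\operatorname{erf}(x)=\frac{2}{\sqrt\pi}\int_0^x e^{-y^2}\,dy$. Skorokhod integral: the extension of the Itô integral to not necessarily adapted integrands given by the adjoint $\delta$ of the Malliavin derivative $D$, i.e. $\int_0^T u_s\,\delta B_s=\delta(u)$ is characterized by $\mathbb E[F\,\delta(u)]=\mathbb E[\int_0^T D_sF\,u_s\,ds]$ for all $F\in\mathbb D^{1,2}$, and $\int_0^t u_s\,\delta B_s=\delta(u\mathbf 1_{[0,t]})$. The Skorokhod equation means $S_1(t)=S_1(0)+\mu\int_0^tS_1(s)\,ds+\sigma\int_0^tS_1(s)\,\delta B_s$. Its solution, obtained by Malliavin calculus, is $S_1(t)=S_1(0)\diamond\exp\{(\mu-\sigma^2/2)t+\sigma B_t\}$, where $\diamond$ is the Wick product (determined on multiple Wiener-Itô integrals by $I_n(f)\diamond I_m(g)=I_{n+m}(f\,\widehat\otimes\,g)$, with $\widehat\otimes$ the symmetrized tensor product, and extended bilinearly to chaos expansions). Russo-Vallois forward integral: $\int_0^t\varphi(s)\,d^-B_s=\lim_{\varepsilon\to0^+}\int_0^t\varphi(s)\frac{B_{s+\varepsilon}-B_s}{\varepsilon}\,ds$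 (limit in probability). The forward equation means $S_1(t)=S_1(0)+\mu\int_0^tS_1(s)\,ds+\sigma\int_0^tS_1(s)\,d^-B_s$. Its solution, obtained by the rules of Itô calculus (which the forward integral preserves), is $S_1(t)=S_1(0)\exp\{(\mu-\sigma^2/2)t+\sigma B_t\}$. *)

theory Defs
  imports "HOL-Probability.Probability"
begin

section \<open>Brownian motion\<close>

definition erf :: "real \<Rightarrow> real" where
  "erf x = 2 / sqrt pi * (LBINT y=0..x. exp (- (y\<^sup>2)))"

locale brownian_motion = prob_space P for P :: "'a measure" +
  fixes B :: "real \<Rightarrow> 'a \<Rightarrow> real"
  assumes BM_measurable: "\<And>t. 0 \<le> t \<Longrightarrow> B t \<in> borel_measurable P"
    and BM_zero: "AE \<omega> in P. B 0 \<omega> = 0"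
    and BM_increment: "\<And>s t. 0 \<le> s \<Longrightarrow> s < t \<Longrightarrow>
          distributed P lborel (\<lambda>\<omega>. B t \<omega> - B s \<omega>) (normal_density 0 (sqrt (t - s)))"
    and BM_indep: "\<And>(n::nat) \<tau>. 0 \<le> \<tau> 0 \<Longrightarrow> (\<forall>i<n. \<tau> i \<le> \<tau> (Suc i)) \<Longrightarrow>
          indep_vars (\<lambda>_. borel) (\<lambda>i \<omega>. B (\<tau> (Suc i)) \<omega> - B (\<tau> i) \<omega>) {..<n}"
    and BM_continuous: "AE \<omega> in P. continuous_on {0..} (\<lambda>t. B t \<omega>)"

text \<open>The Brownian filtration, augmented by the null sets of \<open>P\<close>, and its initial enlargement by
  a random variable \<open>\<xi>\<close>. Only the \<open>\<sigma>\<close>-algebras of the following measure spaces matter;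
  the measure carried by \<^const>\<open>sigma\<close> is irrelevant.\<close>

definition bm_filtration :: "'a measure \<Rightarrow> (real \<Rightarrow> 'a \<Rightarrow> real) \<Rightarrow> real \<Rightarrow> 'a measure" where
  "bm_filtration P B t = sigma (space P)
     ({B s -` A \<inter> space P |s A. 0 \<le> s \<and> s \<le> t \<and> A \<in> sets borel} \<union> null_sets P)"

definition enlarged_filtration ::
  "'a measure \<Rightarrow> (real \<Rightarrow> 'a \<Rightarrow> real) \<Rightarrow> ('a \<Rightarrow> real) \<Rightarrow> real \<Rightarrow> 'a measure" where
  "enlarged_filtration P B \<xi> t = sigma (space P)
     (sets (bm_filtration P B t) \<union> {\<xi> -` A \<inter> space P |A. A \<in> sets borel})"

definition conv_in_prob ::
  "'a measure \<Rightarrow> ('i \<Rightarrow> 'a \<Rightarrow> real) \<Rightarrow> ('a \<Rightarrow> real) \<Rightarrow> 'i filter \<Rightarrow> bool" where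
  "conv_in_prob P X L F \<longleftrightarrow>
     (\<forall>\<^sub>F i in F. X i \<in> borel_measurable P) \<and> L \<in> borel_measurable P \<and>
     (\<forall>e>0. ((\<lambda>i. measure P {\<omega> \<in> space P. e < \<bar>X i \<omega> - L \<omega>\<bar>}) \<longlongrightarrow> 0) F)"

definition square_integrable :: "'b measure \<Rightarrow> ('b \<Rightarrow> real) \<Rightarrow> bool" where
  "square_integrable N f \<longleftrightarrow> f \<in> borel_measurable N \<and> integrable N (\<lambda>x. (f x)\<^sup>2)"

abbreviation time_space :: "real \<Rightarrow> real measure" where
  "time_space T \<equiv> restrict_space lborel {0..T}"

section \<open>The Ito integral\<close>

text \<open>\<open>(n, \<tau>, \<xi>)\<close> encodes the simple process with value \<open>\<xi> i\<close> on \<open>]\<tau> i, \<tau> (i+1)]\<close>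
  for \<open>i < n\<close>.\<close>

definition simple_adapted ::
  "'a measure \<Rightarrow> (real \<Rightarrow> 'a measure) \<Rightarrow> nat \<Rightarrow> (nat \<Rightarrow> real) \<Rightarrow> (nat \<Rightarrow> 'a \<Rightarrow> real) \<Rightarrow> bool" where
  "simple_adapted P \<F> n \<tau> \<xi> \<longleftrightarrow> 0 \<le> \<tau> 0 \<and>
     (\<forall>i<n. \<tau> i \<le> \<tau> (Suc i) \<and> \<xi> i \<in> borel_measurable (\<F> (\<tau> i)) \<and>
            (\<exists>C. \<forall>\<omega>\<in>space P. \<bar>\<xi> i \<omega>\<bar> \<le> C))"

definition simple_process ::
  "nat \<Rightarrow> (nat \<Rightarrow> real) \<Rightarrow> (nat \<Rightarrow> 'a \<Rightarrow> real) \<Rightarrow> real \<Rightarrow> 'a \<Rightarrow> real" where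
  "simple_process n \<tau> \<xi> s \<omega> = (\<Sum>i<n. \<xi> i \<omega> * indicator {\<tau> i<..\<tau> (Suc i)} s)"

definition simple_integral ::
  "(real \<Rightarrow> 'a \<Rightarrow> real) \<Rightarrow> nat \<Rightarrow> (nat \<Rightarrow> real) \<Rightarrow> (nat \<Rightarrow> 'a \<Rightarrow> real) \<Rightarrow> real \<Rightarrow> 'a \<Rightarrow> real" where
  "simple_integral B n \<tau> \<xi> t \<omega> =
     (\<Sum>i<n. \<xi> i \<omega> * (B (min (\<tau> (Suc i)) t) \<omega> - B (min (\<tau> i) t) \<omega>))"

text \<open>\<open>I\<close> is (a version of) the Ito integral of \<open>X\<close> over \<open>[0,t]\<close>, for measurable adapted \<open>X\<close>
  with almost surely square integrable paths.\<close>

definition has_ito_integral ::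
  "'a measure \<Rightarrow> (real \<Rightarrow> 'a \<Rightarrow> real) \<Rightarrow> (real \<Rightarrow> 'a \<Rightarrow> real) \<Rightarrow> real \<Rightarrow> ('a \<Rightarrow> real) \<Rightarrow> bool" where
  "has_ito_integral P B X t I \<longleftrightarrow>
     (\<lambda>(s,\<omega>). X s \<omega>) \<in> borel_measurable (time_space t \<Otimes>\<^sub>M P) \<and>
     (\<forall>s\<in>{0..t}. X s \<in> borel_measurable (bm_filtration P B s)) \<and>
     (AE \<omega> in P. set_integrable lborel {0..t} (\<lambda>s. (X s \<omega>)\<^sup>2)) \<and>
     (\<exists>n \<tau> \<xi>.
        (\<forall>k::nat. simple_adapted P (bm_filtration P B) (n k) (\<tau> k) (\<xi> k)) \<and>
        conv_in_prob P
          (\<lambda>k \<omega>. LINT s:{0..t}|lborel. (simple_process (n k) (\<tau> k) (\<xi> k) s \<omega> - X s \<omega>)\<^sup>2)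
          (\<lambda>_. 0) sequentially \<and>
        conv_in_prob P (\<lambda>k. simple_integral B (n k) (\<tau> k) (\<xi> k) t) I sequentially)"

definition ito_solution ::
  "'a measure \<Rightarrow> (real \<Rightarrow> 'a \<Rightarrow> real) \<Rightarrow> real \<Rightarrow> real \<Rightarrow> real \<Rightarrow> (real \<Rightarrow> 'a \<Rightarrow> real) \<Rightarrow> bool" where
  "ito_solution P B \<mu> \<sigma> T X \<longleftrightarrow>
     (AE \<omega> in P. continuous_on {0..T} (\<lambda>t. X t \<omega>)) \<and>
     (\<forall>t\<in>{0..T}. X t \<in> borel_measurable (bm_filtration P B t)) \<and>
     (\<forall>t\<in>{0..T}. \<exists>I. has_ito_integral P B X t I \<and>
        (AE \<omega> in P. X t \<omega> = X 0 \<omega> + \<mu> * (LINT s:{0..t}|lborel. X s \<omega>) + \<sigma> * I \<omega>))"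

section \<open>Malliavin derivative and Skorokhod integral\<close>

text \<open>Functions of \<open>n\<close> real variables are represented as functions on \<^typ>\<open>nat \<Rightarrow> real\<close> that
  depend only on the first \<open>n\<close> coordinates.\<close>

definition pd :: "nat \<Rightarrow> ((nat \<Rightarrow> real) \<Rightarrow> real) \<Rightarrow> (nat \<Rightarrow> real) \<Rightarrow> real" where
  "pd i f x = deriv (\<lambda>y. f (x(i := y))) (x i)"

text \<open>\<open>C\<^sup>\<infinity>\<close> functions which, together with all their partial derivatives, grow at most
  polynomially; \<open>fold pd js f\<close> is the iterated partial derivative along the list \<open>js\<close>.\<close>

definition smooth_poly_growth :: "nat \<Rightarrow> ((nat \<Rightarrow> real) \<Rightarrow> real) \<Rightarrow> bool" where
  "smooth_poly_growth n f \<longleftrightarrow>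
     (\<forall>x y. (\<forall>i<n. x i = y i) \<longrightarrow> f x = f y) \<and>
     (\<forall>js. set js \<subseteq> {..<n} \<longrightarrow>
        continuous_on UNIV (fold pd js f) \<and>
        (\<forall>i<n. \<forall>x. (\<lambda>y. fold pd js f (x(i := y))) differentiable (at (x i))) \<and>
        (\<exists>C k. \<forall>x. \<bar>fold pd js f x\<bar> \<le> C * (1 + (\<Sum>i<n. \<bar>x i\<bar>)) ^ k))"

text \<open>\<open>F = f (W h\<^sub>0, \<dots>, W h\<^sub>n\<^sub>-\<^sub>1)\<close> with Wiener integrals \<open>W h\<^sub>i = \<integral> h\<^sub>i dB\<close> over \<open>[0,T]\<close>,
  and \<open>DF s = \<Sum>i. \<partial>\<^sub>i f (W h\<^sub>0, \<dots>, W h\<^sub>n\<^sub>-\<^sub>1) * h\<^sub>i s\<close>.\<close>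

definition smooth_functional ::
  "'a measure \<Rightarrow> (real \<Rightarrow> 'a \<Rightarrow> real) \<Rightarrow> real \<Rightarrow> ('a \<Rightarrow> real) \<Rightarrow> (real \<Rightarrow> 'a \<Rightarrow> real) \<Rightarrow> bool" where
  "smooth_functional P B T F DF \<longleftrightarrow>
     (\<exists>(n::nat) f h W. smooth_poly_growth n f \<and>
        (\<forall>i<n. square_integrable (time_space T) (h i) \<and>
               has_ito_integral P B (\<lambda>s _. h i s) T (W i)) \<and>
        F = (\<lambda>\<omega>. f (\<lambda>i. W i \<omega>)) \<and>
        DF = (\<lambda>s \<omega>. \<Sum>i<n. pd i f (\<lambda>j. W j \<omega>) * h i s))"

text \<open>\<open>F \<in> \<D>\<^sup>1\<^sup>,\<^sup>2\<close> with Malliavin derivative \<open>DF\<close>: the closure in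
  \<open>L\<^sup>2(\<Omega>) \<times> L\<^sup>2([0,T] \<times> \<Omega>)\<close> of the derivative on smooth functionals.\<close>

definition has_malliavin_derivative ::
  "'a measure \<Rightarrow> (real \<Rightarrow> 'a \<Rightarrow> real) \<Rightarrow> real \<Rightarrow> ('a \<Rightarrow> real) \<Rightarrow> (real \<Rightarrow> 'a \<Rightarrow> real) \<Rightarrow> bool" where
  "has_malliavin_derivative P B T F DF \<longleftrightarrow>
     square_integrable P F \<and>
     square_integrable (time_space T \<Otimes>\<^sub>M P) (\<lambda>(s,\<omega>). DF s \<omega>) \<and>
     (\<exists>G DG. (\<forall>k::nat. smooth_functional P B T (G k) (DG k)) \<and>
        (\<lambda>k. \<integral>\<omega>. (G k \<omega> - F \<omega>)\<^sup>2 \<partial>P) \<longlonglongrightarrow> 0 \<and>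
        (\<lambda>k. \<integral>(s,\<omega>). (DG k s \<omega> - DF s \<omega>)\<^sup>2 \<partial>(time_space T \<Otimes>\<^sub>M P)) \<longlonglongrightarrow> 0)"

text \<open>\<open>V = \<delta>(u)\<close> on \<open>[0,T]\<close>. Malliavin calculus lives on the \<open>\<sigma>\<close>-algebra generated by \<open>B\<close>; since
  \<open>P\<close> may carry more randomness, this measurability is required of \<open>u\<close> and \<open>V\<close> explicitly, and it is
  what makes \<open>V\<close> unique almost surely.\<close>

definition has_skorokhod_integral ::
  "'a measure \<Rightarrow> (real \<Rightarrow> 'a \<Rightarrow> real) \<Rightarrow> real \<Rightarrow> (real \<Rightarrow> 'a \<Rightarrow> real) \<Rightarrow> ('a \<Rightarrow> real) \<Rightarrow> bool" where
  "has_skorokhod_integral P B T u V \<longleftrightarrow>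
     (\<lambda>(s,\<omega>). u s \<omega>) \<in> borel_measurable (time_space T \<Otimes>\<^sub>M bm_filtration P B T) \<and>
     square_integrable (time_space T \<Otimes>\<^sub>M P) (\<lambda>(s,\<omega>). u s \<omega>) \<and>
     V \<in> borel_measurable (bm_filtration P B T) \<and>
     square_integrable P V \<and>
     (\<forall>F DF. has_malliavin_derivative P B T F DF \<longrightarrow>
        (\<integral>\<omega>. F \<omega> * V \<omega> \<partial>P) = (\<integral>\<omega>. (LINT s:{0..T}|lborel. DF s \<omega> * u s \<omega>) \<partial>P))"

definition skorokhod_solution ::
  "'a measure \<Rightarrow> (real \<Rightarrow> 'a \<Rightarrow> real) \<Rightarrow> real \<Rightarrow> real \<Rightarrow> real \<Rightarrow> (real \<Rightarrow> 'a \<Rightarrow> real) \<Rightarrow> bool" where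
  "skorokhod_solution P B \<mu> \<sigma> T X \<longleftrightarrow>
     (\<forall>t\<in>{0..T}. X t \<in> borel_measurable P) \<and>
     (\<forall>t\<in>{0..T}. \<exists>V. has_skorokhod_integral P B T (\<lambda>s \<omega>. X s \<omega> * indicator {0..t} s) V \<and>
        (AE \<omega> in P. X t \<omega> = X 0 \<omega> + \<mu> * (LINT s:{0..t}|lborel. X s \<omega>) + \<sigma> * V \<omega>))"

section \<open>The Russo-Vallois forward integral\<close>

definition has_forward_integral ::
  "'a measure \<Rightarrow> (real \<Rightarrow> 'a \<Rightarrow> real) \<Rightarrow> (real \<Rightarrow> 'a \<Rightarrow> real) \<Rightarrow> real \<Rightarrow> ('a \<Rightarrow> real) \<Rightarrow> bool" where
  "has_forward_integral P B \<phi> t I \<longleftrightarrow>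
     conv_in_prob P
       (\<lambda>\<epsilon> \<omega>. LINT s:{0..t}|lborel. \<phi> s \<omega> * ((B (s + \<epsilon>) \<omega> - B s \<omega>) / \<epsilon>)) I (at_right 0)"

text \<open>As usual for (strong) solutions of a stochastic differential equation with random initial
  value, a solution is a continuous process adapted to the filtration generated by the driving
  Brownian motion and the initial value. The initial value may anticipate \<open>B\<close>, so the integrand
  need not be adapted to the Brownian filtration. Among arbitrary anticipating processes the
  forward equation does not determine its solution.\<close>

definition forward_solution ::
  "'a measure \<Rightarrow> (real \<Rightarrow> 'a \<Rightarrow> real) \<Rightarrow> real \<Rightarrow> real \<Rightarrow> real \<Rightarrow> (real \<Rightarrow> 'a \<Rightarrow> real) \<Rightarrow> bool" where
  "forward_solution P B \<mu> \<sigma> T X \<longleftrightarrow>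
     X 0 \<in> borel_measurable P \<and>
     (AE \<omega> in P. continuous_on {0..T} (\<lambda>t. X t \<omega>)) \<and>
     (\<forall>t\<in>{0..T}. X t \<in> borel_measurable (enlarged_filtration P B (X 0) t)) \<and>
     (\<forall>t\<in>{0..T}. \<exists>I. has_forward_integral P B X t I \<and>
        (AE \<omega> in P. X t \<omega> = X 0 \<omega> + \<mu> * (LINT s:{0..t}|lborel. X s \<omega>) + \<sigma> * I \<omega>))"

section \<open>The riskless asset\<close>

definition ode_solution :: "real \<Rightarrow> real \<Rightarrow> (real \<Rightarrow> real) \<Rightarrow> bool" where
  "ode_solution \<rho> T y \<longleftrightarrow>
     (\<forall>t\<in>{0..T}. (y has_real_derivative \<rho> * y t) (at t within {0..T}))"

definition random_ode_solution ::
  "'a measure \<Rightarrow> real \<Rightarrow> real \<Rightarrow> (real \<Rightarrow> 'a \<Rightarrow> real) \<Rightarrow> bool" where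
  "random_ode_solution P \<rho> T Y \<longleftrightarrow>
     (\<forall>t\<in>{0..T}. Y t \<in> borel_measurable P) \<and> (AE \<omega> in P. ode_solution \<rho> T (\<lambda>t. Y t \<omega>))"

end

theory Submission
  imports Defs
begin

text \<open>Each solution is identified pathwise by the integrating factor
  \<open>Z t = exp (- \<sigma> B t - (\<mu> - \<sigma>\<^sup>2 / 2) t)\<close>: along a grid, \<open>Z X\<close> changes by the sum of terms
  \<open>Z X (\<Delta> - (\<Delta>B)\<^sup>2)\<close>, which is small in \<open>L\<^sup>2\<close>, and of remainders, which are stochastic sums with
  small coefficients. Since all integrands are continuous, this only needs the stochastic integral to
  be the limit in probability of Riemann sums, and second moments of such sums with adapted
  coefficients. For the forward equation the coefficients are adapted to an enlarged filtration, but
  the initial value takes two values only, and on an event on which it is constant the coefficients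
  agree with adapted ones, so no semimartingale decomposition of \<open>B\<close> is needed. The Skorokhod
  integral, on the other hand, has mean zero (test the duality against \<open>F = 1\<close>), so the expectation of
  the Skorokhod solution satisfies a linear ordinary differential equation. Everything else is a
  Gaussian integral.\<close>

section \<open>Independence of increments from the augmented filtration\<close>

text \<open>The obstacle is that the equation gives the integral only as a limit in probability, and
  that no moments of the solution are given. Hence every second-moment bound is taken over an event
  on which the paths are bounded and have a fixed modulus of continuity. Such an event anticipates,
  so coefficients cannot simply be multiplied by its indicator; instead adapted versions of them are
  clipped, and the clipped sums agree with the given ones on the event. Two grids are used: a coarse
  one, on which \<open>Z X\<close> is telescoped, and a refinement, on which increments of the
  integral become Riemann sums; the fine mesh goes to 0 first. In the telescoped sum the residual of
  the step from t_i to t_{i+1} is weighted by \<open>Z\<close> at t_{i+1}, which is not adapted at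
  t_i; replacing it by \<open>Z\<close> at t_i costs a product of two small quantities, controlled
  by Young's inequality. The error functions in (a) and (b) differ because weighting by exp(\<sigma>
  B_T) moves the mean of B_T by \<sigma> T, whereas in (a) only the probability of B_T > c
  enters.\<close>

lemma measurable_Collect_mem:
  "f \<in> measurable M N \<Longrightarrow> A \<in> sets N \<Longrightarrow> {x\<in>space M. f x \<in> A} \<in> sets M"
  using measurable_sets[of f M N A] by (simp add: vimage_def Int_def conj_commute)

lemma sorted_enum:
  fixes D :: "real set"
  assumes "finite D" "D \<noteq> {}"
  obtains k :: nat and d :: "nat \<Rightarrow> real"
  where "D = d ` {..k}" "\<And>i j. i < j \<Longrightarrow> j \<le> k \<Longrightarrow> d i < d j"
proof -
  define l where "l = sorted_list_of_set D"
  have l: "set l = D" "sorted_wrt (<) l" using assms(1) by (auto simp: l_def)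
  have ne: "l \<noteq> []" using l(1) assms(2) by auto
  define k where "k = length l - 1"
  have "Suc k = length l" using ne by (simp add: k_def)
  then have k: "{..k} = {..<length l}" by auto
  have "D = (\<lambda>i. l ! i) ` {..k}" unfolding k l(1)[symmetric] by (auto simp: set_conv_nth)
  moreover have "i < j \<Longrightarrow> j \<le> k \<Longrightarrow> l ! i < l ! j" for i j
    using l(2) k by (auto simp: sorted_wrt_iff_nth_less)
  ultimately show ?thesis using that by blast
qed

lemma space_bm_filtration [simp]: "space (bm_filtration P B t) = space P"
  unfolding bm_filtration_def by (rule space_measure_of) (auto dest: null_sets.sets_into_space)

lemma sets_bm_filtration:
  "sets (bm_filtration P B t) = sigma_sets (space P)
     ({B s -` A \<inter> space P |s A. 0 \<le> s \<and> s \<le> t \<and> A \<in> sets borel} \<union> null_sets P)"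
  unfolding bm_filtration_def by (rule sets_measure_of) (auto dest: null_sets.sets_into_space)

lemma bm_filtration_mono:
  assumes "s \<le> t"
  shows "sets (bm_filtration P B s) \<subseteq> sets (bm_filtration P B t)"
  unfolding sets_bm_filtration
proof (intro sigma_sets_mono' Un_mono order_refl Collect_mono impI)
  fix C assume "\<exists>r A. C = B r -` A \<inter> space P \<and> 0 \<le> r \<and> r \<le> s \<and> A \<in> sets borel"
  then obtain r A where "C = B r -` A \<inter> space P" "0 \<le> r" "r \<le> s" "A \<in> sets borel" by blast
  moreover from this have "r \<le> t" using \<open>s \<le> t\<close> by simp
  ultimately show "\<exists>r A. C = B r -` A \<inter> space P \<and> 0 \<le> r \<and> r \<le> t \<and> A \<in> sets borel" by blast
qed

lemma measurable_bm_filtration_mono: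
  assumes "s \<le> t" "f \<in> measurable (bm_filtration P B s) N"
  shows "f \<in> measurable (bm_filtration P B t) N"
  using measurable_mono[OF order_refl refl bm_filtration_mono[OF assms(1)]] assms(2) by auto

context brownian_motion begin

abbreviation \<F> :: "real \<Rightarrow> 'a measure" where "\<F> \<equiv> bm_filtration P B"

lemma sets_filtration_subset: "sets (\<F> t) \<subseteq> sets P"
proof -
  have "B s -` A \<inter> space P \<in> sets P" if "0 \<le> s" "A \<in> sets borel" for s A
    using measurable_sets[OF BM_measurable[OF that(1)] that(2)] .
  then have "{B s -` A \<inter> space P |s A. 0 \<le> s \<and> s \<le> t \<and> A \<in> sets borel} \<subseteq> sets P"
    by blast
  moreover have "null_sets P \<subseteq> sets P" by (rule subsetI) (rule null_setsD2)
  ultimately show ?thesis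
    unfolding sets_bm_filtration by (rule sets.sigma_sets_subset[OF Un_least])
qed

lemma measurable_filtration: "f \<in> measurable (\<F> t) N \<Longrightarrow> f \<in> measurable P N"
  using measurable_mono[OF order_refl refl sets_filtration_subset] by auto

lemma BM_adapted: "0 \<le> s \<Longrightarrow> s \<le> t \<Longrightarrow> B s \<in> borel_measurable (\<F> t)"
proof (rule measurableI)
  fix A :: "real set" assume "0 \<le> s" "s \<le> t" "A \<in> sets borel"
  then have "B s -` A \<inter> space P \<in> {B s -` A \<inter> space P |s A. 0 \<le> s \<and> s \<le> t \<and> A \<in> sets borel} \<union> null_sets P"
    by blast
  then show "B s -` A \<inter> space (\<F> t) \<in> sets (\<F> t)"
    unfolding sets_bm_filtration space_bm_filtration by (rule sigma_sets.Basic)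
qed simp

text \<open>Almost surely \<open>B 0\<close> is 0, so the values at the times in \<open>I\<close>
  are partial sums of increments between consecutive points of \<open>I\<close> together with 0 and
  \<open>s\<close>. The increment from \<open>s\<close> to \<open>t\<close> is one further member of
  the same independent family.\<close>

lemma prob_cylinder_increment:
  assumes I: "finite I" "I \<subseteq> {0..s}" and st: "0 \<le> s" "s < t"
    and A: "\<And>r. r \<in> I \<Longrightarrow> A r \<in> sets borel" and D: "D \<in> sets borel"
  shows "prob ({\<omega>\<in>space P. \<forall>r\<in>I. B r \<omega> \<in> A r} \<inter> {\<omega>\<in>space P. B t \<omega> - B s \<omega> \<in> D}) =
    prob {\<omega>\<in>space P. \<forall>r\<in>I. B r \<omega> \<in> A r} * prob {\<omega>\<in>space P. B t \<omega> - B s \<omega> \<in> D}"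
proof -
  \<comment> \<open>0 and \<open>s\<close> are added so that the increments start at time 0 and the
    last one before \<open>t\<close> ends exactly at \<open>s\<close>.\<close>
  obtain k :: nat and d :: "nat \<Rightarrow> real" where d: "insert 0 (insert s I) = d ` {..k}" "\<And>i j. i < j \<Longrightarrow> j \<le> k \<Longrightarrow> d i < d j"
    by (rule sorted_enum[of "insert 0 (insert s I)"]) (use I(1) in simp_all)
  have dmono: "d i \<le> d j" if "i \<le> j" "j \<le> k" for i j
    using d(2)[of i j] that by (cases "i = j") auto
  have dI: "d i \<in> insert 0 (insert s I)" if "i \<le> k" for i unfolding d(1) using that by simp
  have d0: "d 0 = 0"
  proof -
    have "0 \<in> d ` {..k}" unfolding d(1)[symmetric] by simp
    then obtain i where "i \<le> k" "d i = 0" by auto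
    then show ?thesis using dmono[of 0 i] dI[of 0] I(2) st by fastforce
  qed
  have dk: "d k = s"
  proof -
    have "s \<in> d ` {..k}" unfolding d(1)[symmetric] by simp
    then obtain i where "i \<le> k" "d i = s" by auto
    then show ?thesis using dmono[of i k] dI[of k] I(2) st by fastforce
  qed
  \<comment> \<open>Appending \<open>t\<close> makes the increment in question the one with index
    \<open>k\<close>.\<close>
  define \<tau> where "\<tau> i = (if i \<le> k then d i else t)" for i
  have \<tau>: "0 \<le> \<tau> 0" "\<forall>i<Suc k. \<tau> i \<le> \<tau> (Suc i)"
  proof -
    show "0 \<le> \<tau> 0" by (simp add: \<tau>_def d0)
    show "\<forall>i<Suc k. \<tau> i \<le> \<tau> (Suc i)"
    proof (intro allI impI)
      fix i assume "i < Suc k"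
      then show "\<tau> i \<le> \<tau> (Suc i)"
        using dmono[of i "Suc i"] dk st by (cases "i = k") (auto simp: \<tau>_def)
    qed
  qed
  define X where "X i \<omega> = B (\<tau> (Suc i)) \<omega> - B (\<tau> i) \<omega>" for i \<omega>
  have ind: "indep_vars (\<lambda>_. borel) X {..<Suc k}"
    using BM_indep[OF \<tau>] unfolding X_def[abs_def] .
  have Xk: "X k \<omega> = B t \<omega> - B s \<omega>" for \<omega> by (simp add: X_def \<tau>_def dk)
  have iv: "indep_var (PiM {..<k} (\<lambda>_. borel)) (\<lambda>\<omega>. restrict (\<lambda>i. X i \<omega>) {..<k})
              (PiM {k} (\<lambda>_. borel)) (\<lambda>\<omega>. restrict (\<lambda>i. X i \<omega>) {k})"
    using indep_var_restrict[OF ind, of "{..<k}" "{k}"] by auto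
  define pos where "pos r = (SOME j. j \<le> k \<and> d j = r)" for r
  have pos: "pos r \<le> k \<and> d (pos r) = r" if "r \<in> I" for r
  proof -
    have "r \<in> d ` {..k}" unfolding d(1)[symmetric] using that by simp
    then have "\<exists>j. j \<le> k \<and> d j = r" by auto
    then show ?thesis unfolding pos_def by (rule someI_ex)
  qed
  define C where "C = {x \<in> space (PiM {..<k} (\<lambda>_. borel :: real measure)). \<forall>r\<in>I. (\<Sum>i<pos r. x i) \<in> A r}"
  have C: "C \<in> sets (PiM {..<k} (\<lambda>_. borel))"
  proof -
    have "(\<lambda>x. \<Sum>i<pos r. x i) \<in> borel_measurable (PiM {..<k} (\<lambda>_. borel :: real measure))" if "r \<in> I" for r
    proof (rule borel_measurable_sum)
      fix i assume "i \<in> {..<pos r}"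
      then have "i \<in> {..<k}" using pos[OF that] by auto
      then show "(\<lambda>x. x i) \<in> borel_measurable (PiM {..<k} (\<lambda>_. borel :: real measure))" by measurable
    qed
    then have "{x \<in> space (PiM {..<k} (\<lambda>_. borel :: real measure)). (\<Sum>i<pos r. x i) \<in> A r}
        \<in> sets (PiM {..<k} (\<lambda>_. borel))" if "r \<in> I" for r
      using that A[OF that] by (intro measurable_Collect_mem)
    then show ?thesis unfolding C_def using I(1) by (intro sets.sets_Collect_finite_All) auto
  qed
  define D' where "D' = {x \<in> space (PiM {k} (\<lambda>_. borel :: real measure)). x k \<in> D}"
  have D': "D' \<in> sets (PiM {k} (\<lambda>_. borel))"
    unfolding D'_def by (rule measurable_Collect_mem[OF _ D]) simp
  have tel: "(\<Sum>i<j. X i \<omega>) = B (d j) \<omega> - B 0 \<omega>" if "j \<le> k" for j \<omega>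
  proof -
    have "(\<Sum>i<j. X i \<omega>) = (\<Sum>i<j. B (d (Suc i)) \<omega> - B (d i) \<omega>)"
      by (rule sum.cong) (use that in \<open>auto simp: X_def \<tau>_def\<close>)
    then show ?thesis using sum_lessThan_telescope[of "\<lambda>i. B (d i) \<omega>" j] d0 by simp
  qed
  have Cm: "{\<omega>\<in>space P. \<forall>r\<in>I. B r \<omega> \<in> A r} \<in> events"
  proof (rule sets.sets_Collect_finite_All)
    show "finite I" by (rule I(1))
    fix r assume "r \<in> I"
    then show "{\<omega> \<in> space P. B r \<omega> \<in> A r} \<in> events"
      using BM_measurable[of r] A[of r] I(2) by (intro measurable_Collect_mem) auto
  qed
  have Dm: "{\<omega>\<in>space P. B t \<omega> - B s \<omega> \<in> D} \<in> events"
    by (rule measurable_Collect_mem[OF borel_measurable_diff D]) (use BM_measurable st in auto)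
  have rv: "random_variable (PiM {..<k} (\<lambda>_. borel)) (\<lambda>\<omega>. restrict (\<lambda>i. X i \<omega>) {..<k})"
           "random_variable (PiM {k} (\<lambda>_. borel)) (\<lambda>\<omega>. restrict (\<lambda>i. X i \<omega>) {k})"
    using indep_var_rv1[OF iv] indep_var_rv2[OF iv] by auto
  \<comment> \<open>Partial sums of increments give \<open>B r - B 0\<close>, so the two events
    agree only up to the null set where \<open>B 0\<close> is not 0.\<close>
  have Cae: "AE \<omega> in P. \<omega> \<in> {\<omega>\<in>space P. \<forall>r\<in>I. B r \<omega> \<in> A r} \<longleftrightarrow>
       \<omega> \<in> (\<lambda>\<omega>. restrict (\<lambda>i. X i \<omega>) {..<k}) -` C \<inter> space P"
    using BM_zero
  proof eventually_elim
    case (elim \<omega>)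
    have "(\<Sum>i<pos r. restrict (\<lambda>i. X i \<omega>) {..<k} i) = B r \<omega>" if "r \<in> I" for r
    proof -
      have "(\<Sum>i<pos r. restrict (\<lambda>i. X i \<omega>) {..<k} i) = (\<Sum>i<pos r. X i \<omega>)"
        by (rule sum.cong) (use pos[OF that] in auto)
      then show ?thesis using tel[of "pos r"] pos[OF that] elim by simp
    qed
    then show ?case by (auto simp: C_def space_PiM)
  qed
  have Deq: "{\<omega>\<in>space P. B t \<omega> - B s \<omega> \<in> D} = (\<lambda>\<omega>. restrict (\<lambda>i. X i \<omega>) {k}) -` D' \<inter> space P"
    by (auto simp: D'_def space_PiM Xk)
  have 1: "prob {\<omega>\<in>space P. \<forall>r\<in>I. B r \<omega> \<in> A r} = prob ((\<lambda>\<omega>. restrict (\<lambda>i. X i \<omega>) {..<k}) -` C \<inter> space P)"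
    by (rule finite_measure_eq_AE[OF Cae Cm measurable_sets[OF rv(1) C]])
  have 2: "prob ({\<omega>\<in>space P. \<forall>r\<in>I. B r \<omega> \<in> A r} \<inter> {\<omega>\<in>space P. B t \<omega> - B s \<omega> \<in> D})
     = prob (((\<lambda>\<omega>. restrict (\<lambda>i. X i \<omega>) {..<k}) -` C \<inter> space P) \<inter> {\<omega>\<in>space P. B t \<omega> - B s \<omega> \<in> D})"
  proof (rule finite_measure_eq_AE)
    show "AE \<omega> in P. \<omega> \<in> {\<omega>\<in>space P. \<forall>r\<in>I. B r \<omega> \<in> A r} \<inter> {\<omega>\<in>space P. B t \<omega> - B s \<omega> \<in> D} \<longleftrightarrow>
       \<omega> \<in> (\<lambda>\<omega>. restrict (\<lambda>i. X i \<omega>) {..<k}) -` C \<inter> space P \<inter> {\<omega>\<in>space P. B t \<omega> - B s \<omega> \<in> D}"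
      using Cae by eventually_elim (simp only: Int_iff)
  qed (rule sets.Int Cm Dm measurable_sets[OF rv(1) C])+
  have 3: "(\<lambda>\<omega>. restrict (\<lambda>i. X i \<omega>) {..<k}) -` C \<inter> space P \<inter> ((\<lambda>\<omega>. restrict (\<lambda>i. X i \<omega>) {k}) -` D' \<inter> space P)
    = (\<lambda>\<omega>. (restrict (\<lambda>i. X i \<omega>) {..<k}, restrict (\<lambda>i. X i \<omega>) {k})) -` (C \<times> D') \<inter> space P"
    by blast
  show ?thesis unfolding 1 2 unfolding Deq 3 by (rule indep_varD[OF iv C D'])
qed

text \<open>Dynkin's argument. Cylinder events together with the null sets are stable under
  intersection and generate the augmented \<sigma>-algebra, and the events with the product rule are
  closed under complements and countable disjoint unions.\<close>

lemma prob_filtration_increment: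
  assumes st: "0 \<le> s" "s \<le> t" and C: "C \<in> sets (\<F> s)" and D: "D \<in> sets borel"
  shows "prob (C \<inter> {\<omega>\<in>space P. B t \<omega> - B s \<omega> \<in> D}) =
    prob C * prob {\<omega>\<in>space P. B t \<omega> - B s \<omega> \<in> D}"
proof (cases "s = t")
  case True
  have "C \<in> events" using C sets_filtration_subset by blast
  then have "C \<inter> space P = C" by (simp add: sets.Int_space_eq2)
  then show ?thesis using True by (cases "0 \<in> D") (simp_all add: prob_space)
next
  case False
  then have st': "s < t" using st by simp
  define E where "E = {\<omega>\<in>space P. B t \<omega> - B s \<omega> \<in> D}"
  have E: "E \<in> events" unfolding E_def
    by (rule measurable_Collect_mem[OF borel_measurable_diff D]) (use BM_measurable st in auto)
  define cyl where "cyl I A = {\<omega>\<in>space P. \<forall>r\<in>I. B r \<omega> \<in> A r}" for I A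
  define \<G> where "\<G> = {cyl I A |I A. finite I \<and> I \<subseteq> {0..s} \<and> (\<forall>r\<in>I. A r \<in> sets borel)}"
  \<comment> \<open>A time constrained by only one of the two cylinders receives the trivial
    constraint \<open>UNIV\<close> from the other.\<close>
  have cylI: "cyl I A \<inter> cyl J A' = cyl (I \<union> J) (\<lambda>r. (if r \<in> I then A r else UNIV) \<inter> (if r \<in> J then A' r else UNIV))"
    for I J A A' unfolding cyl_def by auto
  have "cyl I A \<in> events" if "finite I" "I \<subseteq> {0..s}" "\<forall>r\<in>I. A r \<in> sets borel" for I A
    unfolding cyl_def
  proof (rule sets.sets_Collect_finite_All)
    fix r assume "r \<in> I"
    then show "{\<omega> \<in> space P. B r \<omega> \<in> A r} \<in> events"
      using BM_measurable[of r] that by (intro measurable_Collect_mem) auto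
  qed (rule that(1))
  then have Gev: "\<G> \<subseteq> events" unfolding \<G>_def by blast
  have stable: "Int_stable (\<G> \<union> null_sets P)"
  proof (rule Int_stableI)
    fix X Y assume X: "X \<in> \<G> \<union> null_sets P" and Y: "Y \<in> \<G> \<union> null_sets P"
    show "X \<inter> Y \<in> \<G> \<union> null_sets P"
    proof (cases "X \<in> null_sets P \<or> Y \<in> null_sets P")
      case True
      moreover have "X \<in> events" "Y \<in> events" using X Y Gev by (auto dest: null_setsD2)
      ultimately have "X \<inter> Y \<in> null_sets P" by (elim disjE) (simp_all add: null_set_Int1 null_set_Int2)
      then show ?thesis by (rule UnI2)
    next
      case False
      with X Y have "X \<in> \<G>" "Y \<in> \<G>" by simp_all
      then obtain I A J A' where XY: "X = cyl I A" "Y = cyl J A'" "finite I" "finite J" "I \<subseteq> {0..s}" "J \<subseteq> {0..s}"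
        "\<forall>r\<in>I. A r \<in> sets borel" "\<forall>r\<in>J. A' r \<in> sets borel" unfolding \<G>_def by blast
      show ?thesis unfolding XY(1,2) cylI \<G>_def
        by (rule UnI1, rule CollectI, rule exI, rule exI, rule conjI[OF refl]) (use XY(3-) in auto)
    qed
  qed
  have "sets (\<F> s) \<subseteq> sigma_sets (space P) (\<G> \<union> null_sets P)"
    unfolding sets_bm_filtration
  proof (rule sigma_sets_mono', rule Un_mono[OF _ order_refl], rule subsetI)
    fix X assume "X \<in> {B r -` A \<inter> space P |r A. 0 \<le> r \<and> r \<le> s \<and> A \<in> sets borel}"
    then obtain r A where r: "X = B r -` A \<inter> space P" "0 \<le> r" "r \<le> s" "A \<in> sets borel" by blast
    have "X = cyl {r} (\<lambda>_. A)" unfolding r(1) cyl_def by auto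
    then show "X \<in> \<G>" unfolding \<G>_def using r by (intro CollectI exI[of _ "{r}"] exI[of _ "\<lambda>_. A"]) auto
  qed
  then have Csig: "C \<in> sigma_sets (space P) (\<G> \<union> null_sets P)" using C by blast
  have ev: "X \<in> events" if "X \<in> sigma_sets (space P) (\<G> \<union> null_sets P)" for X
  proof -
    have "\<G> \<union> null_sets P \<subseteq> events" using Gev by (auto dest: null_setsD2)
    then show ?thesis using that sets.sigma_sets_subset by blast
  qed
  have "prob (C \<inter> E) = prob C * prob E"
  proof (rule sigma_sets_induct_disjoint[OF stable _ Csig, where P="\<lambda>C. prob (C \<inter> E) = prob C * prob E"])
    show "\<G> \<union> null_sets P \<subseteq> Pow (space P)" using Gev sets.sets_into_space by (auto dest: null_sets.sets_into_space)
  next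
    fix X assume "X \<in> \<G> \<union> null_sets P"
    then show "prob (X \<inter> E) = prob X * prob E"
    proof
      assume "X \<in> \<G>"
      then obtain I A where X: "X = cyl I A" "finite I" "I \<subseteq> {0..s}" "\<forall>r\<in>I. A r \<in> sets borel" unfolding \<G>_def by blast
      show ?thesis unfolding X(1) cyl_def E_def
        by (rule prob_cylinder_increment[OF X(2,3) st(1) st' _ D]) (use X in auto)
    next
      assume X: "X \<in> null_sets P"
      then have "X \<inter> E \<in> null_sets P" using E by (rule null_set_Int2)
      then show ?thesis using X by (simp add: measure_def null_setsD1)
    qed
  next
    show "prob ({} \<inter> E) = prob {} * prob E" by simp
  next
    fix X assume X: "X \<in> sigma_sets (space P) (\<G> \<union> null_sets P)" "prob (X \<inter> E) = prob X * prob E"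
    have "(space P - X) \<inter> E = E - X \<inter> E" using sets.sets_into_space[OF E] by blast
    moreover have "prob (E - X \<inter> E) = prob E - prob (X \<inter> E)"
      by (rule finite_measure_Diff) (use ev[OF X(1)] E in auto)
    ultimately have "prob ((space P - X) \<inter> E) = (1 - prob X) * prob E"
      using X(2) by (simp add: left_diff_distrib)
    then show "prob ((space P - X) \<inter> E) = prob (space P - X) * prob E"
      by (simp only: prob_compl[OF ev[OF X(1)]])
  next
    fix X :: "nat \<Rightarrow> 'a set"
    assume X: "disjoint_family X" "range X \<subseteq> sigma_sets (space P) (\<G> \<union> null_sets P)"
      "\<And>i. prob (X i \<inter> E) = prob (X i) * prob E"
    have X': "range X \<subseteq> events" using X(2) ev by blast
    have "(\<lambda>i. prob (X i \<inter> E)) sums prob (\<Union>i. X i \<inter> E)"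
      by (rule finite_measure_UNION)
         (use X' E X(1) in \<open>auto simp: disjoint_family_on_def\<close>)
    moreover have "(\<lambda>i. prob (X i) * prob E) sums (prob (\<Union>i. X i) * prob E)"
      by (intro sums_mult2 finite_measure_UNION X' X(1))
    ultimately show "prob (\<Union> (range X) \<inter> E) = prob (\<Union> (range X)) * prob E"
      using X(3) sums_unique2[of "\<lambda>i. prob (X i) * prob E"] by simp
  qed
  then show ?thesis unfolding E_def .
qed

lemma indep_var_filtration_increment:
  assumes "0 \<le> s" "s \<le> t" and f: "f \<in> borel_measurable (\<F> s)"
  shows "indep_var borel f borel (\<lambda>\<omega>. B t \<omega> - B s \<omega>)"
  unfolding indep_var_eq
proof (intro conjI indep_setI)
  show "random_variable borel f" "random_variable borel (\<lambda>\<omega>. B t \<omega> - B s \<omega>)"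
    using measurable_filtration[OF f] BM_measurable assms(1,2) by auto
  then show "sigma_sets (space P) {f -` A \<inter> space P |A. A \<in> sets borel} \<subseteq> events"
    "sigma_sets (space P) {(\<lambda>\<omega>. B t \<omega> - B s \<omega>) -` A \<inter> space P |A. A \<in> sets borel} \<subseteq> events"
    by (intro sets.sigma_sets_subset; blast intro: measurable_sets)+
next
  fix X Y assume X: "X \<in> sigma_sets (space P) {f -` A \<inter> space P |A. A \<in> sets borel}"
    and Y: "Y \<in> sigma_sets (space P) {(\<lambda>\<omega>. B t \<omega> - B s \<omega>) -` A \<inter> space P |A. A \<in> sets borel}"
  have "sigma_sets (space P) {f -` A \<inter> space P |A. A \<in> sets borel} \<subseteq> sets (\<F> s)"
    using sets.sigma_sets_subset[of "{f -` A \<inter> space P |A. A \<in> sets borel}" "\<F> s"] measurable_sets[OF f]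
    unfolding space_bm_filtration by blast
  then have "X \<in> sets (\<F> s)" using X by blast
  have "Y \<in> {(\<lambda>\<omega>. B t \<omega> - B s \<omega>) -` A \<inter> space P |A. A \<in> sets borel}"
    using Y sigma_sets_vimage_commute[of "\<lambda>\<omega>. B t \<omega> - B s \<omega>" "space P" UNIV "sets borel"]
      sets.sigma_sets_eq[of "borel :: real measure"] by simp
  then obtain D where "Y = {\<omega>\<in>space P. B t \<omega> - B s \<omega> \<in> D}" "D \<in> sets borel" by auto
  then show "prob (X \<inter> Y) = prob X * prob Y"
    using prob_filtration_increment[OF assms(1,2) \<open>X \<in> sets (\<F> s)\<close>] by simp
qed

end

section \<open>Convergence in probability and sums of increments\<close>

lemma square_sum_le: "(x + y :: real)\<^sup>2 \<le> 2 * x\<^sup>2 + 2 * y\<^sup>2"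
  using sum_squares_bound[of x y] by (simp add: power2_sum)

context prob_space begin

text \<open>\<open>l0 A\<close> metrizes convergence in probability on the event \<open>A\<close>; being subadditive, it replaces the
  usual bookkeeping with two thresholds.\<close>

definition l0 :: "'a set \<Rightarrow> ('a \<Rightarrow> real) \<Rightarrow> real" where
  "l0 A Y = expectation (\<lambda>\<omega>. indicator A \<omega> * min 1 \<bar>Y \<omega>\<bar>)"

lemma integrable_l0:
  fixes Y :: "'a \<Rightarrow> real"
  assumes "A \<in> events" "Y \<in> borel_measurable M"
  shows "integrable M (\<lambda>\<omega>. indicator A \<omega> * min 1 \<bar>Y \<omega>\<bar>)"
proof (rule integrable_const_bound)
  show "AE \<omega> in M. norm (indicator A \<omega> * min 1 \<bar>Y \<omega>\<bar>) \<le> 1" by (auto simp: indicator_def)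
qed (use assms in auto)

lemma l0_nonneg: "0 \<le> l0 A Y"
  unfolding l0_def by (rule Bochner_Integration.integral_nonneg) simp

lemma l0_le:
  assumes "A \<in> events" "Y \<in> borel_measurable M" "integrable M g"
    and "AE \<omega> in M. \<omega> \<in> A \<longrightarrow> min 1 \<bar>Y \<omega>\<bar> \<le> g \<omega>" "AE \<omega> in M. 0 \<le> g \<omega>"
  shows "l0 A Y \<le> expectation g"
  unfolding l0_def
  by (rule integral_mono_AE[OF integrable_l0[OF assms(1,2)] assms(3)])
     (use assms(4,5) in eventually_elim, auto simp: indicator_def)

lemma l0_mono:
  assumes "A \<in> events" "Y \<in> borel_measurable M" "Y' \<in> borel_measurable M"
    and "AE \<omega> in M. \<omega> \<in> A \<longrightarrow> \<bar>Y \<omega>\<bar> \<le> \<bar>Y' \<omega>\<bar>"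
  shows "l0 A Y \<le> l0 A Y'"
  unfolding l0_def
  by (rule integral_mono_AE[OF integrable_l0 integrable_l0])
     (use assms in \<open>auto simp: indicator_def elim!: eventually_mono\<close>)

lemma l0_subset:
  assumes "A \<in> events" "O' \<in> events" "O' \<subseteq> A" "Y \<in> borel_measurable M"
  shows "l0 O' Y \<le> l0 A Y"
  unfolding l0_def
  by (rule integral_mono[OF integrable_l0 integrable_l0]) (use assms in \<open>auto simp: indicator_def\<close>)

lemma l0_add:
  assumes "A \<in> events" "Y \<in> borel_measurable M" "Y' \<in> borel_measurable M"
  shows "l0 A (\<lambda>\<omega>. Y \<omega> + Y' \<omega>) \<le> l0 A Y + l0 A Y'"
proof -
  have "l0 A (\<lambda>\<omega>. Y \<omega> + Y' \<omega>) \<le> expectation (\<lambda>\<omega>. indicator A \<omega> * min 1 \<bar>Y \<omega>\<bar> + indicator A \<omega> * min 1 \<bar>Y' \<omega>\<bar>)"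
    unfolding l0_def
    by (intro integral_mono integrable_l0 Bochner_Integration.integrable_add)
       (use assms in \<open>auto simp: indicator_def min_def\<close>)
  then show ?thesis unfolding l0_def using assms by (simp add: integrable_l0)
qed

lemma l0_uminus: "l0 A (\<lambda>\<omega>. - Y \<omega>) = l0 A Y"
  unfolding l0_def by simp

lemma l0_diff:
  assumes "A \<in> events" "Y \<in> borel_measurable M" "Y' \<in> borel_measurable M"
  shows "l0 A (\<lambda>\<omega>. Y \<omega> - Y' \<omega>) \<le> l0 A Y + l0 A Y'"
  using l0_add[of A Y "\<lambda>\<omega>. - Y' \<omega>"] assms by (simp add: l0_uminus)

lemma l0_sum:
  assumes "A \<in> events" "\<And>i. i \<in> I \<Longrightarrow> Y i \<in> borel_measurable M"
  shows "l0 A (\<lambda>\<omega>. \<Sum>i\<in>I. Y i \<omega>) \<le> (\<Sum>i\<in>I. l0 A (Y i))"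
  using assms(2)
proof (induction I rule: infinite_finite_induct)
  case (insert x F)
  have "l0 A (\<lambda>\<omega>. Y x \<omega> + (\<Sum>i\<in>F. Y i \<omega>)) \<le> l0 A (Y x) + l0 A (\<lambda>\<omega>. \<Sum>i\<in>F. Y i \<omega>)"
    using insert.prems by (intro l0_add assms(1) borel_measurable_sum) auto
  moreover have "l0 A (\<lambda>\<omega>. \<Sum>i\<in>F. Y i \<omega>) \<le> (\<Sum>i\<in>F. l0 A (Y i))"
    by (rule insert.IH) (use insert.prems in auto)
  ultimately show ?case using insert.hyps by simp
qed (auto simp: l0_def)

text \<open>With R at least 1, min 1 (R y) is at most R times min 1 y; for smaller R this fails,
  which is why later constants are enlarged to be at least 1.\<close>

lemma l0_mult:
  assumes "A \<in> events" "Y \<in> borel_measurable M" "Z \<in> borel_measurable M" "1 \<le> R"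
    and "AE \<omega> in M. \<omega> \<in> A \<longrightarrow> \<bar>Z \<omega>\<bar> \<le> R"
  shows "l0 A (\<lambda>\<omega>. Z \<omega> * Y \<omega>) \<le> R * l0 A Y"
proof -
  have "l0 A (\<lambda>\<omega>. Z \<omega> * Y \<omega>) \<le> expectation (\<lambda>\<omega>. R * (indicator A \<omega> * min 1 \<bar>Y \<omega>\<bar>))"
  proof (rule l0_le)
    show "AE \<omega> in M. \<omega> \<in> A \<longrightarrow> min 1 \<bar>Z \<omega> * Y \<omega>\<bar> \<le> R * (indicator A \<omega> * min 1 \<bar>Y \<omega>\<bar>)"
      using assms(5)
    proof eventually_elim
      case (elim \<omega>)
      show ?case
      proof
        assume "\<omega> \<in> A"
        with elim have "\<bar>Z \<omega>\<bar> \<le> R" by blast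
        then have "\<bar>Z \<omega> * Y \<omega>\<bar> \<le> R * \<bar>Y \<omega>\<bar>"
          using mult_right_mono[of "\<bar>Z \<omega>\<bar>" R "\<bar>Y \<omega>\<bar>"] by (simp add: abs_mult)
        then show "min 1 \<bar>Z \<omega> * Y \<omega>\<bar> \<le> R * (indicator A \<omega> * min 1 \<bar>Y \<omega>\<bar>)"
          using \<open>\<omega> \<in> A\<close> \<open>1 \<le> R\<close> by (simp add: min_def)
      qed
    qed
  qed (use assms integrable_l0[OF assms(1,2)] in auto)
  then show ?thesis by (simp add: l0_def)
qed

text \<open>The integrand of \<open>l0\<close> never exceeds 1, so shrinking the event costs at most
  the probability removed. This is how bad paths are discarded.\<close>

lemma l0_split:
  assumes "A \<in> events" "O' \<in> events" "O' \<subseteq> A" "Y \<in> borel_measurable M"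
  shows "l0 A Y \<le> l0 O' Y + prob (A - O')"
proof -
  have i: "integrable M (indicator (A - O') :: 'a \<Rightarrow> real)"
    using assms by (intro integrable_real_indicator) (auto simp: less_top[symmetric])
  have "l0 A Y \<le> expectation (\<lambda>\<omega>. indicator O' \<omega> * min 1 \<bar>Y \<omega>\<bar> + indicator (A - O') \<omega>)"
    by (rule l0_le[OF assms(1,4) Bochner_Integration.integrable_add[OF integrable_l0[OF assms(2,4)] i]])
       (auto simp: indicator_def)
  also have "\<dots> = l0 O' Y + prob (A - O')"
    unfolding l0_def Bochner_Integration.integral_add[OF integrable_l0[OF assms(2,4)] i]
    using assms by simp
  finally show ?thesis .
qed

text \<open>From 0 \<le> (|y| - c)^2 one gets |y| \<le> c / 2 + y^2 / (2 c); taking expectations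
  replaces the Cauchy-Schwarz inequality.\<close>

lemma l0_le_L2:
  assumes "A \<in> events" "Y \<in> borel_measurable M" "integrable M (\<lambda>\<omega>. indicator A \<omega> * (Y \<omega>)\<^sup>2)"
    and "expectation (\<lambda>\<omega>. indicator A \<omega> * (Y \<omega>)\<^sup>2) \<le> c\<^sup>2" "0 < c"
  shows "l0 A Y \<le> c"
proof -
  have "l0 A Y \<le> expectation (\<lambda>\<omega>. c / 2 + (indicator A \<omega> * (Y \<omega>)\<^sup>2) / (2 * c))"
  proof (rule l0_le)
    have "min 1 \<bar>y\<bar> \<le> c / 2 + y\<^sup>2 / (2 * c)" for y
    proof -
      have "0 \<le> (\<bar>y\<bar> - c)\<^sup>2 / (2 * c)" using assms(5) by simp
      also have "\<dots> = c / 2 + y\<^sup>2 / (2 * c) - \<bar>y\<bar>"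
        using assms(5) by (simp add: power2_eq_square field_simps)
      finally show ?thesis by simp
    qed
    then show "AE \<omega> in M. \<omega> \<in> A \<longrightarrow> min 1 \<bar>Y \<omega>\<bar> \<le> c / 2 + (indicator A \<omega> * (Y \<omega>)\<^sup>2) / (2 * c)"
      by simp
  qed (use assms in \<open>auto simp: indicator_def\<close>)
  also have "\<dots> = c / 2 + expectation (\<lambda>\<omega>. indicator A \<omega> * (Y \<omega>)\<^sup>2) / (2 * c)"
    using assms(3) by (simp add: prob_space)
  also have "\<dots> \<le> c / 2 + c\<^sup>2 / (2 * c)"
    using assms(4,5) by (intro add_left_mono divide_right_mono) auto
  also have "\<dots> = c" using assms(5) by (simp add: power2_eq_square)
  finally show ?thesis .
qed

lemma l0_eq_0_AE:
  assumes "A \<in> events" "Y \<in> borel_measurable M" "l0 A Y \<le> 0"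
  shows "AE \<omega> in M. \<omega> \<in> A \<longrightarrow> Y \<omega> = 0"
proof -
  have "l0 A Y = 0" using assms(3) l0_nonneg[of A Y] by simp
  then have "AE \<omega> in M. indicator A \<omega> * min 1 \<bar>Y \<omega>\<bar> = 0"
    unfolding l0_def
    by (subst (asm) integral_nonneg_eq_0_iff_AE[OF integrable_l0[OF assms(1,2)]]) auto
  then show ?thesis by eventually_elim (auto simp: indicator_def min_def split: if_splits)
qed

lemma l0_le_prob:
  assumes "Y \<in> borel_measurable M" "0 \<le> e" "A \<in> events"
  shows "l0 A Y \<le> e + prob {\<omega>\<in>A. e < \<bar>Y \<omega>\<bar>}"
proof -
  have "{\<omega>\<in>A. e < \<bar>Y \<omega>\<bar>} = A \<inter> {\<omega>\<in>space M. e < \<bar>Y \<omega>\<bar>}" using sets.sets_into_space[OF assms(3)] by auto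
  moreover have "{\<omega>\<in>space M. e < \<bar>Y \<omega>\<bar>} \<in> events" using assms(1) by measurable
  ultimately have ev: "{\<omega>\<in>A. e < \<bar>Y \<omega>\<bar>} \<in> events" using assms(3) by auto
  then have i: "integrable M (indicator {\<omega>\<in>A. e < \<bar>Y \<omega>\<bar>} :: 'a \<Rightarrow> real)"
    by (intro integrable_real_indicator) (auto simp: less_top[symmetric])
  have "l0 A Y \<le> expectation (\<lambda>\<omega>. e + indicator {\<omega>\<in>A. e < \<bar>Y \<omega>\<bar>} \<omega>)"
    by (rule l0_le[OF assms(3,1) Bochner_Integration.integrable_add[OF _ i]])
       (use assms in \<open>auto simp: indicator_def\<close>)
  then show ?thesis using ev i by (simp add: prob_space)
qed

end

lemma conv_in_prob_l0:
  assumes "prob_space P" "conv_in_prob P X L F"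
  shows "((\<lambda>i. prob_space.l0 P (space P) (\<lambda>\<omega>. X i \<omega> - L \<omega>)) \<longlongrightarrow> 0) F"
proof -
  interpret prob_space P by fact
  have L: "L \<in> borel_measurable P" and X: "\<forall>\<^sub>F i in F. X i \<in> borel_measurable P"
    and c: "\<And>e. e > 0 \<Longrightarrow> ((\<lambda>i. measure P {\<omega> \<in> space P. e < \<bar>X i \<omega> - L \<omega>\<bar>}) \<longlongrightarrow> 0) F"
    using assms(2) unfolding conv_in_prob_def by auto
  show ?thesis
  proof (rule tendstoI)
    fix e :: real assume "0 < e"
    have "\<forall>\<^sub>F i in F. measure P {\<omega> \<in> space P. e / 2 < \<bar>X i \<omega> - L \<omega>\<bar>} < e / 2"
      using order_tendstoD(2)[OF c[of "e / 2"], of "e / 2"] \<open>0 < e\<close> by simp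
    with X show "\<forall>\<^sub>F i in F. dist (l0 (space P) (\<lambda>\<omega>. X i \<omega> - L \<omega>)) 0 < e"
    proof eventually_elim
      case (elim i)
      have "l0 (space P) (\<lambda>\<omega>. X i \<omega> - L \<omega>) \<le> e / 2 + prob {\<omega>\<in>space P. e / 2 < \<bar>X i \<omega> - L \<omega>\<bar>}"
        by (rule l0_le_prob) (use elim L \<open>0 < e\<close> in auto)
      then show ?case using elim l0_nonneg[of "space P" "\<lambda>\<omega>. X i \<omega> - L \<omega>"] by (simp add: dist_real_def)
    qed
  qed
qed

section \<open>Second moments of sums with locally adapted coefficients\<close>

context brownian_motion begin

text \<open>The event \<open>A\<close> may lie outside the \<sigma>-algebra at time
  \<open>t\<close>, so multiplying by its indicator would destroy adaptedness. Asking only for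
  agreement on \<open>A\<close> with an adapted variable covers processes adapted to the enlarged
  filtration, on an event where the initial value is constant.\<close>

definition locadapted :: "'a set \<Rightarrow> real \<Rightarrow> ('a \<Rightarrow> real) \<Rightarrow> bool" where
  "locadapted A t f \<longleftrightarrow> (\<exists>g\<in>borel_measurable (\<F> t). AE \<omega> in P. \<omega> \<in> A \<longrightarrow> f \<omega> = g \<omega>)"

lemma locadapted_adapted: "f \<in> borel_measurable (\<F> t) \<Longrightarrow> locadapted A t f"
  unfolding locadapted_def by auto

lemma locadapted_mono: "locadapted A s f \<Longrightarrow> s \<le> t \<Longrightarrow> locadapted A t f"
  unfolding locadapted_def using measurable_bm_filtration_mono by blast

lemma locadapted_combine:
  assumes "locadapted A t f" "locadapted A t f'"
    and h: "(\<lambda>(x, y). h x y) \<in> borel_measurable (borel \<Otimes>\<^sub>M borel)"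
  shows "locadapted A t (\<lambda>\<omega>. h (f \<omega>) (f' \<omega>))"
proof -
  obtain g g' where g: "g \<in> borel_measurable (\<F> t)" "g' \<in> borel_measurable (\<F> t)"
    "AE \<omega> in P. \<omega> \<in> A \<longrightarrow> f \<omega> = g \<omega>" "AE \<omega> in P. \<omega> \<in> A \<longrightarrow> f' \<omega> = g' \<omega>"
    using assms unfolding locadapted_def by blast
  have "(\<lambda>\<omega>. h (g \<omega>) (g' \<omega>)) \<in> borel_measurable (\<F> t)"
    using measurable_compose[OF measurable_Pair[OF g(1,2)] h] by simp
  moreover have "AE \<omega> in P. \<omega> \<in> A \<longrightarrow> h (f \<omega>) (f' \<omega>) = h (g \<omega>) (g' \<omega>)"
    using g(3,4) by eventually_elim simp
  ultimately show ?thesis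
    unfolding locadapted_def by (intro bexI[of _ "\<lambda>\<omega>. h (g \<omega>) (g' \<omega>)"])
qed

lemma locadapted_diff: "locadapted A t f \<Longrightarrow> locadapted A t f' \<Longrightarrow> locadapted A t (\<lambda>\<omega>. f \<omega> - f' \<omega>)"
  by (rule locadapted_combine) measurable

lemma locadapted_mult: "locadapted A t f \<Longrightarrow> locadapted A t f' \<Longrightarrow> locadapted A t (\<lambda>\<omega>. f \<omega> * f' \<omega>)"
  by (rule locadapted_combine) measurable

text \<open>A discrete Ito isometry. The functions \<open>h i\<close> are kept general because two
  instances are used: the increment itself and its square minus its mean. Boundedness of the
  coefficients secures integrability of the products.\<close>

lemma expectation_sum_increments:
  fixes a b :: "nat \<Rightarrow> real" and h :: "nat \<Rightarrow> real \<Rightarrow> real" and \<xi> :: "nat \<Rightarrow> 'a \<Rightarrow> real"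
  defines "\<eta> \<equiv> \<lambda>i \<omega>. h i (B (b i) \<omega> - B (a i) \<omega>)"
  assumes ab: "\<And>i. i < N \<Longrightarrow> 0 \<le> a i \<and> a i \<le> b i" "\<And>i j. i < j \<Longrightarrow> j < N \<Longrightarrow> b i \<le> a j"
    and \<xi>: "\<And>i. i < N \<Longrightarrow> \<xi> i \<in> borel_measurable (\<F> (a i))"
      "\<And>i. i < N \<Longrightarrow> \<exists>K. \<forall>\<omega>\<in>space P. \<bar>\<xi> i \<omega>\<bar> \<le> K"
    and h: "\<And>i. i < N \<Longrightarrow> h i \<in> borel_measurable borel"
      "\<And>i. i < N \<Longrightarrow> integrable P (\<lambda>\<omega>. (\<eta> i \<omega>)\<^sup>2)"
      "\<And>i. i < N \<Longrightarrow> expectation (\<eta> i) = 0"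
      "\<And>i. i < N \<Longrightarrow> expectation (\<lambda>\<omega>. (\<eta> i \<omega>)\<^sup>2) = v i"
  shows "integrable P (\<lambda>\<omega>. (\<Sum>i<N. \<xi> i \<omega> * \<eta> i \<omega>)\<^sup>2) \<and> (\<forall>i<N. integrable P (\<lambda>\<omega>. (\<xi> i \<omega>)\<^sup>2)) \<and>
    expectation (\<lambda>\<omega>. (\<Sum>i<N. \<xi> i \<omega> * \<eta> i \<omega>)\<^sup>2) = (\<Sum>i<N. expectation (\<lambda>\<omega>. (\<xi> i \<omega>)\<^sup>2) * v i)"
  using assms(2-)
proof (induction N)
  case 0
  then show ?case by simp
next
  case (Suc N)
  define S where "S \<omega> = (\<Sum>i<N. \<xi> i \<omega> * \<eta> i \<omega>)" for \<omega>
  have IH: "integrable P (\<lambda>\<omega>. (S \<omega>)\<^sup>2)" "\<forall>i<N. integrable P (\<lambda>\<omega>. (\<xi> i \<omega>)\<^sup>2)"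
    "expectation (\<lambda>\<omega>. (S \<omega>)\<^sup>2) = (\<Sum>i<N. expectation (\<lambda>\<omega>. (\<xi> i \<omega>)\<^sup>2) * v i)"
    using Suc.IH Suc.prems by (auto simp: S_def less_Suc_eq)
  have a: "0 \<le> a N" "a N \<le> b N" and bi: "\<And>i. i < N \<Longrightarrow> b i \<le> a N"
    using Suc.prems(1)[of N] Suc.prems(2) by auto
  have mE: "\<eta> i \<in> borel_measurable (\<F> t)" if "i < Suc N" "b i \<le> t" for i t
  proof -
    have 0: "0 \<le> a i" "a i \<le> b i" using Suc.prems(1)[OF that(1)] by auto
    have "(\<lambda>\<omega>. B (b i) \<omega> - B (a i) \<omega>) \<in> borel_measurable (\<F> t)"
      using 0 that by (intro borel_measurable_diff BM_adapted) auto
    then show ?thesis unfolding \<eta>_def using Suc.prems(5)[OF that(1)] by (rule measurable_compose)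
  qed
  have S: "S \<in> borel_measurable (\<F> (a N))"
    unfolding S_def[abs_def]
  proof (intro borel_measurable_sum borel_measurable_times)
    fix i assume "i \<in> {..<N}"
    then have i: "i < N" by simp
    show "\<eta> i \<in> borel_measurable (\<F> (a N))" using mE[of i "a N"] bi[OF i] i by simp
    show "\<xi> i \<in> borel_measurable (\<F> (a N))"
    proof (rule measurable_bm_filtration_mono)
      show "a i \<le> a N" using bi[OF i] Suc.prems(1)[of i] i by simp
      show "\<xi> i \<in> borel_measurable (\<F> (a i))" using Suc.prems(3)[of i] i by simp
    qed
  qed
  have \<xi>N: "\<xi> N \<in> borel_measurable (\<F> (a N))" using Suc.prems(3)[of N] by simp
  obtain K where K: "\<And>\<omega>. \<omega> \<in> space P \<Longrightarrow> \<bar>\<xi> N \<omega>\<bar> \<le> K" using Suc.prems(4)[of N] by auto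
  have mP: "S \<in> borel_measurable P" "\<xi> N \<in> borel_measurable P" "\<eta> N \<in> borel_measurable P"
    using S \<xi>N mE[of N "b N"] measurable_filtration by auto
  have iS: "integrable P S" by (rule square_integrable_imp_integrable[OF mP(1) IH(1)])
  have i\<eta>2: "integrable P (\<lambda>\<omega>. (\<eta> N \<omega>)\<^sup>2)" using Suc.prems(6)[of N] by simp
  have i\<eta>: "integrable P (\<eta> N)" by (rule square_integrable_imp_integrable[OF mP(3) i\<eta>2])
  have i\<xi>2: "integrable P (\<lambda>\<omega>. (\<xi> N \<omega>)\<^sup>2)"
  proof (rule integrable_const_bound[OF AE_I2])
    fix \<omega> assume "\<omega> \<in> space P"
    then have "\<bar>\<xi> N \<omega>\<bar>\<^sup>2 \<le> K\<^sup>2" using K by (intro power_mono) auto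
    then show "norm ((\<xi> N \<omega>)\<^sup>2) \<le> K\<^sup>2" by simp
  qed (use mP in measurable)
  have iS\<xi>: "integrable P (\<lambda>\<omega>. S \<omega> * \<xi> N \<omega>)"
  proof (rule Bochner_Integration.integrable_bound[OF integrable_mult_right[OF iS, of K]])
    show "AE \<omega> in P. norm (S \<omega> * \<xi> N \<omega>) \<le> norm (K * S \<omega>)"
    proof (rule AE_I2)
      fix \<omega> assume "\<omega> \<in> space P"
      then have "\<bar>S \<omega>\<bar> * \<bar>\<xi> N \<omega>\<bar> \<le> \<bar>S \<omega>\<bar> * \<bar>K\<bar>" using K by (intro mult_left_mono) force+
      then show "norm (S \<omega> * \<xi> N \<omega>) \<le> norm (K * S \<omega>)" by (simp add: abs_mult mult.commute)
    qed
  qed (use mP in measurable)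
  \<comment> \<open>All earlier terms and the last coefficient are known at time \<open>a N\<close>,
    so the cross term has the factor \<open>expectation (\<eta> N)\<close>, which is 0.\<close>
  have ind1: "indep_var borel (\<lambda>\<omega>. S \<omega> * \<xi> N \<omega>) borel (\<eta> N)"
  proof -
    have "indep_var borel (\<lambda>\<omega>. S \<omega> * \<xi> N \<omega>) borel (\<lambda>\<omega>. B (b N) \<omega> - B (a N) \<omega>)"
      by (rule indep_var_filtration_increment[OF a]) (use S \<xi>N in measurable)
    then have "indep_var borel (id \<circ> (\<lambda>\<omega>. S \<omega> * \<xi> N \<omega>)) borel (h N \<circ> (\<lambda>\<omega>. B (b N) \<omega> - B (a N) \<omega>))"
      by (rule indep_var_compose) (use Suc.prems(5)[of N] in auto)
    then show ?thesis by (simp add: \<eta>_def comp_def)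
  qed
  have ind2: "indep_var borel (\<lambda>\<omega>. (\<xi> N \<omega>)\<^sup>2) borel (\<lambda>\<omega>. (\<eta> N \<omega>)\<^sup>2)"
  proof -
    have "indep_var borel (\<lambda>\<omega>. (\<xi> N \<omega>)\<^sup>2) borel (\<lambda>\<omega>. B (b N) \<omega> - B (a N) \<omega>)"
      by (rule indep_var_filtration_increment[OF a]) (use \<xi>N in measurable)
    then have "indep_var borel (id \<circ> (\<lambda>\<omega>. (\<xi> N \<omega>)\<^sup>2)) borel ((\<lambda>x. (h N x)\<^sup>2) \<circ> (\<lambda>\<omega>. B (b N) \<omega> - B (a N) \<omega>))"
      by (rule indep_var_compose) (use Suc.prems(5)[of N] in auto)
    then show ?thesis by (simp add: \<eta>_def comp_def)
  qed
  have i1: "integrable P (\<lambda>\<omega>. (S \<omega> * \<xi> N \<omega>) * \<eta> N \<omega>)"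
    by (rule indep_var_integrable[OF ind1 iS\<xi> i\<eta>])
  have e1: "expectation (\<lambda>\<omega>. (S \<omega> * \<xi> N \<omega>) * \<eta> N \<omega>) = 0"
    using indep_var_lebesgue_integral[OF ind1 iS\<xi> i\<eta>] Suc.prems(7)[of N] by simp
  have i2: "integrable P (\<lambda>\<omega>. (\<xi> N \<omega>)\<^sup>2 * (\<eta> N \<omega>)\<^sup>2)"
    by (rule indep_var_integrable[OF ind2 i\<xi>2 i\<eta>2])
  have e2: "expectation (\<lambda>\<omega>. (\<xi> N \<omega>)\<^sup>2 * (\<eta> N \<omega>)\<^sup>2) = expectation (\<lambda>\<omega>. (\<xi> N \<omega>)\<^sup>2) * v N"
    using indep_var_lebesgue_integral[OF ind2 i\<xi>2 i\<eta>2] Suc.prems(8)[of N] by simp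
  have eq: "(\<Sum>i<Suc N. \<xi> i \<omega> * \<eta> i \<omega>)\<^sup>2 = (S \<omega>)\<^sup>2 + 2 * ((S \<omega> * \<xi> N \<omega>) * \<eta> N \<omega>) + (\<xi> N \<omega>)\<^sup>2 * (\<eta> N \<omega>)\<^sup>2" for \<omega>
    by (simp add: S_def[symmetric] power2_sum power_mult_distrib)
  show ?case unfolding eq
    using IH i1 i2 e1 e2 i\<xi>2 by (auto simp: less_Suc_eq)
qed

text \<open>Neither the event \<open>O'\<close> nor the bound \<open>K\<close> on it respects the
  filtration. The isometry is therefore applied on the whole space to other coefficients, which are
  adapted and bounded everywhere and coincide with the given ones on \<open>O'\<close>.\<close>

lemma sum_increments_L2_bound:
  fixes a b :: "nat \<Rightarrow> real" and h :: "nat \<Rightarrow> real \<Rightarrow> real" and \<xi> :: "nat \<Rightarrow> 'a \<Rightarrow> real"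
  defines "\<eta> \<equiv> \<lambda>i \<omega>. h i (B (b i) \<omega> - B (a i) \<omega>)"
  assumes A: "A \<in> events" "O' \<in> events" "O' \<subseteq> A"
    and ab: "\<And>i. i < N \<Longrightarrow> 0 \<le> a i \<and> a i \<le> b i" "\<And>i j. i < j \<Longrightarrow> j < N \<Longrightarrow> b i \<le> a j"
    and \<xi>: "\<And>i. i < N \<Longrightarrow> \<xi> i \<in> borel_measurable P" "\<And>i. i < N \<Longrightarrow> locadapted A (a i) (\<xi> i)"
      "\<And>i. i < N \<Longrightarrow> AE \<omega> in P. \<omega> \<in> O' \<longrightarrow> \<bar>\<xi> i \<omega>\<bar> \<le> K" "0 \<le> K"
    and h: "\<And>i. i < N \<Longrightarrow> h i \<in> borel_measurable borel"
      "\<And>i. i < N \<Longrightarrow> integrable P (\<lambda>\<omega>. (\<eta> i \<omega>)\<^sup>2)"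
      "\<And>i. i < N \<Longrightarrow> expectation (\<eta> i) = 0"
      "\<And>i. i < N \<Longrightarrow> expectation (\<lambda>\<omega>. (\<eta> i \<omega>)\<^sup>2) = v i"
  shows "integrable P (\<lambda>\<omega>. indicator O' \<omega> * (\<Sum>i<N. \<xi> i \<omega> * \<eta> i \<omega>)\<^sup>2)"
    "expectation (\<lambda>\<omega>. indicator O' \<omega> * (\<Sum>i<N. \<xi> i \<omega> * \<eta> i \<omega>)\<^sup>2) \<le> K\<^sup>2 * (\<Sum>i<N. v i)"
proof -
  have "\<forall>i\<in>{..<N}. \<exists>g. g \<in> borel_measurable (\<F> (a i)) \<and> (AE \<omega> in P. \<omega> \<in> A \<longrightarrow> \<xi> i \<omega> = g \<omega>)"
    using \<xi>(2) unfolding locadapted_def by blast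
  then obtain g where g: "\<And>i. i < N \<Longrightarrow> g i \<in> borel_measurable (\<F> (a i))"
    "\<And>i. i < N \<Longrightarrow> AE \<omega> in P. \<omega> \<in> A \<longrightarrow> \<xi> i \<omega> = g i \<omega>" by (metis bchoice lessThan_iff)
  \<comment> \<open>Clipping an adapted variable keeps it adapted, and it changes nothing on
    \<open>O'\<close>, where the values already lie between -K and K.\<close>
  define \<xi>' where "\<xi>' i \<omega> = max (- K) (min K (g i \<omega>))" for i \<omega>
  have bd: "\<bar>\<xi>' i \<omega>\<bar> \<le> K" for i \<omega> using \<xi>(4) by (auto simp: \<xi>'_def)
  have iso: "integrable P (\<lambda>\<omega>. (\<Sum>i<N. \<xi>' i \<omega> * \<eta> i \<omega>)\<^sup>2) \<and> (\<forall>i<N. integrable P (\<lambda>\<omega>. (\<xi>' i \<omega>)\<^sup>2)) \<and>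
    expectation (\<lambda>\<omega>. (\<Sum>i<N. \<xi>' i \<omega> * \<eta> i \<omega>)\<^sup>2) = (\<Sum>i<N. expectation (\<lambda>\<omega>. (\<xi>' i \<omega>)\<^sup>2) * v i)"
    unfolding \<eta>_def
  proof (rule expectation_sum_increments[OF ab])
    fix i assume "i < N"
    show "\<xi>' i \<in> borel_measurable (\<F> (a i))" unfolding \<xi>'_def[abs_def] using g(1)[OF \<open>i < N\<close>] by measurable
    show "\<exists>K. \<forall>\<omega>\<in>space P. \<bar>\<xi>' i \<omega>\<bar> \<le> K" using bd by blast
  qed (use h in \<open>auto simp: \<eta>_def\<close>)
  have "AE \<omega> in P. \<forall>i\<in>{..<N}. (\<omega> \<in> A \<longrightarrow> \<xi> i \<omega> = g i \<omega>) \<and> (\<omega> \<in> O' \<longrightarrow> \<bar>\<xi> i \<omega>\<bar> \<le> K)"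
    by (subst AE_finite_all) (use g(2) \<xi>(3) in auto)
  then have le: "AE \<omega> in P. indicator O' \<omega> * (\<Sum>i<N. \<xi> i \<omega> * \<eta> i \<omega>)\<^sup>2 \<le> (\<Sum>i<N. \<xi>' i \<omega> * \<eta> i \<omega>)\<^sup>2"
  proof eventually_elim
    case (elim \<omega>)
    have "(\<Sum>i<N. \<xi> i \<omega> * \<eta> i \<omega>) = (\<Sum>i<N. \<xi>' i \<omega> * \<eta> i \<omega>)" if "\<omega> \<in> O'"
    proof (rule sum.cong[OF refl])
      fix i assume "i \<in> {..<N}"
      with elim that A(3) have "\<xi> i \<omega> = g i \<omega>" "\<bar>\<xi> i \<omega>\<bar> \<le> K" by auto
      then have "\<xi>' i \<omega> = \<xi> i \<omega>" unfolding \<xi>'_def by auto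
      then show "\<xi> i \<omega> * \<eta> i \<omega> = \<xi>' i \<omega> * \<eta> i \<omega>" by simp
    qed
    then show ?case by (auto simp: indicator_def)
  qed
  have \<eta>: "\<eta> i \<in> borel_measurable P" if "i < N" for i
    unfolding \<eta>_def using BM_measurable[of "a i"] BM_measurable[of "b i"] ab(1)[OF that]
    by (intro measurable_compose[OF borel_measurable_diff h(1)[OF that]]) auto
  show int: "integrable P (\<lambda>\<omega>. indicator O' \<omega> * (\<Sum>i<N. \<xi> i \<omega> * \<eta> i \<omega>)\<^sup>2)"
  proof (rule Bochner_Integration.integrable_bound[OF conjunct1[OF iso]])
    have "(\<lambda>\<omega>. \<Sum>i<N. \<xi> i \<omega> * \<eta> i \<omega>) \<in> borel_measurable P"
      using \<xi>(1) \<eta> by (intro borel_measurable_sum borel_measurable_times) auto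
    then show "(\<lambda>\<omega>. indicator O' \<omega> * (\<Sum>i<N. \<xi> i \<omega> * \<eta> i \<omega>)\<^sup>2) \<in> borel_measurable P"
      using A(2) by measurable
  qed (use le in \<open>eventually_elim, simp\<close>)
  have v: "0 \<le> v i" if "i < N" for i using h(4)[OF that, symmetric] by simp
  have "expectation (\<lambda>\<omega>. indicator O' \<omega> * (\<Sum>i<N. \<xi> i \<omega> * \<eta> i \<omega>)\<^sup>2) \<le> expectation (\<lambda>\<omega>. (\<Sum>i<N. \<xi>' i \<omega> * \<eta> i \<omega>)\<^sup>2)"
    by (rule integral_mono_AE[OF int conjunct1[OF iso] le])
  also have "\<dots> = (\<Sum>i<N. expectation (\<lambda>\<omega>. (\<xi>' i \<omega>)\<^sup>2) * v i)" using iso by simp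
  also have "\<dots> \<le> (\<Sum>i<N. K\<^sup>2 * v i)"
  proof (intro sum_mono mult_right_mono)
    fix i assume "i \<in> {..<N}"
    then have "expectation (\<lambda>\<omega>. (\<xi>' i \<omega>)\<^sup>2) \<le> expectation (\<lambda>_. K\<^sup>2)"
      using iso bd \<xi>(4) by (intro integral_mono) (auto simp: abs_le_square_iff[symmetric])
    then show "expectation (\<lambda>\<omega>. (\<xi>' i \<omega>)\<^sup>2) \<le> K\<^sup>2" by (simp add: prob_space)
  qed (use v in auto)
  finally show "expectation (\<lambda>\<omega>. indicator O' \<omega> * (\<Sum>i<N. \<xi> i \<omega> * \<eta> i \<omega>)\<^sup>2) \<le> K\<^sup>2 * (\<Sum>i<N. v i)"
    by (simp add: sum_distrib_left)
qed

end

section \<open>Moments of increments and regularity of paths\<close>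

context brownian_motion begin

lemma increment_moment:
  assumes "0 \<le> s" "s < t"
  shows "has_bochner_integral P (\<lambda>\<omega>. (B t \<omega> - B s \<omega>) ^ (2 * k)) (fact (2 * k) / ((2 / (t - s)) ^ k * fact k))"
    and "has_bochner_integral P (\<lambda>\<omega>. (B t \<omega> - B s \<omega>) ^ (2 * k + 1)) 0"
proof -
  note d = BM_increment[OF assms]
  have pos: "0 < sqrt (t - s)" using assms by simp
  have *: "has_bochner_integral P (\<lambda>\<omega>. (B t \<omega> - B s \<omega>) ^ j) c"
    if "has_bochner_integral lborel (\<lambda>x. normal_density 0 (sqrt (t - s)) x * x ^ j) c" for j c
    using that distributed_integrable[OF d, of "\<lambda>x. x ^ j"] distributed_integral[OF d, of "\<lambda>x. x ^ j"]
    by (simp add: has_bochner_integral_iff)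
  show "has_bochner_integral P (\<lambda>\<omega>. (B t \<omega> - B s \<omega>) ^ (2 * k)) (fact (2 * k) / ((2 / (t - s)) ^ k * fact k))"
    using *[OF normal_moment_even[OF pos, of 0 k, simplified]] assms by simp
  show "has_bochner_integral P (\<lambda>\<omega>. (B t \<omega> - B s \<omega>) ^ (2 * k + 1)) 0"
    using *[of "2 * k + 1"] normal_moment_odd[OF pos, of 0 k] by simp
qed

lemma increment_mean_var:
  assumes "0 \<le> s" "s \<le> t"
  shows "integrable P (\<lambda>\<omega>. (B t \<omega> - B s \<omega>)\<^sup>2)" "integrable P (\<lambda>\<omega>. B t \<omega> - B s \<omega>)"
    "expectation (\<lambda>\<omega>. B t \<omega> - B s \<omega>) = 0"
    "expectation (\<lambda>\<omega>. (B t \<omega> - B s \<omega>)\<^sup>2) = t - s"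
proof -
  have "has_bochner_integral P (\<lambda>\<omega>. (B t \<omega> - B s \<omega>)\<^sup>2) (t - s)"
  proof (cases "s = t")
    case False
    then have st: "s < t" using assms by simp
    then have eq: "fact (2 * 1) / ((2 / (t - s)) ^ 1 * fact 1) = t - s" by (simp add: fact_2 field_simps)
    show ?thesis using increment_moment(1)[OF assms(1) st, of 1] unfolding eq by simp
  qed (simp add: has_bochner_integral_iff)
  then show "integrable P (\<lambda>\<omega>. (B t \<omega> - B s \<omega>)\<^sup>2)" "expectation (\<lambda>\<omega>. (B t \<omega> - B s \<omega>)\<^sup>2) = t - s"
    by (simp_all add: has_bochner_integral_iff)
  have "has_bochner_integral P (\<lambda>\<omega>. B t \<omega> - B s \<omega>) 0"
  proof (cases "s = t")
    case False
    then show ?thesis using increment_moment(2)[of s t 0] assms by simp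
  qed (simp add: has_bochner_integral_iff)
  then show "integrable P (\<lambda>\<omega>. B t \<omega> - B s \<omega>)" "expectation (\<lambda>\<omega>. B t \<omega> - B s \<omega>) = 0"
    by (simp_all add: has_bochner_integral_iff)
qed

text \<open>A centred Gaussian of variance v has fourth moment 3 v^2, so its square has variance 3
  v^2 - v^2.\<close>

lemma increment_square_mean_var:
  assumes "0 \<le> s" "s < t"
  defines "\<eta> \<equiv> \<lambda>\<omega>. (B t \<omega> - B s \<omega>)\<^sup>2 - (t - s)"
  shows "integrable P (\<lambda>\<omega>. (\<eta> \<omega>)\<^sup>2)" "expectation \<eta> = 0"
    "expectation (\<lambda>\<omega>. (\<eta> \<omega>)\<^sup>2) = 2 * (t - s)\<^sup>2"
proof -
  have 4: "has_bochner_integral P (\<lambda>\<omega>. (B t \<omega> - B s \<omega>) ^ 4) (3 * (t - s)\<^sup>2)"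
  proof -
    have "fact (2 * 2) / ((2 / (t - s)) ^ 2 * fact 2) = 3 * (t - s)\<^sup>2"
      using assms by (simp add: fact_numeral power_divide)
    then show ?thesis using increment_moment(1)[OF assms(1,2), of 2] by simp
  qed
  have 2: "has_bochner_integral P (\<lambda>\<omega>. (B t \<omega> - B s \<omega>)\<^sup>2) (t - s)"
    using increment_mean_var[of s t] assms by (simp add: has_bochner_integral_iff)
  have c: "has_bochner_integral P (\<lambda>\<omega>. c) c" for c :: real
    by (simp add: has_bochner_integral_iff prob_space)
  show "expectation \<eta> = 0" unfolding \<eta>_def
    using has_bochner_integral_diff[OF 2 c[of "t - s"]] by (simp add: has_bochner_integral_iff)
  have "(x\<^sup>2 - c)\<^sup>2 = x ^ 4 - (2 * c) * x\<^sup>2 + c\<^sup>2" for x c :: real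
    by (simp add: power2_eq_square power4_eq_xxxx algebra_simps)
  then have "(\<eta> \<omega>)\<^sup>2 = (B t \<omega> - B s \<omega>) ^ 4 - (2 * (t - s)) * (B t \<omega> - B s \<omega>)\<^sup>2 + (t - s)\<^sup>2" for \<omega>
    unfolding \<eta>_def .
  then have eq: "(\<lambda>\<omega>. (\<eta> \<omega>)\<^sup>2) = (\<lambda>\<omega>. (B t \<omega> - B s \<omega>) ^ 4 - (2 * (t - s)) * (B t \<omega> - B s \<omega>)\<^sup>2 + (t - s)\<^sup>2)"
    by auto
  have "has_bochner_integral P (\<lambda>\<omega>. (\<eta> \<omega>)\<^sup>2) (3 * (t - s)\<^sup>2 - (2 * (t - s)) * (t - s) + (t - s)\<^sup>2)"
    unfolding eq
    by (rule has_bochner_integral_add[OF has_bochner_integral_diff[OF 4 has_bochner_integral_mult_right[OF 2]] c])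
  then show "integrable P (\<lambda>\<omega>. (\<eta> \<omega>)\<^sup>2)" "expectation (\<lambda>\<omega>. (\<eta> \<omega>)\<^sup>2) = 2 * (t - s)\<^sup>2"
    by (simp_all add: has_bochner_integral_iff power2_eq_square)
qed

end

section \<open>Continuous paths controlled through rational times\<close>

lemma floor_approx:
  fixes s :: real
  assumes "0 \<le> s"
  shows "(\<lambda>n. of_int \<lfloor>real (Suc n) * s\<rfloor> / real (Suc n)) \<longlonglongrightarrow> s"
    and "of_int \<lfloor>real (Suc n) * s\<rfloor> / real (Suc n) \<le> s" "0 \<le> of_int \<lfloor>real (Suc n) * s\<rfloor> / real (Suc n)"
    and "of_int \<lfloor>real (Suc n) * s\<rfloor> / real (Suc n) \<in> \<rat>"
proof -
  have lo: "s - 1 / real (Suc n) \<le> of_int \<lfloor>real (Suc n) * s\<rfloor> / real (Suc n)"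
    and up: "of_int \<lfloor>real (Suc n) * s\<rfloor> / real (Suc n) \<le> s" for n
  proof -
    have 1: "real (Suc n) * s - 1 \<le> of_int \<lfloor>real (Suc n) * s\<rfloor>" "of_int \<lfloor>real (Suc n) * s\<rfloor> \<le> real (Suc n) * s"
      by linarith+
    have "(real (Suc n) * s - 1) / real (Suc n) \<le> of_int \<lfloor>real (Suc n) * s\<rfloor> / real (Suc n)"
      by (rule divide_right_mono[OF 1(1)]) simp
    then show "s - 1 / real (Suc n) \<le> of_int \<lfloor>real (Suc n) * s\<rfloor> / real (Suc n)"
      by (simp add: diff_divide_distrib)
    have "of_int \<lfloor>real (Suc n) * s\<rfloor> / real (Suc n) \<le> (real (Suc n) * s) / real (Suc n)"
      by (rule divide_right_mono[OF 1(2)]) simp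
    then show "of_int \<lfloor>real (Suc n) * s\<rfloor> / real (Suc n) \<le> s" by simp
  qed
  have l: "(\<lambda>n. s - 1 / real (Suc n)) \<longlonglongrightarrow> s"
    using tendsto_diff[OF tendsto_const LIMSEQ_inverse_real_of_nat, of s] by (simp add: inverse_eq_divide)
  show "(\<lambda>n. of_int \<lfloor>real (Suc n) * s\<rfloor> / real (Suc n)) \<longlonglongrightarrow> s"
    by (rule tendsto_sandwich[OF _ _ l tendsto_const]) (use lo up in auto)
  show "of_int \<lfloor>real (Suc n) * s\<rfloor> / real (Suc n) \<le> s" by (rule up)
  show "0 \<le> of_int \<lfloor>real (Suc n) * s\<rfloor> / real (Suc n)" using assms by (intro divide_nonneg_nonneg) auto
  show "of_int \<lfloor>real (Suc n) * s\<rfloor> / real (Suc n) \<in> \<rat>" by (intro Rats_divide) (auto simp del: of_nat_Suc)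
qed

lemma continuous_rational_bound:
  fixes f :: "real \<Rightarrow> real"
  assumes c: "continuous_on {0..T} f" and q: "\<And>q. q \<in> \<rat> \<inter> {0..T} \<Longrightarrow> \<bar>f q\<bar> \<le> K" and s: "s \<in> {0..T}"
  shows "\<bar>f s\<bar> \<le> K"
proof -
  define r where "r n = of_int \<lfloor>real (Suc n) * s\<rfloor> / real (Suc n)" for n
  have r: "r \<longlonglongrightarrow> s" "\<And>n. r n \<in> \<rat> \<inter> {0..T}"
    unfolding r_def using floor_approx[of s] s by (auto intro: order_trans simp del: of_nat_Suc)
  have "(\<lambda>n. f (r n)) \<longlonglongrightarrow> f s"
    by (rule continuous_on_tendsto_compose[OF c r(1) s]) (use r(2) in auto)
  then have "(\<lambda>n. \<bar>f (r n)\<bar>) \<longlonglongrightarrow> \<bar>f s\<bar>" by (rule tendsto_rabs)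
  then show ?thesis by (rule LIMSEQ_le_const2) (use q r(2) in auto)
qed

text \<open>The strict inequality in the premise is an open condition and so holds eventually for
  rational approximants of both times; the weak one in the conclusion is closed and survives the
  limit.\<close>

lemma continuous_rational_modulus:
  fixes f :: "real \<Rightarrow> real"
  assumes c: "continuous_on {0..T} f"
    and q: "\<And>q q'. q \<in> \<rat> \<inter> {0..T} \<Longrightarrow> q' \<in> \<rat> \<inter> {0..T} \<Longrightarrow> \<bar>q - q'\<bar> < h \<Longrightarrow> \<bar>f q - f q'\<bar> \<le> K"
    and s: "s \<in> {0..T}" "s' \<in> {0..T}" "\<bar>s - s'\<bar> < h"
  shows "\<bar>f s - f s'\<bar> \<le> K"
proof -
  define r where "r s n = of_int \<lfloor>real (Suc n) * s\<rfloor> / real (Suc n)" for n s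
  have r: "r s \<longlonglongrightarrow> s" "\<And>n. r s n \<in> \<rat> \<inter> {0..T}" if "s \<in> {0..T}" for s
    unfolding r_def using floor_approx[of s] that by (auto intro: order_trans simp del: of_nat_Suc)
  have lf: "(\<lambda>n. f (r s n)) \<longlonglongrightarrow> f s" if "s \<in> {0..T}" for s
    by (rule continuous_on_tendsto_compose[OF c r(1)[OF that] that]) (use r(2) that in auto)
  have "(\<lambda>n. \<bar>r s n - r s' n\<bar>) \<longlonglongrightarrow> \<bar>s - s'\<bar>"
    by (intro tendsto_rabs tendsto_diff r s)
  then have ev: "\<forall>\<^sub>F n in sequentially. \<bar>r s n - r s' n\<bar> < h"
    using s(3) by (rule order_tendstoD(2))
  have "(\<lambda>n. \<bar>f (r s n) - f (r s' n)\<bar>) \<longlonglongrightarrow> \<bar>f s - f s'\<bar>"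
    by (intro tendsto_rabs tendsto_diff lf s)
  moreover have "\<forall>\<^sub>F n in sequentially. \<bar>f (r s n) - f (r s' n)\<bar> \<le> K"
    using ev by eventually_elim (use q r(2) s in auto)
  ultimately show ?thesis by (rule tendsto_upperbound) simp
qed

context prob_space begin

lemma exhaustion:
  fixes G :: "nat \<Rightarrow> 'a set"
  assumes "\<And>k. G k \<in> events" "\<And>k. G k \<subseteq> G (Suc k)" "AE \<omega> in M. \<exists>k. \<omega> \<in> G k" "0 < \<eta>"
  shows "\<exists>k. prob (space M - G k) \<le> \<eta>"
proof -
  have "incseq G" using assms(2) by (simp add: incseq_SucI)
  then have "(\<lambda>k. prob (G k)) \<longlonglongrightarrow> prob (\<Union>k. G k)"
    using assms(1) by (intro finite_Lim_measure_incseq) auto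
  moreover have "prob (\<Union>k. G k) = 1"
    by (rule prob_eq_1[THEN iffD2]) (use assms in auto)
  ultimately have "\<forall>\<^sub>F k in sequentially. 1 - \<eta> < prob (G k)"
    using order_tendstoD(1)[of "\<lambda>k. prob (G k)" 1 sequentially "1 - \<eta>"] assms(4) by simp
  then obtain k where "1 - \<eta> < prob (G k)" by (auto simp: eventually_sequentially)
  then have "prob (space M - G k) \<le> \<eta>" using prob_compl[OF assms(1)] by simp
  then show ?thesis ..
qed

text \<open>\<open>M\<close> need not be complete, so the set where an almost sure property holds
  need not be an event. This supplies an event of full probability inside it.\<close>

lemma AE_event:
  assumes "AE \<omega> in M. Q \<omega>"
  obtains O' where "O' \<in> events" "prob (space M - O') = 0" "\<And>\<omega>. \<omega> \<in> O' \<Longrightarrow> Q \<omega>" "AE \<omega> in M. \<omega> \<in> O'"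
proof -
  obtain N where N: "{\<omega> \<in> space M. \<not> Q \<omega>} \<subseteq> N" "emeasure M N = 0" "N \<in> events"
    using AE_E[OF assms] by blast
  show ?thesis
  proof (rule that[of "space M - N"])
    show "space M - N \<in> events" using N by auto
    have "space M - (space M - N) = N" using sets.sets_into_space[OF N(3)] by auto
    then show "prob (space M - (space M - N)) = 0" using N by (simp add: measure_def)
    show "\<And>\<omega>. \<omega> \<in> space M - N \<Longrightarrow> Q \<omega>" using N by auto
    have "N \<in> null_sets M" using N by auto
    then have "AE \<omega> in M. \<omega> \<notin> N" by (rule AE_not_in)
    then show "AE \<omega> in M. \<omega> \<in> space M - N" using AE_space by eventually_elim simp
  qed
qed

lemma events_Collect_Ball:
  assumes "countable X" "\<And>i. i \<in> X \<Longrightarrow> {\<omega>\<in>space M. Q i \<omega>} \<in> events"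
  shows "{\<omega>\<in>space M. \<forall>i\<in>X. Q i \<omega>} \<in> events"
proof -
  have "{\<omega>\<in>space M. \<forall>i\<in>X. Q i \<omega>} = space M - (\<Union>i\<in>X. space M - {\<omega>\<in>space M. Q i \<omega>})" by auto
  also have "\<dots> \<in> events" using assms by (intro sets.Diff sets.top sets.countable_UN') auto
  finally show ?thesis .
qed

text \<open>Each continuous path on a compact interval has its own bound; giving up probability
  \<eta> turns it into a deterministic one. Bounding at rational times only makes the condition an
  event, and continuity extends it to all times.\<close>

lemma bounded_path_event:
  fixes Y :: "real \<Rightarrow> 'a \<Rightarrow> real"
  assumes Y: "\<And>t. t \<in> {0..T} \<Longrightarrow> Y t \<in> borel_measurable M"
    and c: "AE \<omega> in M. continuous_on {0..T} (\<lambda>t. Y t \<omega> :: real)" and "0 < \<eta>"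
  obtains K :: nat and O' where "O' \<in> events" "prob (space M - O') \<le> \<eta>"
    "\<And>\<omega>. \<omega> \<in> O' \<Longrightarrow> continuous_on {0..T} (\<lambda>t. Y t \<omega>)"
    "\<And>\<omega> s. \<omega> \<in> O' \<Longrightarrow> s \<in> {0..T} \<Longrightarrow> \<bar>Y s \<omega>\<bar> \<le> K"
proof -
  obtain C where C: "C \<in> events" "prob (space M - C) = 0" "\<And>\<omega>. \<omega> \<in> C \<Longrightarrow> continuous_on {0..T} (\<lambda>t. Y t \<omega>)"
    "AE \<omega> in M. \<omega> \<in> C" using AE_event[OF c] by blast
  define G where "G k = {\<omega>\<in>space M. \<omega> \<in> C \<and> (\<forall>q\<in>\<rat> \<inter> {0..T}. \<bar>Y q \<omega>\<bar> \<le> real k)}" for k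
  have G: "G k \<in> events" for k
    unfolding G_def
  proof (intro sets.sets_Collect_conj events_Collect_Ball)
    show "countable (\<rat> \<inter> {0..T})" by (intro countable_Int1 countable_rat)
    show "{\<omega> \<in> space M. \<omega> \<in> C} \<in> events" using C(1) by measurable
    fix q assume "q \<in> \<rat> \<inter> {0..T}"
    then have [measurable]: "Y q \<in> borel_measurable M" using Y[of q] by simp
    show "{\<omega> \<in> space M. \<bar>Y q \<omega>\<bar> \<le> real k} \<in> events" by measurable
  qed
  have mono: "G k \<subseteq> G (Suc k)" for k unfolding G_def by force
  have exh: "AE \<omega> in M. \<exists>k. \<omega> \<in> G k"
    using C(4) AE_space
  proof eventually_elim
    case (elim \<omega>)
    have "compact ((\<lambda>t. Y t \<omega>) ` {0..T})" using C(3)[OF elim(1)] by (intro compact_continuous_image) auto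
    then have "bounded ((\<lambda>t. Y t \<omega>) ` {0..T})" by (rule compact_imp_bounded)
    then obtain b where "\<And>x. x \<in> (\<lambda>t. Y t \<omega>) ` {0..T} \<Longrightarrow> norm x \<le> b" unfolding bounded_iff by blast
    then have b: "\<bar>Y t \<omega>\<bar> \<le> b" if "t \<in> {0..T}" for t using that by force
    obtain k :: nat where "b \<le> real k" using real_arch_simple by blast
    then have "\<bar>Y q \<omega>\<bar> \<le> real k" if "q \<in> {0..T}" for q using b[OF that] by linarith
    then have "\<omega> \<in> G k" unfolding G_def using elim by simp
    then show ?case ..
  qed
  obtain k where k: "prob (space M - G k) \<le> \<eta>" using exhaustion[OF G mono exh \<open>0 < \<eta>\<close>] by blast
  show ?thesis
  proof (rule that[OF G k])
    fix \<omega> assume \<omega>: "\<omega> \<in> G k"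
    then show cont: "continuous_on {0..T} (\<lambda>t. Y t \<omega>)" using C(3) by (auto simp: G_def)
    fix s assume "s \<in> {0..T}"
    show "\<bar>Y s \<omega>\<bar> \<le> k"
      by (rule continuous_rational_bound[OF cont _ \<open>s \<in> {0..T}\<close>]) (use \<omega> in \<open>simp add: G_def\<close>)
  qed
qed

lemma modulus_path_event:
  fixes Y :: "real \<Rightarrow> 'a \<Rightarrow> real"
  assumes Y: "\<And>t. t \<in> {0..T} \<Longrightarrow> Y t \<in> borel_measurable M"
    and c: "AE \<omega> in M. continuous_on {0..T} (\<lambda>t. Y t \<omega> :: real)" and "0 < \<eta>" "0 < \<delta>"
  obtains h and O' where "0 < h" "O' \<in> events" "prob (space M - O') \<le> \<eta>"
    "\<And>\<omega> s s'. \<omega> \<in> O' \<Longrightarrow> s \<in> {0..T} \<Longrightarrow> s' \<in> {0..T} \<Longrightarrow> \<bar>s - s'\<bar> < h \<Longrightarrow> \<bar>Y s \<omega> - Y s' \<omega>\<bar> \<le> \<delta>"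
proof -
  obtain C where C: "C \<in> events" "prob (space M - C) = 0" "\<And>\<omega>. \<omega> \<in> C \<Longrightarrow> continuous_on {0..T} (\<lambda>t. Y t \<omega>)"
    "AE \<omega> in M. \<omega> \<in> C" using AE_event[OF c] by blast
  define G where "G k = {\<omega>\<in>space M. \<omega> \<in> C \<and> (\<forall>q\<in>\<rat> \<inter> {0..T}. \<forall>q'\<in>\<rat> \<inter> {0..T}.
    \<bar>q - q'\<bar> < 1 / real (Suc k) \<longrightarrow> \<bar>Y q \<omega> - Y q' \<omega>\<bar> \<le> \<delta>)}" for k
  have G: "G k \<in> events" for k
    unfolding G_def
  proof (intro sets.sets_Collect_conj events_Collect_Ball sets.sets_Collect_imp)
    show "countable (\<rat> \<inter> {0..T})" by (intro countable_Int1 countable_rat)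
    then show "countable (\<rat> \<inter> {0..T})" .
    show "{\<omega> \<in> space M. \<omega> \<in> C} \<in> events" using C(1) by measurable
    fix q q' assume "q \<in> \<rat> \<inter> {0..T}" "q' \<in> \<rat> \<inter> {0..T}"
    then have [measurable]: "Y q \<in> borel_measurable M" "Y q' \<in> borel_measurable M" using Y by simp_all
    show "{\<omega> \<in> space M. \<bar>Y q \<omega> - Y q' \<omega>\<bar> \<le> \<delta>} \<in> events" by measurable
    show "{\<omega> \<in> space M. \<bar>q - q'\<bar> < 1 / real (Suc k)} \<in> events" by simp
  qed
  have mono: "G k \<subseteq> G (Suc k)" for k
  proof -
    have "1 / real (Suc (Suc k)) \<le> 1 / real (Suc k)" by (intro divide_left_mono) auto
    then show ?thesis unfolding G_def by (auto simp del: of_nat_Suc dest: less_le_trans)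
  qed
  have exh: "AE \<omega> in M. \<exists>k. \<omega> \<in> G k"
    using C(4) AE_space
  proof eventually_elim
    case (elim \<omega>)
    have "uniformly_continuous_on {0..T} (\<lambda>t. Y t \<omega>)"
      using C(3)[OF elim(1)] by (intro compact_uniformly_continuous) auto
    then obtain d where d: "0 < d" "\<And>s s'. s \<in> {0..T} \<Longrightarrow> s' \<in> {0..T} \<Longrightarrow> \<bar>s' - s\<bar> < d \<Longrightarrow> \<bar>Y s' \<omega> - Y s \<omega>\<bar> < \<delta>"
      unfolding uniformly_continuous_on_def dist_real_def using \<open>0 < \<delta>\<close> by metis
    obtain k where k: "1 / real (Suc k) < d"
      using reals_Archimedean[OF d(1)] by (auto simp: inverse_eq_divide)
    have "\<bar>Y q \<omega> - Y q' \<omega>\<bar> \<le> \<delta>" if "q \<in> {0..T}" "q' \<in> {0..T}" "\<bar>q - q'\<bar> < 1 / real (Suc k)" for q q'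
      using d(2)[of q' q] that k by linarith
    then have "\<omega> \<in> G k" unfolding G_def using elim by (simp del: of_nat_Suc)
    then show ?case ..
  qed
  obtain k where k: "prob (space M - G k) \<le> \<eta>" using exhaustion[OF G mono exh \<open>0 < \<eta>\<close>] by blast
  show ?thesis
  proof (rule that[OF _ G k])
    show "0 < 1 / real (Suc k)" by simp
    fix \<omega> s s' assume \<omega>: "\<omega> \<in> G k" and s: "s \<in> {0..T}" "s' \<in> {0..T}" "\<bar>s - s'\<bar> < 1 / real (Suc k)"
    have cont: "continuous_on {0..T} (\<lambda>t. Y t \<omega>)" using \<omega> C(3) by (simp add: G_def)
    show "\<bar>Y s \<omega> - Y s' \<omega>\<bar> \<le> \<delta>"
      by (rule continuous_rational_modulus[OF cont _ s]) (use \<omega> in \<open>simp add: G_def del: of_nat_Suc\<close>)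
  qed
qed

end

section \<open>Elementary estimates for one time step\<close>

lemma exp_diff_abs_le:
  fixes u v :: real
  assumes "u \<le> L" "v \<le> L"
  shows "\<bar>exp u - exp v\<bar> \<le> exp L * \<bar>u - v\<bar>"
proof -
  have *: "\<bar>exp u - exp v\<bar> \<le> exp L * \<bar>u - v\<bar>" if "u \<le> v" "v \<le> L" for u v
  proof -
    have "1 - exp (u - v) \<le> v - u" using exp_ge_add_one_self[of "u - v"] by linarith
    then have "exp v * (1 - exp (u - v)) \<le> exp v * (v - u)" by (intro mult_left_mono) auto
    also have "\<dots> \<le> exp L * (v - u)" using that by (intro mult_right_mono) auto
    finally show ?thesis using that by (simp add: right_diff_distrib exp_diff)
  qed
  show ?thesis using *[of u v] *[of v u] assms by (cases "u \<le> v") (auto simp: abs_minus_commute)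
qed

text \<open>This is Ito's formula for \<open>Z X\<close> in one step: the exponential is the factor
  by which \<open>Z\<close> changes, the other factor is an Euler step for \<open>X\<close>. The
  terms linear in x cancel, those linear in \<Delta> leave \<sigma>^2 / 2, and those in x^2 leave
  \<sigma>^2 / 2 - \<sigma>^2. The error has the form (\<delta> + \<Delta>) (x^2 + \<Delta>) because
  x^2 + \<Delta>, summed over a grid with x an increment of \<open>B\<close>, has expectation 2
  T.\<close>

lemma one_step_defect:
  fixes \<mu> \<sigma> :: real
  obtains C where "0 \<le> C" "\<And>x \<Delta> \<delta>. \<bar>x\<bar> \<le> \<delta> \<Longrightarrow> \<delta> \<le> 1 \<Longrightarrow> 0 \<le> \<Delta> \<Longrightarrow> \<Delta> \<le> 1 \<Longrightarrow>
    \<bar>exp (- \<sigma> * x - (\<mu> - \<sigma>\<^sup>2 / 2) * \<Delta>) * (1 + \<mu> * \<Delta> + \<sigma> * x) - 1 - \<sigma>\<^sup>2 / 2 * (\<Delta> - x\<^sup>2)\<bar>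
      \<le> C * (\<delta> + \<Delta>) * (x\<^sup>2 + \<Delta>)"
proof -
  define a where "a = \<mu> - \<sigma>\<^sup>2 / 2"
  define L where "L = \<bar>\<sigma>\<bar> + \<bar>a\<bar> + \<bar>\<mu>\<bar>"
  have L: "\<bar>\<sigma>\<bar> \<le> L" "\<bar>a\<bar> \<le> L" "\<bar>\<mu>\<bar> \<le> L" "0 \<le> L" unfolding L_def by auto
  \<comment> \<open>The summands bound, in this order, the mixed term x \<Delta>, the terms in
    \<Delta>^2, the product of y^2 / 2 with \<mu> \<Delta> + \<sigma> x, and the Taylor remainder of
    the exponential.\<close>
  define C where "C = L\<^sup>2 + (a\<^sup>2 / 2 + \<bar>a * \<mu>\<bar>) + 2 * L ^ 3 + 2 * L ^ 3 * exp (2 * L) * (1 + 2 * L)"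
  show ?thesis
  proof
    show "0 \<le> C" unfolding C_def using L by simp
    fix x \<Delta> \<delta> :: real assume x: "\<bar>x\<bar> \<le> \<delta>" "\<delta> \<le> 1" "0 \<le> \<Delta>" "\<Delta> \<le> 1"
    define y where "y = - (\<sigma> * x + a * \<Delta>)"
    define m where "m = \<bar>x\<bar> + \<Delta>"
    define q where "q = (\<delta> + \<Delta>) * (x\<^sup>2 + \<Delta>)"
    have m: "0 \<le> m" "m \<le> \<delta> + \<Delta>" "m \<le> 2" using x by (auto simp: m_def)
    have \<sigma>x: "\<bar>\<sigma> * x\<bar> \<le> L * \<bar>x\<bar>" "\<bar>\<mu> * \<Delta>\<bar> \<le> L * \<Delta>" "\<bar>a * \<Delta>\<bar> \<le> L * \<Delta>"
      using L x by (auto simp: abs_mult intro!: mult_right_mono)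
    have y: "\<bar>y\<bar> \<le> L * m" unfolding y_def m_def using \<sigma>x by (simp add: distrib_left)
    have z: "\<bar>\<mu> * \<Delta> + \<sigma> * x\<bar> \<le> L * m" unfolding m_def using \<sigma>x by (simp add: distrib_left)
    have Lm: "L * m \<le> 2 * L" using mult_left_mono[OF m(3) L(4)] by simp
    have q0: "0 \<le> q" unfolding q_def using x by simp
    have "m\<^sup>2 \<le> 2 * (x\<^sup>2 + \<Delta>)"
    proof -
      have "m\<^sup>2 \<le> 2 * \<bar>x\<bar>\<^sup>2 + 2 * \<Delta>\<^sup>2" unfolding m_def by (rule square_sum_le)
      moreover have "\<Delta>\<^sup>2 \<le> \<Delta>" using x by (simp add: power2_eq_square mult_left_le)
      ultimately show ?thesis by simp
    qed
    \<comment> \<open>Every cubic remainder is reduced to \<open>q\<close> in this way: one factor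
      \<open>m\<close> is at most \<delta> + \<Delta>, and the other two give at most 2 (x^2 +
      \<Delta>).\<close>
    then have "m * m\<^sup>2 \<le> (\<delta> + \<Delta>) * (2 * (x\<^sup>2 + \<Delta>))" using m by (intro mult_mono) auto
    then have m3: "m ^ 3 \<le> 2 * q" by (simp add: q_def power3_eq_cube power2_eq_square algebra_simps)
    have e: "\<bar>exp y - (1 + y + y\<^sup>2 / 2)\<bar> \<le> exp (2 * L) * (L ^ 3 * m ^ 3)"
    proof -
      have "\<bar>exp y - (1 + y + y\<^sup>2 / 2)\<bar> \<le> exp \<bar>y\<bar> * \<bar>y\<bar> ^ 3 / 2"
        using Taylor_exp_field[of y 2] by (simp add: numeral_2_eq_2 power2_eq_square numeral_3_eq_3)
      also have "\<dots> \<le> exp \<bar>y\<bar> * \<bar>y\<bar> ^ 3" by simp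
      also have "\<dots> \<le> exp (2 * L) * (L * m) ^ 3"
        using y Lm by (intro mult_mono power_mono) auto
      finally show ?thesis by (simp add: power_mult_distrib)
    qed
    have z1: "\<bar>1 + (\<mu> * \<Delta> + \<sigma> * x)\<bar> \<le> 1 + 2 * L" using z Lm by linarith
    have e1: "\<bar>(exp y - (1 + y + y\<^sup>2 / 2)) * (1 + (\<mu> * \<Delta> + \<sigma> * x))\<bar> \<le> 2 * L ^ 3 * exp (2 * L) * (1 + 2 * L) * q"
    proof -
      have "\<bar>(exp y - (1 + y + y\<^sup>2 / 2)) * (1 + (\<mu> * \<Delta> + \<sigma> * x))\<bar> \<le> (exp (2 * L) * (L ^ 3 * m ^ 3)) * (1 + 2 * L)"
        unfolding abs_mult by (rule mult_mono[OF e z1]) (use L m in auto)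
      also have "\<dots> \<le> (exp (2 * L) * (L ^ 3 * (2 * q))) * (1 + 2 * L)"
        using m3 L by (intro mult_right_mono mult_left_mono) auto
      finally show ?thesis by (simp add: mult_ac)
    qed
    have y2: "\<bar>y\<^sup>2 / 2 * (\<mu> * \<Delta> + \<sigma> * x)\<bar> \<le> 2 * L ^ 3 * q"
    proof -
      have "\<bar>y\<^sup>2 / 2 * (\<mu> * \<Delta> + \<sigma> * x)\<bar> \<le> y\<^sup>2 * \<bar>\<mu> * \<Delta> + \<sigma> * x\<bar>" by (simp add: abs_mult mult_nonneg_nonneg)
      also have "\<dots> \<le> (L * m)\<^sup>2 * (L * m)"
        using power_mono[OF y, of 2] z L m by (intro mult_mono) auto
      also have "\<dots> = L ^ 3 * m ^ 3" by (simp add: power3_eq_cube power2_eq_square)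
      also have "\<dots> \<le> L ^ 3 * (2 * q)" using m3 L by (intro mult_left_mono) auto
      finally show ?thesis by (simp add: mult_ac)
    qed
    have xD: "\<bar>\<sigma> * \<mu> * (x * \<Delta>)\<bar> \<le> L\<^sup>2 * q"
    proof -
      have "\<bar>x\<bar> * \<Delta> \<le> (\<delta> + \<Delta>) * (x\<^sup>2 + \<Delta>)" using x by (intro mult_mono) auto
      moreover have "\<bar>\<sigma> * \<mu>\<bar> \<le> L * L" using L unfolding abs_mult by (intro mult_mono) auto
      ultimately have "\<bar>\<sigma> * \<mu>\<bar> * (\<bar>x\<bar> * \<Delta>) \<le> (L * L) * q"
        unfolding q_def using x L by (intro mult_mono) auto
      then show ?thesis using x by (simp add: abs_mult power2_eq_square)
    qed
    have D2: "\<bar>(a\<^sup>2 / 2 - a * \<mu>) * \<Delta>\<^sup>2\<bar> \<le> (a\<^sup>2 / 2 + \<bar>a * \<mu>\<bar>) * q"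
    proof -
      have "\<Delta> * \<Delta> \<le> (\<delta> + \<Delta>) * (x\<^sup>2 + \<Delta>)" using x by (intro mult_mono) auto
      moreover have "\<bar>a\<^sup>2 / 2 - a * \<mu>\<bar> \<le> a\<^sup>2 / 2 + \<bar>a * \<mu>\<bar>"
        using abs_triangle_ineq4[of "a\<^sup>2 / 2" "a * \<mu>"] by simp
      ultimately have "\<bar>a\<^sup>2 / 2 - a * \<mu>\<bar> * (\<Delta> * \<Delta>) \<le> (a\<^sup>2 / 2 + \<bar>a * \<mu>\<bar>) * q"
        unfolding q_def using x by (intro mult_mono) auto
      then show ?thesis using x by (simp add: abs_mult power2_eq_square)
    qed
    define w where "w = 1 + (\<mu> * \<Delta> + \<sigma> * x)"
    define p where "p = 1 + y + y\<^sup>2 / 2"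
    define S where "S = \<sigma>\<^sup>2 / 2 * (\<Delta> - x\<^sup>2)"
    have E1: "exp (- \<sigma> * x - (\<mu> - \<sigma>\<^sup>2 / 2) * \<Delta>) = exp y" by (simp add: y_def a_def)
    \<comment> \<open>The choice of \<open>a\<close> makes y + \<mu> \<Delta> + \<sigma> x equal to
      \<sigma>^2 \<Delta> / 2, and the contributions a \<sigma> x \<Delta> of y^2 / 2 and of the
      product cancel.\<close>
    have E2: "(1 + y + y\<^sup>2 / 2) * (1 + (\<mu> * \<Delta> + \<sigma> * x)) - 1 - \<sigma>\<^sup>2 / 2 * (\<Delta> - x\<^sup>2)
       = - (\<sigma> * \<mu> * (x * \<Delta>)) + (a\<^sup>2 / 2 - a * \<mu>) * \<Delta>\<^sup>2 + y\<^sup>2 / 2 * (\<mu> * \<Delta> + \<sigma> * x)"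
      unfolding y_def a_def by (simp add: power2_eq_square field_simps)
    have "exp (- \<sigma> * x - (\<mu> - \<sigma>\<^sup>2 / 2) * \<Delta>) * (1 + \<mu> * \<Delta> + \<sigma> * x) - 1 - \<sigma>\<^sup>2 / 2 * (\<Delta> - x\<^sup>2)
      = exp y * w - 1 - S" unfolding E1 w_def S_def by (simp add: add.assoc)
    also have "\<dots> = (exp y - p) * w + (p * w - 1 - S)" by (simp add: left_diff_distrib)
    also have "\<dots> = (exp y - (1 + y + y\<^sup>2 / 2)) * (1 + (\<mu> * \<Delta> + \<sigma> * x))
        + (- (\<sigma> * \<mu> * (x * \<Delta>)) + (a\<^sup>2 / 2 - a * \<mu>) * \<Delta>\<^sup>2 + y\<^sup>2 / 2 * (\<mu> * \<Delta> + \<sigma> * x))"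
      unfolding w_def p_def S_def E2 ..
    also have "\<bar>\<dots>\<bar> \<le> 2 * L ^ 3 * exp (2 * L) * (1 + 2 * L) * q + (L\<^sup>2 * q + (a\<^sup>2 / 2 + \<bar>a * \<mu>\<bar>) * q + 2 * L ^ 3 * q)"
    proof -
      have "\<bar>u + (- v + w + z)\<bar> \<le> k + (l + m + n)"
        if "\<bar>u\<bar> \<le> k" "\<bar>v\<bar> \<le> l" "\<bar>w\<bar> \<le> m" "\<bar>z\<bar> \<le> n" for u v w z k l m n :: real
        using that by linarith
      then show ?thesis using e1 xD D2 y2 by blast
    qed
    also have "\<dots> = C * (\<delta> + \<Delta>) * (x\<^sup>2 + \<Delta>)" unfolding C_def q_def by (simp add: algebra_simps)
    finally show "\<bar>exp (- \<sigma> * x - (\<mu> - \<sigma>\<^sup>2 / 2) * \<Delta>) * (1 + \<mu> * \<Delta> + \<sigma> * x) - 1 - \<sigma>\<^sup>2 / 2 * (\<Delta> - x\<^sup>2)\<bar>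
      \<le> C * (\<delta> + \<Delta>) * (x\<^sup>2 + \<Delta>)" .
  qed
qed

section \<open>Discretization of the linear equation\<close>

lemma set_lebesgue_integral_eq_integral:
  fixes f :: "real \<Rightarrow> real"
  assumes "continuous_on {a..b} f"
  shows "(LINT u:{a..b}|lborel. f u) = integral {a..b} f"
  by (rule set_borel_integral_eq_integral(2)[OF borel_integrable_atLeastAtMost'[OF assms]])

lemma integral_increment_bound:
  fixes f :: "real \<Rightarrow> real"
  assumes c: "continuous_on {0..T} f" and st: "0 \<le> s" "s \<le> t" "t \<le> T"
    and d: "\<And>u. s \<le> u \<Longrightarrow> u \<le> t \<Longrightarrow> \<bar>f u - f s\<bar> \<le> \<delta>"
  shows "\<bar>(LINT u:{0..t}|lborel. f u) - (LINT u:{0..s}|lborel. f u) - f s * (t - s)\<bar> \<le> \<delta> * (t - s)"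
proof -
  have c0: "continuous_on {0..t} f" and c1: "continuous_on {0..s} f" and c2: "continuous_on {s..t} f"
    using st by (auto intro!: continuous_on_subset[OF c])
  have "integral {0..s} f + integral {s..t} f = integral {0..t} f"
    by (rule Henstock_Kurzweil_Integration.integral_combine[OF st(1,2) integrable_continuous_real[OF c0]])
  then have eq: "(LINT u:{0..t}|lborel. f u) - (LINT u:{0..s}|lborel. f u) - f s * (t - s)
      = integral {s..t} (\<lambda>u. f u - f s)"
    using integral_diff[OF integrable_continuous_real[OF c2] integrable_const_ivl[of "f s" s t]] st
    by (simp add: set_lebesgue_integral_eq_integral[OF c0] set_lebesgue_integral_eq_integral[OF c1] mult.commute)
  have "norm (integral {s..t} (\<lambda>u. f u - f s)) \<le> \<delta> * (t - s)"
    by (rule integral_bound[OF st(2)]) (use c2 d in \<open>auto intro!: continuous_intros\<close>)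
  then show ?thesis unfolding eq by simp
qed

text \<open>Dyadic, so that the grids are nested and each coarse point is also a point of every
  finer level.\<close>

definition grid :: "real \<Rightarrow> nat \<Rightarrow> nat \<Rightarrow> real" where
  "grid T n i = T * real i / 2 ^ n"

lemma grid_0 [simp]: "grid T n 0 = 0"
  and grid_top [simp]: "grid T n (2 ^ n) = T"
  by (auto simp: grid_def)

lemma grid_refine: "grid T (n + m) (i * 2 ^ m) = grid T n i"
  by (simp add: grid_def power_add)

lemma grid_Suc: "grid T n (Suc i) = grid T n i + T / 2 ^ n"
  by (simp add: grid_def field_simps)

lemma grid_add: "grid T n (i + j) = grid T n i + T * real j / 2 ^ n"
  by (simp add: grid_def field_simps)

lemma grid_mono: "0 \<le> T \<Longrightarrow> i \<le> j \<Longrightarrow> grid T n i \<le> grid T n j"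
  unfolding grid_def by (intro divide_right_mono mult_left_mono) auto

lemma grid_mem: "0 \<le> T \<Longrightarrow> i \<le> 2 ^ n \<Longrightarrow> grid T n i \<in> {0..T}"
  using grid_mono[of T 0 i n] grid_mono[of T i "2 ^ n" n] by simp

lemma sum_blocks:
  fixes f :: "nat \<Rightarrow> real"
  shows "(\<Sum>i<n. \<Sum>j<k. f (i * k + j)) = (\<Sum>j<n * k. f j)"
proof -
  have "(\<Sum>j<k. f (i * k + j)) = sum f {i * k..<i * k + k}" for i
    using sum.shift_bounds_nat_ivl[of f 0 "i * k" k] by (simp add: add.commute lessThan_atLeast0)
  then show ?thesis using sum.nat_group[of f k n] by simp
qed

text \<open>A discrete product rule, where \<open>r\<close> is the residual of the Euler step. The
  residual is weighted by \<open>z\<close> at the right end of the step, and this is what breaks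
  adaptedness later.\<close>

lemma one_step_telescope:
  fixes x w z r :: "nat \<Rightarrow> real"
  assumes z: "\<And>i. i < N \<Longrightarrow> z (Suc i) = z i * exp (- \<sigma> * (w (Suc i) - w i) - a * \<Delta>)"
    and x: "\<And>i. i < N \<Longrightarrow> x (Suc i) = x i * (1 + \<mu> * \<Delta> + \<sigma> * (w (Suc i) - w i)) + r i"
  shows "z N * x N - z 0 * x 0 =
    (\<Sum>i<N. z i * x i * (exp (- \<sigma> * (w (Suc i) - w i) - a * \<Delta>) * (1 + \<mu> * \<Delta> + \<sigma> * (w (Suc i) - w i)) - 1))
    + (\<Sum>i<N. z (Suc i) * r i)"
proof -
  have "z N * x N - z 0 * x 0 = (\<Sum>i<N. z (Suc i) * x (Suc i) - z i * x i)"
    by (rule sum_lessThan_telescope[symmetric])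
  also have "\<dots> = (\<Sum>i<N. z i * x i * (exp (- \<sigma> * (w (Suc i) - w i) - a * \<Delta>) * (1 + \<mu> * \<Delta> + \<sigma> * (w (Suc i) - w i)) - 1)
      + z (Suc i) * r i)"
  proof (rule sum.cong[OF refl])
    fix i assume "i \<in> {..<N}"
    then have zi: "z (Suc i) = z i * exp (- \<sigma> * (w (Suc i) - w i) - a * \<Delta>)"
      and xi: "x (Suc i) = x i * (1 + \<mu> * \<Delta> + \<sigma> * (w (Suc i) - w i)) + r i" using z x by auto
    have "z (Suc i) * x (Suc i) = z (Suc i) * (x i * (1 + \<mu> * \<Delta> + \<sigma> * (w (Suc i) - w i))) + z (Suc i) * r i"
      unfolding xi by (rule distrib_left)
    also have "z (Suc i) * (x i * (1 + \<mu> * \<Delta> + \<sigma> * (w (Suc i) - w i)))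
      = z i * x i * (exp (- \<sigma> * (w (Suc i) - w i) - a * \<Delta>) * (1 + \<mu> * \<Delta> + \<sigma> * (w (Suc i) - w i)))"
      unfolding zi by (simp only: mult_ac)
    finally show "z (Suc i) * x (Suc i) - z i * x i =
      z i * x i * (exp (- \<sigma> * (w (Suc i) - w i) - a * \<Delta>) * (1 + \<mu> * \<Delta> + \<sigma> * (w (Suc i) - w i)) - 1) + z (Suc i) * r i"
      by (simp only: right_diff_distrib mult_1_right)
  qed
  finally show ?thesis by (simp only: sum.distrib)
qed

context brownian_motion begin

definition rsum :: "real \<Rightarrow> (real \<Rightarrow> 'a \<Rightarrow> real) \<Rightarrow> nat \<Rightarrow> nat \<Rightarrow> 'a \<Rightarrow> real" where
  "rsum T X n k \<omega> = (\<Sum>j<k. X (grid T n j) \<omega> * (B (grid T n (Suc j)) \<omega> - B (grid T n j) \<omega>))"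

text \<open>The centred squares have variance 2 \<Delta>^2 with \<Delta> the mesh, and there are T /
  \<Delta> of them, so the sum has second moment at most R^2 * 2 T \<Delta>, which vanishes with the
  mesh.\<close>

lemma weighted_quadratic_variation:
  assumes A: "A \<in> events" "O' \<in> events" "O' \<subseteq> A" and T: "0 < T" and R: "0 < R"
    and \<xi>: "\<And>i. i < 2 ^ n \<Longrightarrow> \<xi> i \<in> borel_measurable P" "\<And>i. i < 2 ^ n \<Longrightarrow> locadapted A (grid T n i) (\<xi> i)"
      "\<And>i \<omega>. i < 2 ^ n \<Longrightarrow> \<omega> \<in> O' \<Longrightarrow> \<bar>\<xi> i \<omega>\<bar> \<le> R"
  shows "l0 O' (\<lambda>\<omega>. \<Sum>i<2 ^ n. \<xi> i \<omega> * ((B (grid T n (Suc i)) \<omega> - B (grid T n i) \<omega>)\<^sup>2 - T / 2 ^ n))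
    \<le> R * sqrt (2 * T * (T / 2 ^ n))"
proof -
  define \<Delta> where "\<Delta> = T / 2 ^ n"
  have \<Delta>: "0 < \<Delta>" using T by (simp add: \<Delta>_def)
  have g: "0 \<le> grid T n i" "grid T n i < grid T n (Suc i)" "grid T n (Suc i) - grid T n i = \<Delta>" for i
    using T by (auto simp: grid_Suc \<Delta>_def) (simp add: grid_def)
  note iv = increment_square_mean_var[OF g(1,2), unfolded g(3)]
  note b = sum_increments_L2_bound[OF A, of "2 ^ n" "grid T n" "\<lambda>i. grid T n (Suc i)" \<xi> R "\<lambda>_ x. x\<^sup>2 - \<Delta>" "\<lambda>_. 2 * \<Delta>\<^sup>2"]
  have gm: "grid T n (Suc i) \<le> grid T n j" if "i < j" for i j using T that by (intro grid_mono) auto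
  have b: "integrable P (\<lambda>\<omega>. indicator O' \<omega> * (\<Sum>i<2 ^ n. \<xi> i \<omega> * ((B (grid T n (Suc i)) \<omega> - B (grid T n i) \<omega>)\<^sup>2 - \<Delta>))\<^sup>2)"
    "expectation (\<lambda>\<omega>. indicator O' \<omega> * (\<Sum>i<2 ^ n. \<xi> i \<omega> * ((B (grid T n (Suc i)) \<omega> - B (grid T n i) \<omega>)\<^sup>2 - \<Delta>))\<^sup>2)
      \<le> R\<^sup>2 * (\<Sum>i<(2::nat) ^ n. 2 * \<Delta>\<^sup>2)"
    by (rule b; (use T R \<xi> g(1) iv less_imp_le[OF g(2)] gm in simp))+
  have e: "R\<^sup>2 * (\<Sum>i<(2::nat) ^ n. 2 * \<Delta>\<^sup>2) = (R * sqrt (2 * T * \<Delta>))\<^sup>2"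
    using T \<Delta> by (simp add: power_mult_distrib) (simp add: \<Delta>_def power2_eq_square)
  have meas: "(\<lambda>\<omega>. \<Sum>i<2 ^ n. \<xi> i \<omega> * ((B (grid T n (Suc i)) \<omega> - B (grid T n i) \<omega>)\<^sup>2 - \<Delta>)) \<in> borel_measurable P"
    using \<xi>(1) BM_measurable[OF g(1)]
    by (intro borel_measurable_sum borel_measurable_times borel_measurable_diff borel_measurable_power) auto
  show ?thesis unfolding \<Delta>_def[symmetric]
    by (rule l0_le_L2[OF A(2) meas b(1)]) (use b(2) e R T \<Delta> in auto)
qed

lemma stochastic_sum_L2_bound:
  fixes a b :: "nat \<Rightarrow> real"
  assumes A: "A \<in> events" "O' \<in> events" "O' \<subseteq> A"
    and ab: "\<And>i. i < N \<Longrightarrow> 0 \<le> a i \<and> a i \<le> b i" "\<And>i j. i < j \<Longrightarrow> j < N \<Longrightarrow> b i \<le> a j"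
    and \<xi>: "\<And>i. i < N \<Longrightarrow> \<xi> i \<in> borel_measurable P" "\<And>i. i < N \<Longrightarrow> locadapted A (a i) (\<xi> i)"
      "\<And>i \<omega>. i < N \<Longrightarrow> \<omega> \<in> O' \<Longrightarrow> \<bar>\<xi> i \<omega>\<bar> \<le> K" "0 \<le> K"
  shows "integrable P (\<lambda>\<omega>. indicator O' \<omega> * (\<Sum>i<N. \<xi> i \<omega> * (B (b i) \<omega> - B (a i) \<omega>))\<^sup>2)"
    "expectation (\<lambda>\<omega>. indicator O' \<omega> * (\<Sum>i<N. \<xi> i \<omega> * (B (b i) \<omega> - B (a i) \<omega>))\<^sup>2) \<le> K\<^sup>2 * (\<Sum>i<N. b i - a i)"
proof -
  have v: "integrable P (\<lambda>\<omega>. (B (b i) \<omega> - B (a i) \<omega>)\<^sup>2)" "expectation (\<lambda>\<omega>. B (b i) \<omega> - B (a i) \<omega>) = 0"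
    "expectation (\<lambda>\<omega>. (B (b i) \<omega> - B (a i) \<omega>)\<^sup>2) = b i - a i" if "i < N" for i
    using increment_mean_var[of "a i" "b i"] ab(1)[OF that] by auto
  have K: "AE \<omega> in P. \<omega> \<in> O' \<longrightarrow> \<bar>\<xi> i \<omega>\<bar> \<le> K" if "i < N" for i
    using \<xi>(3)[OF that] by auto
  note bnd = sum_increments_L2_bound[OF A ab \<xi>(1,2) K \<xi>(4), where h="\<lambda>_ x. x" and v="\<lambda>i. b i - a i"]
  show "integrable P (\<lambda>\<omega>. indicator O' \<omega> * (\<Sum>i<N. \<xi> i \<omega> * (B (b i) \<omega> - B (a i) \<omega>))\<^sup>2)"
    by (rule bnd(1)) (use v in auto)
  show "expectation (\<lambda>\<omega>. indicator O' \<omega> * (\<Sum>i<N. \<xi> i \<omega> * (B (b i) \<omega> - B (a i) \<omega>))\<^sup>2) \<le> K\<^sup>2 * (\<Sum>i<N. b i - a i)"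
    by (rule bnd(2)) (use v in auto)
qed

text \<open>The five summands of the bound have separate origins: the weighted quadratic variation;
  the one-step defects; the noise part of the residuals weighted by \<open>Z\<close> at left end
  points; the correction for moving \<open>Z\<close> from right to left end points; the error of
  replacing the drift integral by its left-point value. All of them become small when \<Delta> and
  then \<delta> are small with \<open>R\<close> fixed.\<close>

lemma discretization_estimate:
  fixes X :: "real \<Rightarrow> 'a \<Rightarrow> real" and I :: "nat \<Rightarrow> 'a \<Rightarrow> real" and n :: nat and T \<mu> \<sigma> :: real
  defines "\<Delta> \<equiv> T / 2 ^ n" and "a \<equiv> \<mu> - \<sigma>\<^sup>2 / 2"
  defines "Z \<equiv> \<lambda>t \<omega>. exp (- \<sigma> * B t \<omega> - a * t)"
  assumes T: "0 < T" and \<Delta>1: "\<Delta> \<le> 1" and \<delta>: "0 < \<delta>" "\<delta> \<le> 1" and R: "1 \<le> R"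
    and A: "A \<in> events" "O' \<in> events" "O' \<subseteq> A"
    and X: "\<And>t. t \<in> {0..T} \<Longrightarrow> X t \<in> borel_measurable P" "\<And>t. t \<in> {0..T} \<Longrightarrow> locadapted A t (X t)"
    and I: "\<And>i. i \<le> 2 ^ n \<Longrightarrow> I i \<in> borel_measurable P"
    and eq: "\<And>i. i \<le> 2 ^ n \<Longrightarrow> AE \<omega> in P. \<omega> \<in> A \<longrightarrow>
      X (grid T n i) \<omega> = X 0 \<omega> + \<mu> * (LINT s:{0..grid T n i}|lborel. X s \<omega>) + \<sigma> * I i \<omega>"
    and lim: "\<And>i. i \<le> 2 ^ n \<Longrightarrow> (\<lambda>m. l0 A (\<lambda>\<omega>. I i \<omega> - rsum T X (n + m) (i * 2 ^ m) \<omega>)) \<longlonglongrightarrow> 0"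
    and path: "\<And>\<omega>. \<omega> \<in> O' \<Longrightarrow> continuous_on {0..T} (\<lambda>t. X t \<omega>)"
      "\<And>\<omega> t. \<omega> \<in> O' \<Longrightarrow> t \<in> {0..T} \<Longrightarrow> \<bar>X t \<omega>\<bar> \<le> R" "\<And>\<omega> t. \<omega> \<in> O' \<Longrightarrow> t \<in> {0..T} \<Longrightarrow> Z t \<omega> \<le> R"
      "\<And>\<omega> s t. \<omega> \<in> O' \<Longrightarrow> s \<in> {0..T} \<Longrightarrow> t \<in> {0..T} \<Longrightarrow> \<bar>s - t\<bar> \<le> \<Delta> \<Longrightarrow> \<bar>X s \<omega> - X t \<omega>\<bar> \<le> \<delta>"
      "\<And>\<omega> s t. \<omega> \<in> O' \<Longrightarrow> s \<in> {0..T} \<Longrightarrow> t \<in> {0..T} \<Longrightarrow> \<bar>s - t\<bar> \<le> \<Delta> \<Longrightarrow> \<bar>B s \<omega> - B t \<omega>\<bar> \<le> \<delta>"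
    and C: "0 \<le> C" "\<And>x \<Delta> \<delta>. \<bar>x\<bar> \<le> \<delta> \<Longrightarrow> \<delta> \<le> 1 \<Longrightarrow> 0 \<le> \<Delta> \<Longrightarrow> \<Delta> \<le> 1 \<Longrightarrow>
      \<bar>exp (- \<sigma> * x - a * \<Delta>) * (1 + \<mu> * \<Delta> + \<sigma> * x) - 1 - \<sigma>\<^sup>2 / 2 * (\<Delta> - x\<^sup>2)\<bar> \<le> C * (\<delta> + \<Delta>) * (x\<^sup>2 + \<Delta>)"
    and \<sigma>: "0 < \<sigma>"
  shows "l0 O' (\<lambda>\<omega>. Z T \<omega> * X T \<omega> - Z 0 \<omega> * X 0 \<omega>) \<le>
    \<sigma>\<^sup>2 / 2 * R\<^sup>2 * sqrt (2 * T * \<Delta>) + R\<^sup>2 * C * (\<delta> + \<Delta>) * (2 * T)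
    + \<sigma> * R * \<delta> * sqrt T + \<delta> * (R\<^sup>2 * (\<sigma>\<^sup>2 + a\<^sup>2) + \<sigma>\<^sup>2) * T + R * \<bar>\<mu>\<bar> * \<delta> * T"
proof -
  define N :: nat where "N = 2 ^ n"
  define t where "t i = grid T n i" for i
  define w where "w i \<omega> = B (t (Suc i)) \<omega> - B (t i) \<omega>" for i \<omega>
  define r where "r i \<omega> = X (t (Suc i)) \<omega> - X (t i) \<omega> * (1 + \<mu> * \<Delta> + \<sigma> * w i \<omega>)" for i \<omega>
  have \<Delta>: "0 < \<Delta>" using T by (simp add: \<Delta>_def)
  have N\<Delta>: "real N * \<Delta> = T" by (simp add: N_def \<Delta>_def)
  have t: "t i \<in> {0..T}" if "i \<le> N" for i using grid_mem[of T i n] that T by (simp add: t_def N_def)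
  have t0: "0 \<le> t i" for i using T by (simp add: t_def grid_def)
  have tS: "t (Suc i) = t i + \<Delta>" for i by (simp add: t_def \<Delta>_def grid_Suc)
  have Xm: "X (t i) \<in> borel_measurable P" if "i \<le> N" for i using X(1) t that by blast
  have Bm: "B (t i) \<in> borel_measurable P" for i using BM_measurable t0 by blast
  have Zm: "Z s \<in> borel_measurable P" if "0 \<le> s" for s unfolding Z_def using BM_measurable[OF that] by measurable
  have wm: "w i \<in> borel_measurable P" for i unfolding w_def[abs_def] using Bm by measurable
  have rm': "r i \<in> borel_measurable P" if "i < N" for i
    unfolding r_def[abs_def] using Xm[of i] Xm[of "Suc i"] wm[of i] that
    by (intro borel_measurable_diff borel_measurable_times borel_measurable_add borel_measurable_const) auto
  have Za: "locadapted A s (Z s)" if "0 \<le> s" for s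
    by (rule locadapted_adapted) (use BM_adapted[OF that order_refl] in \<open>unfold Z_def, measurable\<close>)
  have Zpos: "0 < Z s \<omega>" for s \<omega> by (simp add: Z_def)
  have w2: "integrable P (\<lambda>\<omega>. (w i \<omega>)\<^sup>2)" "expectation (\<lambda>\<omega>. (w i \<omega>)\<^sup>2) = \<Delta>" for i
    unfolding w_def using increment_mean_var(1,4)[of "t i" "t (Suc i)"] t0[of i] tS[of i] \<Delta> by auto
  have wb: "\<bar>w i \<omega>\<bar> \<le> \<delta>" if "i < N" "\<omega> \<in> O'" for i \<omega>
    unfolding w_def using path(5)[OF that(2) t[of "Suc i"] t[of i]] that(1) tS \<Delta> by simp
  define Q1 where "Q1 \<omega> = (\<Sum>i<N. (Z (t i) \<omega> * X (t i) \<omega>) * ((w i \<omega>)\<^sup>2 - \<Delta>))" for \<omega>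
  define Q2 where "Q2 \<omega> = R\<^sup>2 * C * (\<delta> + \<Delta>) * (\<Sum>i<N. (w i \<omega>)\<^sup>2 + \<Delta>)" for \<omega>
  define Q3 where "Q3 \<omega> = (\<Sum>i<N. Z (t (Suc i)) \<omega> * r i \<omega>)" for \<omega>
  have Q1m: "Q1 \<in> borel_measurable P"
    unfolding Q1_def[abs_def] using Zm[OF t0] Xm wm
    by (intro borel_measurable_sum borel_measurable_times borel_measurable_diff borel_measurable_power) auto
  have Q2m: "Q2 \<in> borel_measurable P"
    unfolding Q2_def[abs_def] using wm by measurable
  have Q3m: "Q3 \<in> borel_measurable P"
    unfolding Q3_def[abs_def] using Zm[OF t0] rm' by (intro borel_measurable_sum borel_measurable_times) auto
  have dec: "\<bar>Z T \<omega> * X T \<omega> - Z 0 \<omega> * X 0 \<omega>\<bar> \<le> \<sigma>\<^sup>2 / 2 * \<bar>Q1 \<omega>\<bar> + Q2 \<omega> + \<bar>Q3 \<omega>\<bar>" if \<omega>: "\<omega> \<in> O'" for \<omega>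
  proof -
    define f where "f x = exp (- \<sigma> * x - a * \<Delta>) * (1 + \<mu> * \<Delta> + \<sigma> * x) - 1" for x
    have zs: "Z (t (Suc i)) \<omega> = Z (t i) \<omega> * exp (- \<sigma> * w i \<omega> - a * \<Delta>)" for i
      unfolding Z_def w_def tS exp_add[symmetric] by (simp add: algebra_simps)
    have "Z (t N) \<omega> * X (t N) \<omega> - Z (t 0) \<omega> * X (t 0) \<omega> = (\<Sum>i<N. Z (t i) \<omega> * X (t i) \<omega> * f (w i \<omega>)) + Q3 \<omega>"
      unfolding f_def Q3_def w_def
      by (rule one_step_telescope) (use zs in \<open>auto simp: w_def r_def\<close>)
    also have "(\<Sum>i<N. Z (t i) \<omega> * X (t i) \<omega> * f (w i \<omega>)) =
      - (\<sigma>\<^sup>2 / 2) * Q1 \<omega> + (\<Sum>i<N. Z (t i) \<omega> * X (t i) \<omega> * (f (w i \<omega>) - \<sigma>\<^sup>2 / 2 * (\<Delta> - (w i \<omega>)\<^sup>2)))"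
    proof -
      have "p * y = - k * (p * (q - d)) + p * (y - k * (d - q))" for p y k q d :: real
        by (simp add: algebra_simps)
      then show ?thesis unfolding Q1_def sum_distrib_left sum.distrib[symmetric] by (intro sum.cong refl) blast
    qed
    finally have *: "Z T \<omega> * X T \<omega> - Z 0 \<omega> * X 0 \<omega> = - (\<sigma>\<^sup>2 / 2) * Q1 \<omega> +
       (\<Sum>i<N. Z (t i) \<omega> * X (t i) \<omega> * (f (w i \<omega>) - \<sigma>\<^sup>2 / 2 * (\<Delta> - (w i \<omega>)\<^sup>2))) + Q3 \<omega>"
      by (simp add: t_def N_def)
    have "\<bar>\<Sum>i<N. Z (t i) \<omega> * X (t i) \<omega> * (f (w i \<omega>) - \<sigma>\<^sup>2 / 2 * (\<Delta> - (w i \<omega>)\<^sup>2))\<bar>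
      \<le> (\<Sum>i<N. R\<^sup>2 * (C * (\<delta> + \<Delta>) * ((w i \<omega>)\<^sup>2 + \<Delta>)))"
    proof (rule order_trans[OF sum_abs], rule sum_mono)
      fix i assume "i \<in> {..<N}"
      then have i: "i < N" by simp
      have zx: "\<bar>Z (t i) \<omega> * X (t i) \<omega>\<bar> \<le> R * R"
        unfolding abs_mult using path(2,3)[OF \<omega> t[of i]] i Zpos[of "t i" \<omega>] R by (intro mult_mono) auto
      have ff: "\<bar>f (w i \<omega>) - \<sigma>\<^sup>2 / 2 * (\<Delta> - (w i \<omega>)\<^sup>2)\<bar> \<le> C * (\<delta> + \<Delta>) * ((w i \<omega>)\<^sup>2 + \<Delta>)"
        unfolding f_def by (rule C(2)[OF wb[OF i \<omega>] \<delta>(2) less_imp_le[OF \<Delta>] \<Delta>1])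
      show "\<bar>Z (t i) \<omega> * X (t i) \<omega> * (f (w i \<omega>) - \<sigma>\<^sup>2 / 2 * (\<Delta> - (w i \<omega>)\<^sup>2))\<bar> \<le> R\<^sup>2 * (C * (\<delta> + \<Delta>) * ((w i \<omega>)\<^sup>2 + \<Delta>))"
        unfolding abs_mult[of "Z (t i) \<omega> * X (t i) \<omega>"] power2_eq_square[of R]
        by (rule mult_mono[OF zx ff]) (use R in auto)
    qed
    also have "\<dots> = Q2 \<omega>" by (simp add: Q2_def sum_distrib_left mult.assoc)
    finally have **: "\<bar>\<Sum>i<N. Z (t i) \<omega> * X (t i) \<omega> * (f (w i \<omega>) - \<sigma>\<^sup>2 / 2 * (\<Delta> - (w i \<omega>)\<^sup>2))\<bar> \<le> Q2 \<omega>" .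
    have "\<bar>- (\<sigma>\<^sup>2 / 2) * Q1 \<omega>\<bar> = \<sigma>\<^sup>2 / 2 * \<bar>Q1 \<omega>\<bar>" by (simp add: abs_mult)
    with * ** show ?thesis by linarith
  qed
  \<comment> \<open>the remainders are, up to small errors, stochastic sums over the blocks of a finer grid\<close>
  have Q3b: "l0 O' Q3 \<le> \<sigma> * R * \<delta> * sqrt T + \<delta> * (R\<^sup>2 * (\<sigma>\<^sup>2 + a\<^sup>2) + \<sigma>\<^sup>2) * T + R * \<bar>\<mu>\<bar> * \<delta> * T
      + (\<Sum>i<N. R * max 1 \<sigma> * (l0 A (\<lambda>\<omega>. I (Suc i) \<omega> - rsum T X (n + m) (Suc i * 2 ^ m) \<omega>) +
                     l0 A (\<lambda>\<omega>. I i \<omega> - rsum T X (n + m) (i * 2 ^ m) \<omega>)))" for m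
  proof -
    define M :: nat where "M = 2 ^ m"
    define s where "s j = grid T (n + m) j" for j
    define v where "v j \<omega> = B (s (Suc j)) \<omega> - B (s j) \<omega>" for j \<omega>
    \<comment> \<open>The residual of a coarse step should be \<sigma> times the integral of X -
      X(t_i) over the step; \<open>rr\<close> is the Riemann sum of that integral on the fine
      grid.\<close>
    define rr where "rr i \<omega> = (\<Sum>j<M. \<sigma> * (X (s (i * M + j)) \<omega> - X (t i) \<omega>) * v (i * M + j) \<omega>)" for i \<omega>
    \<comment> \<open>The defect between the integral and its fine Riemann sum, the only quantity
      here that is not controlled by second moments; it disappears as \<open>m\<close>
      grows.\<close>
    define D where "D i \<omega> = I i \<omega> - rsum T X (n + m) (i * M) \<omega>" for i \<omega>
    define h where "h = T / 2 ^ (n + m)"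
    have M: "0 < M" by (simp add: M_def)
    have h: "0 < h" "real M * h = \<Delta>" using T by (auto simp: h_def M_def \<Delta>_def power_add)
    have s0: "0 \<le> s j" for j using T by (simp add: s_def grid_def)
    have sS: "s (Suc j) = s j + h" for j by (simp add: s_def h_def grid_Suc)
    have sadd: "s (i + j) = s i + real j * h" for i j by (simp add: s_def h_def grid_add)
    have ts: "t i = s (i * M)" for i by (simp add: t_def s_def M_def grid_refine)
    have smono: "s i \<le> s j" if "i \<le> j" for i j using T that by (simp add: s_def grid_mono)
    have smem: "s j \<in> {0..T}" if "j \<le> N * M" for j
      using grid_mem[of T j "n + m"] that T by (simp add: s_def N_def M_def power_add)
    have near: "t i \<le> s (i * M + j)" "\<bar>s (i * M + j) - t i\<bar> \<le> \<Delta>" if "j < M" for i j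
    proof -
      have "real j * h \<le> real M * h" using that h(1) by (intro mult_right_mono) auto
      then show "t i \<le> s (i * M + j)" "\<bar>s (i * M + j) - t i\<bar> \<le> \<Delta>" using h by (auto simp: ts sadd)
    qed
    have iM: "i * M + j < N * M" if "i < N" "j < M" for i j
    proof -
      have "i * M + j < Suc i * M" using that by simp
      also have "\<dots> \<le> N * M" using that by (intro mult_le_mono1) simp
      finally show ?thesis .
    qed
    have Xs: "X (s j) \<in> borel_measurable P" "locadapted A (s j) (X (s j))" if "j \<le> N * M" for j
      using X smem[OF that] by auto
    have vm: "v j \<in> borel_measurable P" for j unfolding v_def[abs_def] using BM_measurable[OF s0] by measurable
    have v2: "integrable P (\<lambda>\<omega>. (v j \<omega>)\<^sup>2)" "expectation (v j) = 0" "expectation (\<lambda>\<omega>. (v j \<omega>)\<^sup>2) = h" for j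
      unfolding v_def[abs_def] using increment_mean_var[of "s j" "s (Suc j)"] s0[of j] sS[of j] h(1) by auto
    have rrm: "rr i \<in> borel_measurable P" if "i < N" for i
      unfolding rr_def[abs_def]
    proof (intro borel_measurable_sum borel_measurable_times borel_measurable_diff borel_measurable_const vm Xm)
      fix j assume "j \<in> {..<M}"
      then show "X (s (i * M + j)) \<in> borel_measurable P" using Xs(1)[of "i * M + j"] iM[OF that, of j] by simp
    qed (use that in simp)
    have Dm: "D i \<in> borel_measurable P" if "i \<le> N" for i
      unfolding D_def[abs_def] rsum_def s_def[symmetric] v_def[symmetric]
    proof (intro borel_measurable_diff borel_measurable_sum borel_measurable_times vm I)
      show "i \<le> 2 ^ n" using that by (simp add: N_def)
      fix j assume "j \<in> {..<i * M}"
      moreover have "i * M \<le> N * M" using that by (rule mult_le_mono1)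
      ultimately have "j \<le> N * M" by (metis lessThan_iff less_imp_le less_le_trans)
      then show "X (s j) \<in> borel_measurable P" by (rule Xs(1))
    qed
    have rdiff: "rsum T X (n + m) (Suc i * M) \<omega> - rsum T X (n + m) (i * M) \<omega> = (\<Sum>j<M. X (s (i * M + j)) \<omega> * v (i * M + j) \<omega>)" for i \<omega>
    proof -
      have "(\<Sum>j<a + k. f j) = (\<Sum>j<a. f j) + (\<Sum>j<k. f (a + j))" for f :: "nat \<Rightarrow> real" and a k
        by (induction k) auto
      note split = this[of _ "i * M" M]
      have req: "rsum T X (n + m) k \<omega> = (\<Sum>j<k. X (s j) \<omega> * v j \<omega>)" for k
        by (simp only: rsum_def s_def v_def)
      have "Suc i * M = i * M + M" by simp
      then show ?thesis unfolding req by (simp only: split add_diff_cancel_left')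
    qed
    have vsum: "(\<Sum>j<M. v (i * M + j) \<omega>) = w i \<omega>" for i \<omega>
      using sum_lessThan_telescope[of "\<lambda>j. B (s (i * M + j)) \<omega>" M]
      by (simp add: v_def w_def ts add.commute)
    have rreq: "rr i \<omega> = \<sigma> * (rsum T X (n + m) (Suc i * M) \<omega> - rsum T X (n + m) (i * M) \<omega>) - \<sigma> * (X (t i) \<omega> * w i \<omega>)" for i \<omega>
      unfolding rdiff vsum[symmetric] rr_def
      by (simp add: sum_distrib_left sum_subtractf[symmetric] algebra_simps)
    define J where "J i \<omega> = (LINT u:{0..t i}|lborel. X u \<omega>)" for i \<omega>
    \<comment> \<open>The equation has an exceptional null set for each time; only the finitely many
      coarse grid points are used, so their union is still null.\<close>
    have "AE \<omega> in P. \<forall>i\<in>{..N}. \<omega> \<in> A \<longrightarrow> X (t i) \<omega> = X 0 \<omega> + \<mu> * J i \<omega> + \<sigma> * I i \<omega>"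
      by (subst AE_finite_all) (use eq in \<open>auto simp: N_def t_def J_def\<close>)
    then have rb: "AE \<omega> in P. \<omega> \<in> O' \<longrightarrow> (\<forall>i<N. \<bar>r i \<omega> - rr i \<omega>\<bar> \<le> \<bar>\<mu>\<bar> * (\<delta> * \<Delta>) + \<sigma> * (\<bar>D (Suc i) \<omega>\<bar> + \<bar>D i \<omega>\<bar>))"
    proof eventually_elim
      case (elim \<omega>)
      show ?case
      proof (intro impI allI)
        fix i assume \<omega>: "\<omega> \<in> O'" and i: "i < N"
        have "X (t i) \<omega> = X 0 \<omega> + \<mu> * J i \<omega> + \<sigma> * I i \<omega>"
          "X (t (Suc i)) \<omega> = X 0 \<omega> + \<mu> * J (Suc i) \<omega> + \<sigma> * I (Suc i) \<omega>"
          using elim \<omega> A(3) i by auto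
        then have "X (t (Suc i)) \<omega> - X (t i) \<omega> = \<mu> * (J (Suc i) \<omega> - J i \<omega>) + \<sigma> * (I (Suc i) \<omega> - I i \<omega>)"
          by (simp add: algebra_simps)
        then have "r i \<omega> - rr i \<omega> = \<mu> * (J (Suc i) \<omega> - J i \<omega> - X (t i) \<omega> * \<Delta>) + \<sigma> * (D (Suc i) \<omega> - D i \<omega>)"
          unfolding rreq r_def D_def by (simp add: algebra_simps)
        moreover have "\<bar>\<mu> * (J (Suc i) \<omega> - J i \<omega> - X (t i) \<omega> * \<Delta>)\<bar> \<le> \<bar>\<mu>\<bar> * (\<delta> * \<Delta>)"
          unfolding abs_mult
        proof (rule mult_left_mono)
          have "\<bar>J (Suc i) \<omega> - J i \<omega> - X (t i) \<omega> * (t (Suc i) - t i)\<bar> \<le> \<delta> * (t (Suc i) - t i)"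
            unfolding J_def
          proof (rule integral_increment_bound[OF path(1)[OF \<omega>]])
            show "0 \<le> t i" "t i \<le> t (Suc i)" "t (Suc i) \<le> T" using t[of i] t[of "Suc i"] i tS \<Delta> by auto
            fix u assume "t i \<le> u" "u \<le> t (Suc i)"
            then show "\<bar>X u \<omega> - X (t i) \<omega>\<bar> \<le> \<delta>"
              using t[of i] t[of "Suc i"] i tS by (intro path(4)[OF \<omega>]) auto
          qed
          then show "\<bar>J (Suc i) \<omega> - J i \<omega> - X (t i) \<omega> * \<Delta>\<bar> \<le> \<delta> * \<Delta>" by (simp add: tS)
        qed simp
        moreover have "\<bar>\<sigma> * (D (Suc i) \<omega> - D i \<omega>)\<bar> \<le> \<sigma> * (\<bar>D (Suc i) \<omega>\<bar> + \<bar>D i \<omega>\<bar>)"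
          using \<sigma> unfolding abs_mult by (intro mult_mono) auto
        ultimately show "\<bar>r i \<omega> - rr i \<omega>\<bar> \<le> \<bar>\<mu>\<bar> * (\<delta> * \<Delta>) + \<sigma> * (\<bar>D (Suc i) \<omega>\<bar> + \<bar>D i \<omega>\<bar>)" by linarith
      qed
    qed
    \<comment> \<open>\<open>U1\<close> weights \<open>rr\<close> by \<open>Z\<close> at left end
      points and is a stochastic sum with adapted coefficients. \<open>U2\<close> majorizes the
      correction from moving \<open>Z\<close> to the right end points, and \<open>U4\<close>
      collects the Riemann sum defects.\<close>
    define U1 where "U1 \<omega> = (\<Sum>i<N. Z (t i) \<omega> * rr i \<omega>)" for \<omega>
    define U2 where "U2 \<omega> = (\<Sum>i<N. \<delta> * R\<^sup>2 * (\<sigma>\<^sup>2 * (w i \<omega>)\<^sup>2 + a\<^sup>2 * \<Delta>\<^sup>2) + (rr i \<omega>)\<^sup>2 / (2 * \<delta>))" for \<omega>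
    define U4 where "U4 \<omega> = (\<Sum>i<N. (R * \<sigma>) * (\<bar>D (Suc i) \<omega>\<bar> + \<bar>D i \<omega>\<bar>))" for \<omega>
    have U1m: "U1 \<in> borel_measurable P" unfolding U1_def[abs_def]
      using Zm[OF t0] rrm by (intro borel_measurable_sum borel_measurable_times) auto
    have U2m: "U2 \<in> borel_measurable P" unfolding U2_def[abs_def]
      using wm rrm by (intro borel_measurable_sum borel_measurable_add borel_measurable_times borel_measurable_divide
        borel_measurable_power borel_measurable_const) auto
    have U4m: "U4 \<in> borel_measurable P" unfolding U4_def[abs_def]
      using Dm by (intro borel_measurable_sum borel_measurable_add borel_measurable_times borel_measurable_abs
        borel_measurable_const) auto
    have U2p: "0 \<le> U2 \<omega>" for \<omega> unfolding U2_def using \<delta>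
      by (intro sum_nonneg add_nonneg_nonneg mult_nonneg_nonneg divide_nonneg_nonneg) auto
    have dz: "\<bar>(Z (t (Suc i)) \<omega> - Z (t i) \<omega>) * rr i \<omega>\<bar> \<le>
        \<delta> * R\<^sup>2 * (\<sigma>\<^sup>2 * (w i \<omega>)\<^sup>2 + a\<^sup>2 * \<Delta>\<^sup>2) + (rr i \<omega>)\<^sup>2 / (2 * \<delta>)" if \<omega>: "\<omega> \<in> O'" and i: "i < N" for \<omega> i
    proof -
      have eR: "exp (ln R) = R" using R by simp
      have le: "Z (t j) \<omega> \<le> exp (ln R)" if "j \<le> N" for j using path(3)[OF \<omega> t[OF that]] R by simp
      have "\<bar>Z (t (Suc i)) \<omega> - Z (t i) \<omega>\<bar> \<le> exp (ln R) * \<bar>(- \<sigma> * B (t (Suc i)) \<omega> - a * t (Suc i)) - (- \<sigma> * B (t i) \<omega> - a * t i)\<bar>"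
        unfolding Z_def by (rule exp_diff_abs_le) (use le[of i] le[of "Suc i"] i in \<open>auto simp: Z_def\<close>)
      also have "(- \<sigma> * B (t (Suc i)) \<omega> - a * t (Suc i)) - (- \<sigma> * B (t i) \<omega> - a * t i) = - (\<sigma> * w i \<omega> + a * \<Delta>)"
        by (simp add: w_def tS algebra_simps)
      finally have zb: "\<bar>Z (t (Suc i)) \<omega> - Z (t i) \<omega>\<bar> \<le> R * \<bar>\<sigma> * w i \<omega> + a * \<Delta>\<bar>"
        unfolding eR abs_minus_cancel .
      \<comment> \<open>Young's inequality with weight \<delta>: the squared increment of
        \<open>Z\<close> is of order \<Delta> in mean and the square of \<open>rr\<close> of order
        \<delta>^2 \<Delta>, so with this weight both terms are of order \<delta> \<Delta> and sum
        to order \<delta>.\<close>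
      have yng: "\<bar>x * y\<bar> \<le> \<delta> / 2 * x\<^sup>2 + y\<^sup>2 / (2 * \<delta>)" for x y :: real
      proof -
        have "0 \<le> (\<delta> * \<bar>x\<bar> - \<bar>y\<bar>)\<^sup>2 / (2 * \<delta>)" using \<delta> by simp
        also have "\<dots> = \<delta> / 2 * x\<^sup>2 + y\<^sup>2 / (2 * \<delta>) - \<bar>x * y\<bar>"
          using \<delta> by (simp add: power2_diff power_mult_distrib abs_mult field_simps power2_eq_square)
        finally show ?thesis by simp
      qed
      have "(Z (t (Suc i)) \<omega> - Z (t i) \<omega>)\<^sup>2 \<le> (R * \<bar>\<sigma> * w i \<omega> + a * \<Delta>\<bar>)\<^sup>2"
        using power_mono[OF zb, of 2] by simp
      also have "\<dots> = R\<^sup>2 * (\<sigma> * w i \<omega> + a * \<Delta>)\<^sup>2" by (simp add: power_mult_distrib)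
      also have "\<dots> \<le> R\<^sup>2 * (2 * (\<sigma> * w i \<omega>)\<^sup>2 + 2 * (a * \<Delta>)\<^sup>2)" by (intro mult_left_mono square_sum_le) simp
      finally have "\<delta> / 2 * (Z (t (Suc i)) \<omega> - Z (t i) \<omega>)\<^sup>2 \<le> \<delta> / 2 * (R\<^sup>2 * (2 * (\<sigma> * w i \<omega>)\<^sup>2 + 2 * (a * \<Delta>)\<^sup>2))"
        using \<delta> by (intro mult_left_mono) auto
      also have "\<dots> = \<delta> * R\<^sup>2 * (\<sigma>\<^sup>2 * (w i \<omega>)\<^sup>2 + a\<^sup>2 * \<Delta>\<^sup>2)" by (simp add: power_mult_distrib algebra_simps)
      finally show ?thesis using yng[of "Z (t (Suc i)) \<omega> - Z (t i) \<omega>" "rr i \<omega>"] by linarith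
    qed
    have Q3bd: "AE \<omega> in P. \<omega> \<in> O' \<longrightarrow> \<bar>Q3 \<omega>\<bar> \<le> \<bar>\<bar>U1 \<omega>\<bar> + (\<bar>U2 \<omega>\<bar> + (R * \<bar>\<mu>\<bar> * \<delta> * T + \<bar>U4 \<omega>\<bar>))\<bar>"
      using rb
    proof eventually_elim
      case (elim \<omega>)
      show ?case
      proof
        assume \<omega>: "\<omega> \<in> O'"
        have "Q3 \<omega> = U1 \<omega> + (\<Sum>i<N. (Z (t (Suc i)) \<omega> - Z (t i) \<omega>) * rr i \<omega>) + (\<Sum>i<N. Z (t (Suc i)) \<omega> * (r i \<omega> - rr i \<omega>))"
          unfolding Q3_def U1_def sum.distrib[symmetric] by (rule sum.cong) (auto simp: algebra_simps)
        moreover have "\<bar>\<Sum>i<N. (Z (t (Suc i)) \<omega> - Z (t i) \<omega>) * rr i \<omega>\<bar> \<le> U2 \<omega>"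
          unfolding U2_def by (rule order_trans[OF sum_abs sum_mono]) (use dz[OF \<omega>] in auto)
        moreover have "\<bar>\<Sum>i<N. Z (t (Suc i)) \<omega> * (r i \<omega> - rr i \<omega>)\<bar> \<le> R * \<bar>\<mu>\<bar> * \<delta> * T + U4 \<omega>"
        proof -
          have "\<bar>\<Sum>i<N. Z (t (Suc i)) \<omega> * (r i \<omega> - rr i \<omega>)\<bar> \<le> (\<Sum>i<N. R * (\<bar>\<mu>\<bar> * (\<delta> * \<Delta>) + \<sigma> * (\<bar>D (Suc i) \<omega>\<bar> + \<bar>D i \<omega>\<bar>)))"
          proof (rule order_trans[OF sum_abs sum_mono])
            fix i assume "i \<in> {..<N}"
            then have i: "i < N" by simp
            show "\<bar>Z (t (Suc i)) \<omega> * (r i \<omega> - rr i \<omega>)\<bar> \<le> R * (\<bar>\<mu>\<bar> * (\<delta> * \<Delta>) + \<sigma> * (\<bar>D (Suc i) \<omega>\<bar> + \<bar>D i \<omega>\<bar>))"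
              unfolding abs_mult[of "Z (t (Suc i)) \<omega>"]
              using path(3)[OF \<omega> t[of "Suc i"]] elim \<omega> i R Zpos[of "t (Suc i)" \<omega>] by (intro mult_mono) auto
          qed
          also have "\<dots> = (\<Sum>i<N. R * \<bar>\<mu>\<bar> * \<delta> * \<Delta>) + U4 \<omega>"
            unfolding U4_def sum.distrib[symmetric] by (rule sum.cong) (auto simp: algebra_simps)
          also have "(\<Sum>i<N. R * \<bar>\<mu>\<bar> * \<delta> * \<Delta>) = R * \<bar>\<mu>\<bar> * \<delta> * T" by (simp add: N\<Delta>[symmetric])
          finally show ?thesis .
        qed
        ultimately show "\<bar>Q3 \<omega>\<bar> \<le> \<bar>\<bar>U1 \<omega>\<bar> + (\<bar>U2 \<omega>\<bar> + (R * \<bar>\<mu>\<bar> * \<delta> * T + \<bar>U4 \<omega>\<bar>))\<bar>" by linarith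
      qed
    qed
    have U1b: "l0 O' U1 \<le> \<sigma> * R * \<delta> * sqrt T"
    proof -
      \<comment> \<open>\<open>j div M\<close> is the coarse block containing the fine index
        \<open>j\<close>. The coarse point of that block lies before the fine one, so the
        coefficient is known at time \<open>s j\<close>.\<close>
      define \<xi> where "\<xi> j \<omega> = Z (t (j div M)) \<omega> * (\<sigma> * (X (s j) \<omega> - X (t (j div M)) \<omega>))" for j \<omega>
      have U1eq: "U1 \<omega> = (\<Sum>j<N * M. \<xi> j \<omega> * v j \<omega>)" for \<omega>
        unfolding sum_blocks[symmetric] U1_def rr_def
        using M by (auto simp: \<xi>_def sum_distrib_left mult.assoc intro!: sum.cong)
      have jd: "j div M < N" "j = (j div M) * M + j mod M" "j mod M < M" if "j < N * M" for j
        using that M by (auto simp: less_mult_imp_div_less)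
      have bm: "\<xi> j \<in> borel_measurable P" "locadapted A (s j) (\<xi> j)"
        "\<And>\<omega>. \<omega> \<in> O' \<Longrightarrow> \<bar>\<xi> j \<omega>\<bar> \<le> \<sigma> * R * \<delta>" if j: "j < N * M" for j
      proof -
        have i: "j div M \<le> N" using jd(1)[OF j] by simp
        have nr: "t (j div M) \<le> s j" "\<bar>s j - t (j div M)\<bar> \<le> \<Delta>"
          using near[of "j mod M" "j div M"] jd(2,3)[OF j] by simp_all
        show "\<xi> j \<in> borel_measurable P" unfolding \<xi>_def[abs_def]
          using Zm[OF t0] Xs(1)[of j] Xm[OF i] j
          by (intro borel_measurable_times borel_measurable_diff borel_measurable_const) auto
        show "locadapted A (s j) (\<xi> j)" unfolding \<xi>_def[abs_def]
          using Xs(2)[of j] j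
          by (intro locadapted_mult locadapted_diff locadapted_adapted[OF borel_measurable_const]
               locadapted_mono[OF Za[OF t0] nr(1)] locadapted_mono[OF X(2)[OF t[OF i]] nr(1)]) auto
        fix \<omega> assume \<omega>: "\<omega> \<in> O'"
        have "\<bar>X (s j) \<omega> - X (t (j div M)) \<omega>\<bar> \<le> \<delta>"
          using smem[of j] j by (intro path(4)[OF \<omega> _ t[OF i] nr(2)]) auto
        then have "\<bar>\<sigma> * (X (s j) \<omega> - X (t (j div M)) \<omega>)\<bar> \<le> \<sigma> * \<delta>" using \<sigma> by (simp add: abs_mult)
        then have "\<bar>\<xi> j \<omega>\<bar> \<le> R * (\<sigma> * \<delta>)" unfolding \<xi>_def abs_mult[of "Z (t (j div M)) \<omega>"]
          using path(3)[OF \<omega> t[OF i]] Zpos[of "t (j div M)" \<omega>] R by (intro mult_mono) auto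
        then show "\<bar>\<xi> j \<omega>\<bar> \<le> \<sigma> * R * \<delta>" by (simp add: mult_ac)
      qed
      have K: "0 \<le> \<sigma> * R * \<delta>" using \<sigma> R \<delta> by simp
      have sS': "0 \<le> s j \<and> s j \<le> s (Suc j)" for j using s0[of j] smono[of j "Suc j"] by simp
      have sj: "s (Suc i) \<le> s j" if "i < j" for i j using that by (intro smono) simp
      note b = stochastic_sum_L2_bound[where a=s and b="\<lambda>j. s (Suc j)" and N="N * M" and K="\<sigma> * R * \<delta>" and \<xi>=\<xi>,
          OF A sS' sj bm K]
      have Nh: "(\<Sum>j<N * M. s (Suc j) - s j) = T" unfolding sS using N\<Delta> h(2) by (simp add: mult.assoc)
      have e: "(\<sigma> * R * \<delta>)\<^sup>2 * (\<Sum>j<N * M. s (Suc j) - s j) = (\<sigma> * R * \<delta> * sqrt T)\<^sup>2"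
        unfolding Nh using T by (simp add: power_mult_distrib)
      show ?thesis
      proof (rule l0_le_L2[OF A(2) U1m])
        show "integrable P (\<lambda>\<omega>. indicator O' \<omega> * (U1 \<omega>)\<^sup>2)" unfolding U1eq v_def by (rule b(1))
        show "expectation (\<lambda>\<omega>. indicator O' \<omega> * (U1 \<omega>)\<^sup>2) \<le> (\<sigma> * R * \<delta> * sqrt T)\<^sup>2"
          unfolding U1eq v_def e[symmetric] by (rule b(2))
        show "0 < \<sigma> * R * \<delta> * sqrt T" using \<sigma> R \<delta> T by simp
      qed
    qed
    have rr2: "integrable P (\<lambda>\<omega>. indicator O' \<omega> * (rr i \<omega>)\<^sup>2)"
      "expectation (\<lambda>\<omega>. indicator O' \<omega> * (rr i \<omega>)\<^sup>2) \<le> (\<sigma> * \<delta>)\<^sup>2 * \<Delta>" if i: "i < N" for i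
    proof -

      have pr: "(\<lambda>\<omega>. \<sigma> * (X (s (i * M + j)) \<omega> - X (t i) \<omega>)) \<in> borel_measurable P"
        "locadapted A (s (i * M + j)) (\<lambda>\<omega>. \<sigma> * (X (s (i * M + j)) \<omega> - X (t i) \<omega>))"
        "\<And>\<omega>. \<omega> \<in> O' \<Longrightarrow> \<bar>\<sigma> * (X (s (i * M + j)) \<omega> - X (t i) \<omega>)\<bar> \<le> \<sigma> * \<delta>" if j: "j < M" for j
      proof -
        have le: "i * M + j \<le> N * M" using iM[OF i j] by simp
        show "(\<lambda>\<omega>. \<sigma> * (X (s (i * M + j)) \<omega> - X (t i) \<omega>)) \<in> borel_measurable P"
          using Xs(1)[OF le] Xm[of i] i by (intro borel_measurable_times borel_measurable_diff borel_measurable_const) auto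
        show "locadapted A (s (i * M + j)) (\<lambda>\<omega>. \<sigma> * (X (s (i * M + j)) \<omega> - X (t i) \<omega>))"
          using i by (intro locadapted_mult locadapted_diff locadapted_adapted[OF borel_measurable_const]
               Xs(2)[OF le] locadapted_mono[OF X(2)[OF t] near(1)[OF j]]) auto
        fix \<omega> assume \<omega>: "\<omega> \<in> O'"
        have "\<bar>X (s (i * M + j)) \<omega> - X (t i) \<omega>\<bar> \<le> \<delta>"
          using smem[OF le] i by (intro path(4)[OF \<omega> _ t near(2)[OF j]]) auto
        then show "\<bar>\<sigma> * (X (s (i * M + j)) \<omega> - X (t i) \<omega>)\<bar> \<le> \<sigma> * \<delta>" using \<sigma> by (simp add: abs_mult)
      qed
      have K: "0 \<le> \<sigma> * \<delta>" using \<sigma> \<delta> by simp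
      have sS': "0 \<le> s (i * M + j) \<and> s (i * M + j) \<le> s (Suc (i * M + j))" for j
        using s0 smono[of "i * M + j" "Suc (i * M + j)"] by simp
      have sj: "s (Suc (i * M + j)) \<le> s (i * M + k)" if "j < k" for j k using that by (intro smono) simp
      have hs: "(\<Sum>j<M. s (Suc (i * M + j)) - s (i * M + j)) = \<Delta>" unfolding sS by (simp add: h(2))
      note b = stochastic_sum_L2_bound[where a="\<lambda>j. s (i * M + j)" and b="\<lambda>j. s (Suc (i * M + j))" and N=M and K="\<sigma> * \<delta>"
          and \<xi>="\<lambda>j \<omega>. \<sigma> * (X (s (i * M + j)) \<omega> - X (t i) \<omega>)", OF A sS' sj pr K, unfolded hs]
      show "integrable P (\<lambda>\<omega>. indicator O' \<omega> * (rr i \<omega>)\<^sup>2)" unfolding rr_def v_def by (rule b(1))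
      show "expectation (\<lambda>\<omega>. indicator O' \<omega> * (rr i \<omega>)\<^sup>2) \<le> (\<sigma> * \<delta>)\<^sup>2 * \<Delta>" unfolding rr_def v_def by (rule b(2))
    qed
    have U2b: "l0 O' U2 \<le> \<delta> * (R\<^sup>2 * (\<sigma>\<^sup>2 + a\<^sup>2) + \<sigma>\<^sup>2) * T"
    proof -
      \<comment> \<open>The square of \<open>rr\<close> is under control only on \<open>O'\<close>;
        inserting the indicator yields an integrable majorant that equals \<open>U2\<close>
        there.\<close>
      define g where "g \<omega> = (\<Sum>i<N. \<delta> * R\<^sup>2 * (\<sigma>\<^sup>2 * (w i \<omega>)\<^sup>2 + a\<^sup>2 * \<Delta>\<^sup>2) + (indicator O' \<omega> * (rr i \<omega>)\<^sup>2) / (2 * \<delta>))" for \<omega>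
      have gi: "integrable P g" unfolding g_def[abs_def]
        using w2 rr2 by (intro Bochner_Integration.integrable_sum Bochner_Integration.integrable_add
          integrable_mult_right integrable_divide_zero integrable_const) auto
      have gp: "0 \<le> g \<omega>" for \<omega> unfolding g_def using \<delta>
        by (intro sum_nonneg add_nonneg_nonneg mult_nonneg_nonneg divide_nonneg_nonneg) auto
      have "l0 O' U2 \<le> expectation g"
      proof (rule l0_le[OF A(2) U2m gi])
        show "AE \<omega> in P. \<omega> \<in> O' \<longrightarrow> min 1 \<bar>U2 \<omega>\<bar> \<le> g \<omega>"
        proof (rule AE_I2, rule impI)
          fix \<omega> assume "\<omega> \<in> O'"
          then have "U2 \<omega> = g \<omega>" by (simp add: U2_def g_def)
          then show "min 1 \<bar>U2 \<omega>\<bar> \<le> g \<omega>" using U2p[of \<omega>] by simp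
        qed
      qed (use gp in simp)
      also have "expectation g = (\<Sum>i<N. \<delta> * R\<^sup>2 * (\<sigma>\<^sup>2 * \<Delta> + a\<^sup>2 * \<Delta>\<^sup>2) + expectation (\<lambda>\<omega>. indicator O' \<omega> * (rr i \<omega>)\<^sup>2) / (2 * \<delta>))"
        unfolding g_def[abs_def] using w2 rr2
        by (subst Bochner_Integration.integral_sum)
           (auto simp: prob_space intro!: Bochner_Integration.integrable_add integrable_mult_right integrable_divide_zero sum.cong)
      also have "\<dots> \<le> (\<Sum>i<N. \<delta> * (R\<^sup>2 * (\<sigma>\<^sup>2 + a\<^sup>2) + \<sigma>\<^sup>2) * \<Delta>)"
      proof (rule sum_mono)
        fix i assume "i \<in> {..<N}"
        then have "expectation (\<lambda>\<omega>. indicator O' \<omega> * (rr i \<omega>)\<^sup>2) / (2 * \<delta>) \<le> (\<sigma> * \<delta>)\<^sup>2 * \<Delta> / (2 * \<delta>)"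
          using rr2(2) \<delta> by (intro divide_right_mono) auto
        also have "\<dots> = \<delta> * \<sigma>\<^sup>2 * \<Delta> / 2" using \<delta> by (simp add: power2_eq_square)
        also have "\<dots> \<le> \<delta> * \<sigma>\<^sup>2 * \<Delta>" using \<delta> \<Delta> by simp
        finally have 1: "expectation (\<lambda>\<omega>. indicator O' \<omega> * (rr i \<omega>)\<^sup>2) / (2 * \<delta>) \<le> \<delta> * \<sigma>\<^sup>2 * \<Delta>" .
        have "a\<^sup>2 * \<Delta>\<^sup>2 \<le> a\<^sup>2 * \<Delta>" using \<Delta> \<Delta>1 by (intro mult_left_mono) (auto simp: power2_eq_square mult_left_le)
        then have "\<delta> * R\<^sup>2 * (\<sigma>\<^sup>2 * \<Delta> + a\<^sup>2 * \<Delta>\<^sup>2) \<le> \<delta> * R\<^sup>2 * (\<sigma>\<^sup>2 * \<Delta> + a\<^sup>2 * \<Delta>)"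
          using \<delta> by (intro mult_left_mono) auto
        with 1 show "\<delta> * R\<^sup>2 * (\<sigma>\<^sup>2 * \<Delta> + a\<^sup>2 * \<Delta>\<^sup>2) + expectation (\<lambda>\<omega>. indicator O' \<omega> * (rr i \<omega>)\<^sup>2) / (2 * \<delta>)
           \<le> \<delta> * (R\<^sup>2 * (\<sigma>\<^sup>2 + a\<^sup>2) + \<sigma>\<^sup>2) * \<Delta>" by (simp add: algebra_simps)
      qed
      also have "\<dots> = \<delta> * (R\<^sup>2 * (\<sigma>\<^sup>2 + a\<^sup>2) + \<sigma>\<^sup>2) * T" by (simp add: N\<Delta>[symmetric])
      finally show ?thesis .
    qed
    have U4b: "l0 O' U4 \<le> (\<Sum>i<N. R * max 1 \<sigma> * (l0 A (D (Suc i)) + l0 A (D i)))"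
    proof -
      have "l0 O' U4 \<le> (\<Sum>i<N. l0 O' (\<lambda>\<omega>. (R * \<sigma>) * (\<bar>D (Suc i) \<omega>\<bar> + \<bar>D i \<omega>\<bar>)))"
        unfolding U4_def[abs_def] using Dm
        by (intro l0_sum A(2) borel_measurable_add borel_measurable_times borel_measurable_abs borel_measurable_const) auto
      also have "\<dots> \<le> (\<Sum>i<N. R * max 1 \<sigma> * (l0 A (D (Suc i)) + l0 A (D i)))"
      proof (rule sum_mono)
        fix i assume "i \<in> {..<N}"
        then have m: "D (Suc i) \<in> borel_measurable P" "D i \<in> borel_measurable P" using Dm[of i] Dm[of "Suc i"] by auto
        \<comment> \<open>The factor must be at least 1 for \<open>l0_mult\<close>, hence the
          maximum, as \<sigma> may be small.\<close>
        have R1: "1 \<le> R * max 1 \<sigma>" using mult_mono[OF R max.cobounded1[of 1 \<sigma>]] R by simp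
        have R2: "\<bar>R * \<sigma>\<bar> \<le> R * max 1 \<sigma>" using R \<sigma> by (simp add: abs_mult)
        have "l0 O' (\<lambda>\<omega>. (R * \<sigma>) * (\<bar>D (Suc i) \<omega>\<bar> + \<bar>D i \<omega>\<bar>)) \<le> R * max 1 \<sigma> * l0 O' (\<lambda>\<omega>. \<bar>D (Suc i) \<omega>\<bar> + \<bar>D i \<omega>\<bar>)"
          by (rule l0_mult[OF A(2) _ _ R1]) (use m R2 in auto)
        also have "l0 O' (\<lambda>\<omega>. \<bar>D (Suc i) \<omega>\<bar> + \<bar>D i \<omega>\<bar>) \<le> l0 O' (\<lambda>\<omega>. \<bar>D (Suc i) \<omega>\<bar>) + l0 O' (\<lambda>\<omega>. \<bar>D i \<omega>\<bar>)"
          by (rule l0_add[OF A(2)]) (use m in auto)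
        also have "\<dots> = l0 O' (D (Suc i)) + l0 O' (D i)" by (simp add: l0_def)
        also have "\<dots> \<le> l0 A (D (Suc i)) + l0 A (D i)" by (intro add_mono l0_subset A m)
        finally show "l0 O' (\<lambda>\<omega>. (R * \<sigma>) * (\<bar>D (Suc i) \<omega>\<bar> + \<bar>D i \<omega>\<bar>)) \<le> R * max 1 \<sigma> * (l0 A (D (Suc i)) + l0 A (D i))"
          using R1 by (simp add: mult_left_mono)
      qed
      finally show ?thesis .
    qed
    have U3b: "l0 O' (\<lambda>_. R * \<bar>\<mu>\<bar> * \<delta> * T) \<le> R * \<bar>\<mu>\<bar> * \<delta> * T"
    proof -
      have nn: "0 \<le> R * \<bar>\<mu>\<bar> * \<delta> * T" using R \<delta> T by simp
      have "l0 O' (\<lambda>_. R * \<bar>\<mu>\<bar> * \<delta> * T) \<le> expectation (\<lambda>_. R * \<bar>\<mu>\<bar> * \<delta> * T)"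
        by (rule l0_le[OF A(2)]) (use nn in auto)
      then show ?thesis by (simp add: prob_space)
    qed
    have "l0 O' Q3 \<le> l0 O' (\<lambda>\<omega>. \<bar>U1 \<omega>\<bar> + (\<bar>U2 \<omega>\<bar> + (R * \<bar>\<mu>\<bar> * \<delta> * T + \<bar>U4 \<omega>\<bar>)))"
      by (rule l0_mono[OF A(2) Q3m _ Q3bd]) (use U1m U2m U4m in measurable)
    also have "\<dots> \<le> l0 O' (\<lambda>\<omega>. \<bar>U1 \<omega>\<bar>) + l0 O' (\<lambda>\<omega>. \<bar>U2 \<omega>\<bar> + (R * \<bar>\<mu>\<bar> * \<delta> * T + \<bar>U4 \<omega>\<bar>))"
      by (rule l0_add[OF A(2)]) (use U1m U2m U4m in measurable)
    also have "l0 O' (\<lambda>\<omega>. \<bar>U2 \<omega>\<bar> + (R * \<bar>\<mu>\<bar> * \<delta> * T + \<bar>U4 \<omega>\<bar>)) \<le> l0 O' (\<lambda>\<omega>. \<bar>U2 \<omega>\<bar>) + l0 O' (\<lambda>\<omega>. R * \<bar>\<mu>\<bar> * \<delta> * T + \<bar>U4 \<omega>\<bar>)"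
      by (rule l0_add[OF A(2)]) (use U1m U2m U4m in measurable)
    also have "l0 O' (\<lambda>\<omega>. R * \<bar>\<mu>\<bar> * \<delta> * T + \<bar>U4 \<omega>\<bar>) \<le> l0 O' (\<lambda>\<omega>. R * \<bar>\<mu>\<bar> * \<delta> * T) + l0 O' (\<lambda>\<omega>. \<bar>U4 \<omega>\<bar>)"
      by (rule l0_add[OF A(2)]) (use U1m U2m U4m in measurable)
    finally have "l0 O' Q3 \<le> l0 O' U1 + (l0 O' U2 + (R * \<bar>\<mu>\<bar> * \<delta> * T + l0 O' U4))"
      using U3b by (simp add: l0_def)
    then show ?thesis using U1b U2b U4b by (simp add: D_def[abs_def] M_def)
  qed
  \<comment> \<open>The left side does not depend on \<open>m\<close>, so letting \<open>m\<close>
    tend to infinity removes the Riemann sum defects from the bound.\<close>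
  have "l0 O' Q3 \<le> \<sigma> * R * \<delta> * sqrt T + \<delta> * (R\<^sup>2 * (\<sigma>\<^sup>2 + a\<^sup>2) + \<sigma>\<^sup>2) * T + R * \<bar>\<mu>\<bar> * \<delta> * T + 0"
  proof (rule LIMSEQ_le_const)
    have "(\<lambda>m. \<Sum>i<N. R * max 1 \<sigma> * (l0 A (\<lambda>\<omega>. I (Suc i) \<omega> - rsum T X (n + m) (Suc i * 2 ^ m) \<omega>) +
                     l0 A (\<lambda>\<omega>. I i \<omega> - rsum T X (n + m) (i * 2 ^ m) \<omega>))) \<longlonglongrightarrow> (\<Sum>i<N. R * max 1 \<sigma> * (0 + 0))"
      by (intro tendsto_sum tendsto_mult tendsto_add tendsto_const lim) (auto simp: N_def)
    then show "(\<lambda>m. \<sigma> * R * \<delta> * sqrt T + \<delta> * (R\<^sup>2 * (\<sigma>\<^sup>2 + a\<^sup>2) + \<sigma>\<^sup>2) * T + R * \<bar>\<mu>\<bar> * \<delta> * T +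
       (\<Sum>i<N. R * max 1 \<sigma> * (l0 A (\<lambda>\<omega>. I (Suc i) \<omega> - rsum T X (n + m) (Suc i * 2 ^ m) \<omega>) +
                     l0 A (\<lambda>\<omega>. I i \<omega> - rsum T X (n + m) (i * 2 ^ m) \<omega>)))) \<longlonglongrightarrow>
       \<sigma> * R * \<delta> * sqrt T + \<delta> * (R\<^sup>2 * (\<sigma>\<^sup>2 + a\<^sup>2) + \<sigma>\<^sup>2) * T + R * \<bar>\<mu>\<bar> * \<delta> * T + 0"
      by (intro tendsto_add tendsto_const) simp
  qed (use Q3b in blast)
  then have Q3c: "l0 O' Q3 \<le> \<sigma> * R * \<delta> * sqrt T + \<delta> * (R\<^sup>2 * (\<sigma>\<^sup>2 + a\<^sup>2) + \<sigma>\<^sup>2) * T + R * \<bar>\<mu>\<bar> * \<delta> * T"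
    by simp
  have Q1b: "l0 O' (\<lambda>\<omega>. \<sigma>\<^sup>2 / 2 * Q1 \<omega>) \<le> \<sigma>\<^sup>2 / 2 * R\<^sup>2 * sqrt (2 * T * \<Delta>)"
  proof -
    have eqn: "(\<lambda>\<omega>. \<sigma>\<^sup>2 / 2 * Q1 \<omega>) = (\<lambda>\<omega>. \<Sum>i<2 ^ n. (\<sigma>\<^sup>2 / 2 * (Z (t i) \<omega> * X (t i) \<omega>)) *
        ((B (grid T n (Suc i)) \<omega> - B (grid T n i) \<omega>)\<^sup>2 - T / 2 ^ n))"
      by (simp add: Q1_def fun_eq_iff sum_distrib_left w_def t_def \<Delta>_def N_def mult.assoc)
    show ?thesis unfolding eqn \<Delta>_def
    proof (rule weighted_quadratic_variation[OF A T])
      show "0 < \<sigma>\<^sup>2 / 2 * R\<^sup>2" using \<sigma> R by simp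
      fix i :: nat assume "i < 2 ^ n"
      then have i: "i \<le> N" by (simp add: N_def)
      show "(\<lambda>\<omega>. \<sigma>\<^sup>2 / 2 * (Z (t i) \<omega> * X (t i) \<omega>)) \<in> borel_measurable P"
        using Zm[OF t0] Xm[OF i] by measurable
      show "locadapted A (grid T n i) (\<lambda>\<omega>. \<sigma>\<^sup>2 / 2 * (Z (t i) \<omega> * X (t i) \<omega>))"
        unfolding t_def[symmetric]
        by (intro locadapted_mult Za X(2) t0 t i locadapted_adapted borel_measurable_const)
      fix \<omega> assume \<omega>: "\<omega> \<in> O'"
      have "\<bar>Z (t i) \<omega> * X (t i) \<omega>\<bar> \<le> R * R"
        unfolding abs_mult using path(2,3)[OF \<omega> t[OF i]] Zpos[of "t i" \<omega>] R by (intro mult_mono) auto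
      then have "\<sigma>\<^sup>2 / 2 * \<bar>Z (t i) \<omega> * X (t i) \<omega>\<bar> \<le> \<sigma>\<^sup>2 / 2 * (R * R)" by (rule mult_left_mono) simp
      then show "\<bar>\<sigma>\<^sup>2 / 2 * (Z (t i) \<omega> * X (t i) \<omega>)\<bar> \<le> \<sigma>\<^sup>2 / 2 * R\<^sup>2"
        by (simp add: abs_mult power2_eq_square)
    qed
  qed
  have Q2b: "l0 O' Q2 \<le> R\<^sup>2 * C * (\<delta> + \<Delta>) * (2 * T)"
  proof -
    have i: "integrable P (\<lambda>\<omega>. \<Sum>i<N. (w i \<omega>)\<^sup>2 + \<Delta>)" using w2 by auto
    have Q2i: "integrable P Q2" unfolding Q2_def[abs_def] by (intro integrable_mult_right i)
    have Q2p: "0 \<le> Q2 \<omega>" for \<omega> unfolding Q2_def using C(1) \<delta> \<Delta> by (intro mult_nonneg_nonneg sum_nonneg) auto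
    have "l0 O' Q2 \<le> expectation Q2"
      by (rule l0_le[OF A(2) Q2m Q2i]) (use Q2p in auto)
    also have "expectation Q2 = R\<^sup>2 * C * (\<delta> + \<Delta>) * (\<Sum>i<N. \<Delta> + \<Delta>)"
      unfolding Q2_def[abs_def] using w2 by (simp add: prob_space)
    also have "(\<Sum>i<N. \<Delta> + \<Delta>) = 2 * T" using N\<Delta> by (simp add: algebra_simps)
    finally show ?thesis .
  qed
  have "l0 O' (\<lambda>\<omega>. Z T \<omega> * X T \<omega> - Z 0 \<omega> * X 0 \<omega>) \<le> l0 O' (\<lambda>\<omega>. (\<bar>\<sigma>\<^sup>2 / 2 * Q1 \<omega>\<bar> + \<bar>Q2 \<omega>\<bar>) + \<bar>Q3 \<omega>\<bar>)"
  proof (rule l0_mono[OF A(2)])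
    show "(\<lambda>\<omega>. Z T \<omega> * X T \<omega> - Z 0 \<omega> * X 0 \<omega>) \<in> borel_measurable P"
      using Zm[of T] Zm[of 0] X(1)[of T] X(1)[of 0] T
      by (intro borel_measurable_diff borel_measurable_times) auto
    show "(\<lambda>\<omega>. (\<bar>\<sigma>\<^sup>2 / 2 * Q1 \<omega>\<bar> + \<bar>Q2 \<omega>\<bar>) + \<bar>Q3 \<omega>\<bar>) \<in> borel_measurable P"
      using Q1m Q2m Q3m by measurable
    show "AE \<omega> in P. \<omega> \<in> O' \<longrightarrow> \<bar>Z T \<omega> * X T \<omega> - Z 0 \<omega> * X 0 \<omega>\<bar> \<le> \<bar>(\<bar>\<sigma>\<^sup>2 / 2 * Q1 \<omega>\<bar> + \<bar>Q2 \<omega>\<bar>) + \<bar>Q3 \<omega>\<bar>\<bar>"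
    proof (rule AE_I2, rule impI)
      fix \<omega> assume "\<omega> \<in> O'"
      have "\<bar>\<sigma>\<^sup>2 / 2 * Q1 \<omega>\<bar> = \<sigma>\<^sup>2 / 2 * \<bar>Q1 \<omega>\<bar>" by (simp add: abs_mult)
      moreover have "x \<le> \<bar>(\<bar>p\<bar> + \<bar>q\<bar>) + \<bar>r\<bar>\<bar>" if "x \<le> p' + q + \<bar>r\<bar>" "\<bar>p\<bar> = p'" for x p p' q r :: real
        using that by linarith
      ultimately show "\<bar>Z T \<omega> * X T \<omega> - Z 0 \<omega> * X 0 \<omega>\<bar> \<le> \<bar>(\<bar>\<sigma>\<^sup>2 / 2 * Q1 \<omega>\<bar> + \<bar>Q2 \<omega>\<bar>) + \<bar>Q3 \<omega>\<bar>\<bar>"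
        using dec[OF \<open>\<omega> \<in> O'\<close>] by blast
    qed
  qed
  also have "\<dots> \<le> l0 O' (\<lambda>\<omega>. \<bar>\<sigma>\<^sup>2 / 2 * Q1 \<omega>\<bar> + \<bar>Q2 \<omega>\<bar>) + l0 O' (\<lambda>\<omega>. \<bar>Q3 \<omega>\<bar>)"
    by (rule l0_add[OF A(2)]) (use Q1m Q2m Q3m in measurable)
  also have "l0 O' (\<lambda>\<omega>. \<bar>\<sigma>\<^sup>2 / 2 * Q1 \<omega>\<bar> + \<bar>Q2 \<omega>\<bar>) \<le> l0 O' (\<lambda>\<omega>. \<bar>\<sigma>\<^sup>2 / 2 * Q1 \<omega>\<bar>) + l0 O' (\<lambda>\<omega>. \<bar>Q2 \<omega>\<bar>)"
    by (rule l0_add[OF A(2)]) (use Q1m Q2m Q3m in measurable)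
  finally show ?thesis using Q1b Q2b Q3c by (simp add: l0_def)
qed

lemma BM_continuous_on: "AE \<omega> in P. continuous_on {0..T} (\<lambda>t. B t \<omega>)"
  using BM_continuous by eventually_elim (auto intro: continuous_on_subset)

text \<open>The variable \<open>Y\<close> involves neither the grid nor the good event, so the
  discretization estimate, with errors and discarded probability made arbitrarily small, forces it
  to vanish on \<open>A\<close>. The constants are chosen in the order \<open>R\<close>, \<delta>,
  moduli of continuity, grid, since each choice depends on the earlier ones.\<close>

theorem linear_sde_unique:
  fixes X I :: "real \<Rightarrow> 'a \<Rightarrow> real"
  assumes T: "0 < T" and \<sigma>: "0 < \<sigma>" and A: "A \<in> events"
    and X: "\<And>t. t \<in> {0..T} \<Longrightarrow> X t \<in> borel_measurable P" "\<And>t. t \<in> {0..T} \<Longrightarrow> locadapted A t (X t)"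
      "AE \<omega> in P. continuous_on {0..T} (\<lambda>t. X t \<omega>)"
    and I: "\<And>t. t \<in> {0..T} \<Longrightarrow> I t \<in> borel_measurable P"
    and eq: "\<And>t. t \<in> {0..T} \<Longrightarrow> AE \<omega> in P. \<omega> \<in> A \<longrightarrow>
      X t \<omega> = X 0 \<omega> + \<mu> * (LINT s:{0..t}|lborel. X s \<omega>) + \<sigma> * I t \<omega>"
    and lim: "\<And>n i. i \<le> 2 ^ n \<Longrightarrow>
      (\<lambda>m. l0 A (\<lambda>\<omega>. I (grid T n i) \<omega> - rsum T X (n + m) (i * 2 ^ m) \<omega>)) \<longlonglongrightarrow> 0"
  shows "AE \<omega> in P. \<omega> \<in> A \<longrightarrow> X T \<omega> = X 0 \<omega> * exp ((\<mu> - \<sigma>\<^sup>2 / 2) * T + \<sigma> * B T \<omega>)"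
proof -
  define a where "a = \<mu> - \<sigma>\<^sup>2 / 2"
  define Z where "Z t \<omega> = exp (- \<sigma> * B t \<omega> - a * t)" for t \<omega>
  define Y where "Y \<omega> = Z T \<omega> * X T \<omega> - Z 0 \<omega> * X 0 \<omega>" for \<omega>
  have Zm: "Z s \<in> borel_measurable P" if "0 \<le> s" for s
    unfolding Z_def[abs_def] using BM_measurable[OF that] by measurable
  have Ym: "Y \<in> borel_measurable P" unfolding Y_def[abs_def]
    using Zm[of T] Zm[of 0] X(1)[of T] X(1)[of 0] T by (intro borel_measurable_diff borel_measurable_times) auto
  have Bm: "B t \<in> borel_measurable P" if "t \<in> {0..T}" for t using BM_measurable that by simp
  have "l0 A Y \<le> \<epsilon>" if "0 < \<epsilon>" for \<epsilon>
  proof -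
    \<comment> \<open>Six shares: four for the discarded events, one for the terms proportional to
      \<delta>, one for the terms governed by the mesh.\<close>
    define \<eta> where "\<eta> = \<epsilon> / 6"
    have \<eta>: "0 < \<eta>" using that by (simp add: \<eta>_def)
    obtain K1 :: nat and O1 where O1: "O1 \<in> events" "prob (space P - O1) \<le> \<eta>"
      "\<And>\<omega>. \<omega> \<in> O1 \<Longrightarrow> continuous_on {0..T} (\<lambda>t. X t \<omega>)"
      "\<And>\<omega> s. \<omega> \<in> O1 \<Longrightarrow> s \<in> {0..T} \<Longrightarrow> \<bar>X s \<omega>\<bar> \<le> K1"
      using bounded_path_event[OF X(1) X(3) \<eta>] by metis
    obtain K2 :: nat and O2 where O2: "O2 \<in> events" "prob (space P - O2) \<le> \<eta>"
      "\<And>\<omega> s. \<omega> \<in> O2 \<Longrightarrow> s \<in> {0..T} \<Longrightarrow> \<bar>B s \<omega>\<bar> \<le> K2"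
      using bounded_path_event[OF Bm BM_continuous_on \<eta>] by metis
    \<comment> \<open>One bound for both processes: \<open>K1\<close> for \<open>X\<close>, and for
      \<open>Z\<close> the exponential of the largest exponent possible when \<open>B\<close> is
      bounded by \<open>K2\<close>.\<close>
    define R where "R = max 1 (max (real K1) (exp (\<sigma> * real K2 + \<bar>a\<bar> * T)))"
    have R: "1 \<le> R" "real K1 \<le> R" "exp (\<sigma> * real K2 + \<bar>a\<bar> * T) \<le> R" unfolding R_def by auto
    obtain C where C: "0 \<le> C" "\<And>x \<Delta> \<delta>. \<bar>x\<bar> \<le> \<delta> \<Longrightarrow> \<delta> \<le> 1 \<Longrightarrow> 0 \<le> \<Delta> \<Longrightarrow> \<Delta> \<le> 1 \<Longrightarrow>
      \<bar>exp (- \<sigma> * x - a * \<Delta>) * (1 + \<mu> * \<Delta> + \<sigma> * x) - 1 - \<sigma>\<^sup>2 / 2 * (\<Delta> - x\<^sup>2)\<bar> \<le> C * (\<delta> + \<Delta>) * (x\<^sup>2 + \<Delta>)"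
      unfolding a_def using one_step_defect[of \<sigma> \<mu> thesis] by blast
    \<comment> \<open>The total coefficient of \<delta> in the bound of
      \<open>discretization_estimate\<close>.\<close>
    define c where "c = R\<^sup>2 * C * (2 * T) + \<sigma> * R * sqrt T + (R\<^sup>2 * (\<sigma>\<^sup>2 + a\<^sup>2) + \<sigma>\<^sup>2) * T + R * \<bar>\<mu>\<bar> * T"
    have c: "0 \<le> c" unfolding c_def using C(1) \<sigma> R(1) T by simp
    define \<delta> where "\<delta> = min 1 (\<eta> / (c + 1))"
    have \<delta>: "0 < \<delta>" "\<delta> \<le> 1" using \<eta> c by (auto simp: \<delta>_def)
    have c\<delta>: "c * \<delta> \<le> \<eta>"
    proof -
      have "c * \<delta> \<le> (c + 1) * (\<eta> / (c + 1))" using c \<delta> by (intro mult_mono) (auto simp: \<delta>_def)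
      also have "\<dots> = \<eta>" using c by simp
      finally show ?thesis .
    qed
    obtain h3 O3 where O3: "0 < h3" "O3 \<in> events" "prob (space P - O3) \<le> \<eta>"
      "\<And>\<omega> s s'. \<omega> \<in> O3 \<Longrightarrow> s \<in> {0..T} \<Longrightarrow> s' \<in> {0..T} \<Longrightarrow> \<bar>s - s'\<bar> < h3 \<Longrightarrow> \<bar>X s \<omega> - X s' \<omega>\<bar> \<le> \<delta>"
      using modulus_path_event[OF X(1) X(3) \<eta> \<delta>(1)] by metis
    obtain h4 O4 where O4: "0 < h4" "O4 \<in> events" "prob (space P - O4) \<le> \<eta>"
      "\<And>\<omega> s s'. \<omega> \<in> O4 \<Longrightarrow> s \<in> {0..T} \<Longrightarrow> s' \<in> {0..T} \<Longrightarrow> \<bar>s - s'\<bar> < h4 \<Longrightarrow> \<bar>B s \<omega> - B s' \<omega>\<bar> \<le> \<delta>"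
      using modulus_path_event[OF Bm BM_continuous_on \<eta> \<delta>(1)] by metis
    \<comment> \<open>With \<open>R\<close>, \<open>C\<close> and \<delta> fixed, only the level
      \<open>n\<close> is still free: it makes the remaining terms small and brings the mesh below
      both moduli of continuity.\<close>
    have \<Delta>0: "(\<lambda>n. T / 2 ^ n) \<longlonglongrightarrow> 0"
      using tendsto_mult[OF tendsto_const[of T] LIMSEQ_inverse_realpow_zero[of 2]] by (simp add: divide_inverse)
    have "(\<lambda>n. \<sigma>\<^sup>2 / 2 * R\<^sup>2 * sqrt (2 * T * (T / 2 ^ n)) + R\<^sup>2 * C * (2 * T) * (T / 2 ^ n)) \<longlonglongrightarrow>
        \<sigma>\<^sup>2 / 2 * R\<^sup>2 * sqrt (2 * T * 0) + R\<^sup>2 * C * (2 * T) * 0"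
      by (intro tendsto_add tendsto_mult tendsto_const tendsto_real_sqrt \<Delta>0)
    then have "\<forall>\<^sub>F n in sequentially. \<sigma>\<^sup>2 / 2 * R\<^sup>2 * sqrt (2 * T * (T / 2 ^ n)) + R\<^sup>2 * C * (2 * T) * (T / 2 ^ n) < \<eta>"
      using \<eta> by (intro order_tendstoD(2)) auto
    moreover have "\<forall>\<^sub>F n in sequentially. T / 2 ^ n < min 1 (min h3 h4)"
      using O3(1) O4(1) by (intro order_tendstoD(2)[OF \<Delta>0]) auto
    ultimately have "\<forall>\<^sub>F n in sequentially. \<sigma>\<^sup>2 / 2 * R\<^sup>2 * sqrt (2 * T * (T / 2 ^ n)) + R\<^sup>2 * C * (2 * T) * (T / 2 ^ n) < \<eta>
        \<and> T / 2 ^ n < min 1 (min h3 h4)" by (rule eventually_conj)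
    then obtain n where n: "\<sigma>\<^sup>2 / 2 * R\<^sup>2 * sqrt (2 * T * (T / 2 ^ n)) + R\<^sup>2 * C * (2 * T) * (T / 2 ^ n) < \<eta>"
        "T / 2 ^ n < min 1 (min h3 h4)" by (auto simp: eventually_sequentially)
    define \<Delta> where "\<Delta> = T / 2 ^ n"
    define O' where "O' = A \<inter> (O1 \<inter> O2) \<inter> (O3 \<inter> O4)"
    have O': "O' \<in> events" "O' \<subseteq> A" unfolding O'_def using A O1(1) O2(1) O3(2) O4(2) by auto
    have small: "prob (A - O') \<le> 4 * \<eta>"
    proof -
      have "prob (A - O') \<le> prob ((space P - O1) \<union> (space P - O2) \<union> ((space P - O3) \<union> (space P - O4)))"
        using sets.sets_into_space[OF A] O1(1) O2(1) O3(2) O4(2)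
        by (intro finite_measure_mono) (auto simp: O'_def)
      also have "\<dots> \<le> prob ((space P - O1) \<union> (space P - O2)) + prob ((space P - O3) \<union> (space P - O4))"
        using O1(1) O2(1) O3(2) O4(2) by (intro measure_Un_le) auto
      also have "\<dots> \<le> (prob (space P - O1) + prob (space P - O2)) + (prob (space P - O3) + prob (space P - O4))"
        using O1(1) O2(1) O3(2) O4(2) by (intro add_mono measure_Un_le) auto
      finally show ?thesis using O1(2) O2(2) O3(3) O4(3) by linarith
    qed
    have "l0 O' Y \<le> \<sigma>\<^sup>2 / 2 * R\<^sup>2 * sqrt (2 * T * \<Delta>) + R\<^sup>2 * C * (\<delta> + \<Delta>) * (2 * T)
    + \<sigma> * R * \<delta> * sqrt T + \<delta> * (R\<^sup>2 * (\<sigma>\<^sup>2 + a\<^sup>2) + \<sigma>\<^sup>2) * T + R * \<bar>\<mu>\<bar> * \<delta> * T"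
      unfolding Y_def[abs_def] Z_def a_def \<Delta>_def
    proof (rule discretization_estimate[where A=A and X=X and I="\<lambda>i. I (grid T n i)" and C=C and \<mu>=\<mu> and \<sigma>=\<sigma>])
      fix i :: nat assume i: "i \<le> 2 ^ n"
      have g: "grid T n i \<in> {0..T}" by (rule grid_mem) (use T i in auto)
      show "I (grid T n i) \<in> borel_measurable P" by (rule I[OF g])
      show "AE \<omega> in P. \<omega> \<in> A \<longrightarrow> X (grid T n i) \<omega> = X 0 \<omega> + \<mu> * (LINT s:{0..grid T n i}|lborel. X s \<omega>) + \<sigma> * I (grid T n i) \<omega>"
        by (rule eq[OF g])
      show "(\<lambda>m. l0 A (\<lambda>\<omega>. I (grid T n i) \<omega> - rsum T X (n + m) (i * 2 ^ m) \<omega>)) \<longlonglongrightarrow> 0" by (rule lim[OF i])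
    next
      fix \<omega> t assume \<omega>: "\<omega> \<in> O'" and t: "t \<in> {0..T}"
      show "\<bar>X t \<omega>\<bar> \<le> R" using O1(4)[of \<omega> t] \<omega> t R(2) unfolding O'_def by auto
      have "\<bar>B t \<omega>\<bar> \<le> real K2" using O2(3)[of \<omega> t] \<omega> t unfolding O'_def by auto
      then have "\<sigma> * \<bar>B t \<omega>\<bar> \<le> \<sigma> * real K2" using \<sigma> by simp
      moreover have "- \<sigma> * B t \<omega> \<le> \<sigma> * \<bar>B t \<omega>\<bar>" using \<sigma> abs_ge_minus_self[of "\<sigma> * B t \<omega>"] by (simp add: abs_mult)
      moreover have "- (a * t) \<le> \<bar>a\<bar> * T"
      proof -
        have "- (a * t) \<le> \<bar>a\<bar> * t" using abs_ge_minus_self[of "a * t"] t by (simp add: abs_mult)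
        also have "\<dots> \<le> \<bar>a\<bar> * T" using t by (intro mult_left_mono) auto
        finally show ?thesis .
      qed
      ultimately have "- \<sigma> * B t \<omega> - a * t \<le> \<sigma> * real K2 + \<bar>a\<bar> * T" by linarith
      then show "exp (- \<sigma> * B t \<omega> - (\<mu> - \<sigma>\<^sup>2 / 2) * t) \<le> R" using R(3) unfolding a_def[symmetric] by (meson exp_le_cancel_iff order_trans)
    next
      fix \<omega> s t assume \<omega>: "\<omega> \<in> O'" and st: "s \<in> {0..T}" "t \<in> {0..T}" and d: "\<bar>s - t\<bar> \<le> T / 2 ^ n"
      show "\<bar>X s \<omega> - X t \<omega>\<bar> \<le> \<delta>" using \<omega> n(2) d by (intro O3(4)[OF _ st]) (auto simp: O'_def)
      show "\<bar>B s \<omega> - B t \<omega>\<bar> \<le> \<delta>" using \<omega> n(2) d by (intro O4(4)[OF _ st]) (auto simp: O'_def)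
    next
      fix x \<Delta> \<delta> :: real assume "\<bar>x\<bar> \<le> \<delta>" "\<delta> \<le> 1" "0 \<le> \<Delta>" "\<Delta> \<le> 1"
      then show "\<bar>exp (- \<sigma> * x - (\<mu> - \<sigma>\<^sup>2 / 2) * \<Delta>) * (1 + \<mu> * \<Delta> + \<sigma> * x) - 1 - \<sigma>\<^sup>2 / 2 * (\<Delta> - x\<^sup>2)\<bar>
        \<le> C * (\<delta> + \<Delta>) * (x\<^sup>2 + \<Delta>)" unfolding a_def[symmetric] by (rule C(2))
    next
      show "\<And>\<omega>. \<omega> \<in> O' \<Longrightarrow> continuous_on {0..T} (\<lambda>t. X t \<omega>)" using O1(3) unfolding O'_def by blast
      show "T / 2 ^ n \<le> 1" using n(2) by simp
    qed (use T \<delta> R(1) A O' X C(1) \<sigma> in auto)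
    also have "\<dots> = (\<sigma>\<^sup>2 / 2 * R\<^sup>2 * sqrt (2 * T * \<Delta>) + R\<^sup>2 * C * (2 * T) * \<Delta>) + c * \<delta>"
      unfolding c_def by (simp add: algebra_simps)
    also have "\<dots> \<le> \<eta> + \<eta>" using n(1) c\<delta> unfolding \<Delta>_def by linarith
    finally have "l0 O' Y \<le> 2 * \<eta>" by simp
    then show ?thesis using l0_split[OF A O'(1,2) Ym] small by (simp add: \<eta>_def)
  qed
  then have "l0 A Y \<le> 0" by (rule field_le_epsilon[where y=0, simplified])
  then have "AE \<omega> in P. \<omega> \<in> A \<longrightarrow> Y \<omega> = 0" by (rule l0_eq_0_AE[OF A Ym])
  then show ?thesis using BM_zero
  proof eventually_elim
    case (elim \<omega>)
    show ?case
    proof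
      assume "\<omega> \<in> A"
      with elim have "Z T \<omega> * X T \<omega> = X 0 \<omega>" by (simp add: Y_def Z_def)
      moreover have "exp (a * T + \<sigma> * B T \<omega>) * Z T \<omega> = 1" by (simp add: Z_def exp_add[symmetric])
      ultimately show "X T \<omega> = X 0 \<omega> * exp ((\<mu> - \<sigma>\<^sup>2 / 2) * T + \<sigma> * B T \<omega>)"
        unfolding a_def[symmetric] by (metis mult.assoc mult.commute mult_1)
    qed
  qed
qed

end

section \<open>Ito integrals as limits of Riemann sums\<close>

lemma integral_step_function:
  fixes d c :: "nat \<Rightarrow> real"
  assumes d: "d 0 = 0" "d k = t" "\<And>i j. i < j \<Longrightarrow> j \<le> k \<Longrightarrow> d i < d j"
    and g: "\<And>j s. j < k \<Longrightarrow> d j < s \<Longrightarrow> s \<le> d (Suc j) \<Longrightarrow> g s = c j"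
  shows "(LINT s:{0..t}|lborel. g s) = (\<Sum>j<k. c j * (d (Suc j) - d j))"
proof -
  have mono: "d i \<le> d j" if "i \<le> j" "j \<le> k" for i j using d(3)[of i j] that by (cases "i = j") auto
  have *: "indicator {0..t} s *\<^sub>R g s = (\<Sum>j<k. c j * indicator {d j<..d (Suc j)} s)" if elim: "s \<noteq> 0" for s
    proof (cases "s \<in> {0..t}")
      case False
      have "(\<Sum>j<k. c j * indicator {d j<..d (Suc j)} s) = 0"
      proof (rule sum.neutral, rule ballI)
        fix j assume "j \<in> {..<k}"
        then have "0 \<le> d j" "d (Suc j) \<le> t" using mono[of 0 j] mono[of "Suc j" k] d(1,2) by auto
        then show "c j * indicator {d j<..d (Suc j)} s = 0" using False by (auto simp: indicator_def)
      qed
      then show ?thesis using False by simp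
    next
      case True
      then have s: "0 < s" "s \<le> t" using elim by auto
      define j where "j = (LEAST i. s \<le> d i)"
      have "s \<le> d k" using s d(2) by simp
      then have j: "s \<le> d j" "j \<le> k" unfolding j_def by (auto intro: LeastI Least_le)
      then obtain i where i: "j = Suc i" using s d(1) by (cases j) auto
      have di: "d i < s" using not_less_Least[of i "\<lambda>i. s \<le> d i"] i unfolding j_def by auto
      have "(\<Sum>l<k. c l * indicator {d l<..d (Suc l)} s) = (\<Sum>l<k. if l = i then c i else 0)"
      proof (rule sum.cong[OF refl])
        fix l assume l: "l \<in> {..<k}"
        show "c l * indicator {d l<..d (Suc l)} s = (if l = i then c i else 0)"
        proof (cases l i rule: linorder_cases)
          case less
          then have "d (Suc l) \<le> d i" using mono[of "Suc l" i] i j by simp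
          then show ?thesis using less di by (auto simp: indicator_def)
        next
          case equal
          then show ?thesis using di j i by (auto simp: indicator_def)
        next
          case greater
          then have "d (Suc i) \<le> d l" using mono[of "Suc i" l] l by simp
          then show ?thesis using greater j i by (auto simp: indicator_def)
        qed
      qed
      also have "\<dots> = c i" using i j by (simp add: sum.delta)
      also have "\<dots> = g s" using g[of i s] di j i by simp
      finally show ?thesis using True by simp
    qed
  have "(\<Sum>j<k. c j * indicator {d j<..d (Suc j)} 0) = 0"
    by (rule sum.neutral) (use mono[of 0] d(1) in \<open>auto simp: indicator_def not_less\<close>)
  \<comment> \<open>The cells are open on the left, so the value of \<open>g\<close> at 0 is
    arbitrary. Displaying it as a separate term gives an identity at every point, from which
    measurability of the integrand follows.\<close>
  then have "indicator {0..t} s *\<^sub>R g s = (\<Sum>j<k. c j * indicator {d j<..d (Suc j)} s) + indicator {0} s * (indicator {0..t} 0 * g 0)" for s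
    using *[of s] by (cases "s = 0") auto
  note ** = this
  have m: "(\<lambda>s. indicator {0..t} s *\<^sub>R g s) \<in> borel_measurable lborel"
    unfolding ** by measurable
  have "AE s in lborel. s \<noteq> (0::real)" by (rule AE_lborel_singleton)
  then have "(LINT s:{0..t}|lborel. g s) = (LINT s|lborel. (\<Sum>j<k. c j * indicator {d j<..d (Suc j)} s))"
    unfolding set_lebesgue_integral_def
  proof (intro integral_cong_AE m)
    show "(\<lambda>s. \<Sum>j<k. c j * indicator {d j<..d (Suc j)} s) \<in> borel_measurable lborel" by measurable
    assume "AE s in lborel. s \<noteq> (0::real)"
    then show "AE s in lborel. indicator {0..t} s *\<^sub>R g s = (\<Sum>j<k. c j * indicator {d j<..d (Suc j)} s)"
      by eventually_elim (rule *)
  qed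
  also have "\<dots> = (\<Sum>j<k. c j * (d (Suc j) - d j))"
    using mono by (subst Bochner_Integration.integral_sum) auto
  finally show ?thesis .
qed

text \<open>Comparing integrals by monotonicity needs an integrable majorant, since the Bochner
  integral of a nonintegrable function is 0 by convention. On a compact interval both functions are
  bounded.\<close>

lemma set_integrable_step_minus_continuous:
  fixes f :: "real \<Rightarrow> real" and c :: "nat \<Rightarrow> real"
  assumes f: "continuous_on {0..t} f"
  shows "set_integrable lborel {0..t} (\<lambda>s. ((\<Sum>i<n. c i * indicator {\<tau> i<..\<tau> (Suc i)} s) - f s)\<^sup>2)"
proof -
  have "bounded (f ` {0..t})" using compact_imp_bounded[OF compact_continuous_image[OF f]] by simp
  then obtain K where K: "\<And>s. s \<in> {0..t} \<Longrightarrow> \<bar>f s\<bar> \<le> K" unfolding bounded_iff by fastforce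
  define L where "L = (\<Sum>i<n. \<bar>c i\<bar>) + K"
  have fm: "(\<lambda>s. indicator {0..t} s *\<^sub>R f s) \<in> borel_measurable lborel"
    using borel_measurable_continuous_on_indicator[OF _ f] by simp
  have eq: "(\<lambda>s. indicator {0..t} s *\<^sub>R ((\<Sum>i<n. c i * indicator {\<tau> i<..\<tau> (Suc i)} s) - f s)\<^sup>2)
     = (\<lambda>s. (indicator {0..t} s * (\<Sum>i<n. c i * indicator {\<tau> i<..\<tau> (Suc i)} s) - indicator {0..t} s *\<^sub>R f s)\<^sup>2)"
    by (auto simp: indicator_def)
  show ?thesis
    unfolding set_integrable_def
  proof (rule Bochner_Integration.integrable_bound)
    show "integrable lborel (\<lambda>s. L\<^sup>2 * indicator {0..t} s)"
      by (intro integrable_mult_right integrable_real_indicator) (auto simp: emeasure_lborel_Icc_eq)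
    show "(\<lambda>s. indicator {0..t} s *\<^sub>R ((\<Sum>i<n. c i * indicator {\<tau> i<..\<tau> (Suc i)} s) - f s)\<^sup>2) \<in> borel_measurable lborel"
      unfolding eq using fm by measurable
    show "AE s in lborel. norm (indicator {0..t} s *\<^sub>R ((\<Sum>i<n. c i * indicator {\<tau> i<..\<tau> (Suc i)} s) - f s)\<^sup>2)
        \<le> norm (L\<^sup>2 * indicator {0..t} s)"
    proof (rule AE_I2)
      fix s
      show "norm (indicator {0..t} s *\<^sub>R ((\<Sum>i<n. c i * indicator {\<tau> i<..\<tau> (Suc i)} s) - f s)\<^sup>2)
        \<le> norm (L\<^sup>2 * indicator {0..t} s)"
      proof (cases "s \<in> {0..t}")
        case True
        have "\<bar>\<Sum>i<n. c i * indicator {\<tau> i<..\<tau> (Suc i)} s\<bar> \<le> (\<Sum>i<n. \<bar>c i\<bar>)"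
          by (rule order_trans[OF sum_abs sum_mono]) (auto simp: indicator_def)
        then have "\<bar>(\<Sum>i<n. c i * indicator {\<tau> i<..\<tau> (Suc i)} s) - f s\<bar> \<le> L"
          using K[OF True] unfolding L_def by linarith
        moreover have "norm (indicator {0..t} s *\<^sub>R y\<^sup>2) \<le> norm (L\<^sup>2 * indicator {0..t} s)" if "\<bar>y\<bar> \<le> L" for y :: real
          using True power_mono[OF that, of 2] by simp
        ultimately show ?thesis by blast
      qed simp
    qed
  qed
qed

context brownian_motion begin

text \<open>Stopping the sum when its quadratic variation exceeds \<open>\<delta>\<close> turns a bound in probability on the
  integrand into one on the integral.\<close>

lemma stopped_sum_l0_bound:
  fixes d :: "nat \<Rightarrow> real"
  assumes d: "0 \<le> d 0" "\<And>i j. i < j \<Longrightarrow> j \<le> k \<Longrightarrow> d i < d j"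
    and \<psi>: "\<And>j. j < k \<Longrightarrow> \<psi> j \<in> borel_measurable (\<F> (d j))"
    and O': "O' \<in> events" and \<delta>: "0 < \<delta>"
    and le: "\<And>\<omega>. \<omega> \<in> O' \<Longrightarrow> (\<Sum>j<k. (\<psi> j \<omega>)\<^sup>2 * (d (Suc j) - d j)) \<le> \<delta>"
  shows "l0 O' (\<lambda>\<omega>. \<Sum>j<k. \<psi> j \<omega> * (B (d (Suc j)) \<omega> - B (d j) \<omega>)) \<le> sqrt \<delta>"
proof -
  define V where "V j \<omega> = (\<Sum>l<j. (\<psi> l \<omega>)\<^sup>2 * (d (Suc l) - d l))" for j \<omega>
  \<comment> \<open>The test includes the current term, which is known at time \<open>d j\<close>.
    The sum is thus switched off before it would exceed \<delta>, and the stopped quadratic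
    variation is at most \<delta> on every path.\<close>
  define \<phi> where "\<phi> j \<omega> = (if V (Suc j) \<omega> \<le> \<delta> then \<psi> j \<omega> else 0)" for j \<omega>
  have mono: "d i \<le> d j" if "i \<le> j" "j \<le> k" for i j using d(2)[of i j] that by (cases "i = j") auto
  have Vm: "V (Suc j) \<in> borel_measurable (\<F> (d j))" if "j < k" for j
    unfolding V_def[abs_def]
  proof (intro borel_measurable_sum borel_measurable_times borel_measurable_power borel_measurable_const)
    fix l assume "l \<in> {..<Suc j}"
    then have l: "l < k" "d l \<le> d j" using mono[of l j] that by auto
    show "\<psi> l \<in> borel_measurable (\<F> (d j))" by (rule measurable_bm_filtration_mono[OF l(2) \<psi>[OF l(1)]])
  qed
  have \<phi>m: "\<phi> j \<in> borel_measurable (\<F> (d j))" if "j < k" for j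
    unfolding \<phi>_def[abs_def] using Vm[OF that] \<psi>[OF that] by measurable
  have Vmono: "V i \<omega> \<le> V j \<omega>" if "i \<le> j" "j \<le> k" for i j \<omega>
    unfolding V_def using that by (intro sum_mono2) (auto intro!: mult_nonneg_nonneg simp: mono)
  have W: "(\<Sum>l<j. (\<phi> l \<omega>)\<^sup>2 * (d (Suc l) - d l)) \<le> \<delta>" if "j \<le> k" for j \<omega>
    using that
  proof (induction j)
    case (Suc j)
    show ?case
    proof (cases "V (Suc j) \<omega> \<le> \<delta>")
      case True
      have "(\<Sum>l<Suc j. (\<phi> l \<omega>)\<^sup>2 * (d (Suc l) - d l)) \<le> V (Suc j) \<omega>"
        unfolding V_def by (rule sum_mono) (use Suc.prems mono in \<open>auto simp: \<phi>_def intro!: mult_nonneg_nonneg\<close>)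
      then show ?thesis using True by simp
    next
      case False
      then show ?thesis using Suc by (simp add: \<phi>_def)
    qed
  qed (use \<delta> in simp)
  \<comment> \<open>The given coefficients may be unbounded. A stopped one is bounded because its
    own term in the quadratic variation is at most \<delta> and its cell has positive
    length.\<close>
  have bdd: "\<exists>K. \<forall>\<omega>\<in>space P. \<bar>\<phi> j \<omega>\<bar> \<le> K" if j: "j < k" for j
  proof (intro exI ballI)
    fix \<omega>
    have pos: "0 < d (Suc j) - d j" using d(2)[of j "Suc j"] j by simp
    have "(\<phi> j \<omega>)\<^sup>2 * (d (Suc j) - d j) \<le> (\<Sum>l<Suc j. (\<phi> l \<omega>)\<^sup>2 * (d (Suc l) - d l))"
      using j mono by (intro member_le_sum[where f="\<lambda>l. (\<phi> l \<omega>)\<^sup>2 * (d (Suc l) - d l)"]) (auto intro!: mult_nonneg_nonneg)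
    also have "\<dots> \<le> \<delta>" using W[of "Suc j" \<omega>] j by simp
    finally have "(\<phi> j \<omega>)\<^sup>2 \<le> \<delta> / (d (Suc j) - d j)" using pos by (simp add: field_simps)
    then show "\<bar>\<phi> j \<omega>\<bar> \<le> sqrt (\<delta> / (d (Suc j) - d j))" by (simp add: real_le_rsqrt)
  qed
  have ab: "0 \<le> d i \<and> d i \<le> d (Suc i)" if "i < k" for i
    using that mono[of 0 i] mono[of i "Suc i"] d(1) by simp
  have ab': "d (Suc i) \<le> d j" if "i < j" "j < k" for i j using that mono[of "Suc i" j] by simp
  have v: "integrable P (\<lambda>\<omega>. (B (d (Suc i)) \<omega> - B (d i) \<omega>)\<^sup>2)" "expectation (\<lambda>\<omega>. B (d (Suc i)) \<omega> - B (d i) \<omega>) = 0"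
    "expectation (\<lambda>\<omega>. (B (d (Suc i)) \<omega> - B (d i) \<omega>)\<^sup>2) = d (Suc i) - d i" if "i < k" for i
    using increment_mean_var[of "d i" "d (Suc i)"] ab[OF that] by auto
  have iso: "integrable P (\<lambda>\<omega>. (\<Sum>i<k. \<phi> i \<omega> * (B (d (Suc i)) \<omega> - B (d i) \<omega>))\<^sup>2) \<and>
    (\<forall>i<k. integrable P (\<lambda>\<omega>. (\<phi> i \<omega>)\<^sup>2)) \<and>
    expectation (\<lambda>\<omega>. (\<Sum>i<k. \<phi> i \<omega> * (B (d (Suc i)) \<omega> - B (d i) \<omega>))\<^sup>2)
      = (\<Sum>i<k. expectation (\<lambda>\<omega>. (\<phi> i \<omega>)\<^sup>2) * (d (Suc i) - d i))"
    by (rule expectation_sum_increments[where h="\<lambda>_ x. x" and v="\<lambda>i. d (Suc i) - d i", OF ab ab' \<phi>m bdd])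
       (use v in auto)
  have "(\<Sum>i<k. expectation (\<lambda>\<omega>. (\<phi> i \<omega>)\<^sup>2) * (d (Suc i) - d i)) =
      expectation (\<lambda>\<omega>. \<Sum>i<k. (\<phi> i \<omega>)\<^sup>2 * (d (Suc i) - d i))"
    using iso by (subst Bochner_Integration.integral_sum) auto
  also have "\<dots> \<le> expectation (\<lambda>_. \<delta>)"
    using iso W by (intro integral_mono Bochner_Integration.integrable_sum) auto
  finally have e: "expectation (\<lambda>\<omega>. (\<Sum>i<k. \<phi> i \<omega> * (B (d (Suc i)) \<omega> - B (d i) \<omega>))\<^sup>2) \<le> \<delta>"
    using iso by (simp add: prob_space)
  have eqO: "indicator O' \<omega> * (\<Sum>j<k. \<psi> j \<omega> * (B (d (Suc j)) \<omega> - B (d j) \<omega>))\<^sup>2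
     = indicator O' \<omega> * (\<Sum>j<k. \<phi> j \<omega> * (B (d (Suc j)) \<omega> - B (d j) \<omega>))\<^sup>2" for \<omega>
  proof (cases "\<omega> \<in> O'")
    case True
    have "\<phi> j \<omega> = \<psi> j \<omega>" if "j < k" for j
    proof -
      have "V (Suc j) \<omega> \<le> V k \<omega>" using that by (intro Vmono) auto
      then show ?thesis using le[OF True] by (simp add: \<phi>_def V_def)
    qed
    then show ?thesis by (intro arg_cong[where f="\<lambda>x. indicator O' \<omega> * x\<^sup>2"] sum.cong) auto
  qed simp
  have int: "integrable P (\<lambda>\<omega>. indicator O' \<omega> * (\<Sum>j<k. \<phi> j \<omega> * (B (d (Suc j)) \<omega> - B (d j) \<omega>))\<^sup>2)"
    by (rule integrable_real_mult_indicator[OF O', of "\<lambda>\<omega>. (\<Sum>j<k. \<phi> j \<omega> * (B (d (Suc j)) \<omega> - B (d j) \<omega>))\<^sup>2", simplified mult.commute])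
       (use iso in \<open>simp add: mult.commute\<close>)
  have "expectation (\<lambda>\<omega>. indicator O' \<omega> * (\<Sum>j<k. \<phi> j \<omega> * (B (d (Suc j)) \<omega> - B (d j) \<omega>))\<^sup>2)
    \<le> expectation (\<lambda>\<omega>. (\<Sum>j<k. \<phi> j \<omega> * (B (d (Suc j)) \<omega> - B (d j) \<omega>))\<^sup>2)"
    by (rule integral_mono[OF int]) (use iso in \<open>auto simp: indicator_def\<close>)
  then have e': "expectation (\<lambda>\<omega>. indicator O' \<omega> * (\<Sum>j<k. \<phi> j \<omega> * (B (d (Suc j)) \<omega> - B (d j) \<omega>))\<^sup>2) \<le> (sqrt \<delta>)\<^sup>2"
    using e \<delta> by simp
  show ?thesis
  proof (rule l0_le_L2[OF O'])
    show "(\<lambda>\<omega>. \<Sum>j<k. \<psi> j \<omega> * (B (d (Suc j)) \<omega> - B (d j) \<omega>)) \<in> borel_measurable P"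
      using \<psi> BM_measurable ab
      by (intro borel_measurable_sum borel_measurable_times borel_measurable_diff measurable_filtration[OF \<psi>])
         (auto intro: order_trans)
  qed (use int e' \<delta> in \<open>auto simp: eqO\<close>)
qed

text \<open>Two simple processes can be subtracted only over a common partition; this rewrites one
  over any partition containing its nodes cut off at \<open>t\<close>. Cells are left open and right
  closed, so the value is read off at the right end although it is already known at the left
  end.\<close>

lemma simple_process_refine:
  assumes \<tau>: "0 \<le> \<tau> 0" "\<And>i. i < n \<Longrightarrow> \<tau> i \<le> \<tau> (Suc i)"
    and \<xi>: "\<And>i. i < n \<Longrightarrow> \<xi> i \<in> borel_measurable (\<F> (\<tau> i))"
    and d: "d 0 = 0" "d k = t" "\<And>i j. i < j \<Longrightarrow> j \<le> k \<Longrightarrow> d i < d j"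
    and part: "\<And>i. i \<le> n \<Longrightarrow> min (\<tau> i) t \<in> d ` {..k}"
  shows "\<And>j. j < k \<Longrightarrow> simple_process n \<tau> \<xi> (d (Suc j)) \<in> borel_measurable (\<F> (d j))"
    and "simple_integral B n \<tau> \<xi> t \<omega> = (\<Sum>j<k. simple_process n \<tau> \<xi> (d (Suc j)) \<omega> * (B (d (Suc j)) \<omega> - B (d j) \<omega>))"
    and "\<And>j s. j < k \<Longrightarrow> d j < s \<Longrightarrow> s \<le> d (Suc j) \<Longrightarrow> simple_process n \<tau> \<xi> s \<omega> = simple_process n \<tau> \<xi> (d (Suc j)) \<omega>"
proof -
  have mono: "d i \<le> d j" if "i \<le> j" "j \<le> k" for i j using d(3)[of i j] that by (cases "i = j") auto
  have inv: "i \<le> j" if "d i \<le> d j" "i \<le> k" for i j using d(3)[of j i] that by (cases "i \<le> j") auto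
  have "\<forall>i\<in>{..n}. \<exists>p. p \<le> k \<and> min (\<tau> i) t = d p" using part by force
  then obtain p where p: "\<And>i. i \<le> n \<Longrightarrow> p i \<le> k" "\<And>i. i \<le> n \<Longrightarrow> min (\<tau> i) t = d (p i)"
    by (metis atMost_iff bchoice)
  have p_le: "p i \<le> p (Suc i)" if "i < n" for i
    using inv[of "p i" "p (Suc i)"] p[of i] p[of "Suc i"] \<tau>(2)[OF that] that by (auto simp: min_def split: if_splits)
  \<comment> \<open>No node lies strictly inside a cell, so comparing a node with a point of the
    cell reduces to comparing indices. Repeated nodes give empty index ranges, and a node at or
    beyond \<open>t\<close> has index \<open>k\<close>, past every cell.\<close>
  have lt: "\<tau> i < s \<longleftrightarrow> p i \<le> j" and ge: "s \<le> \<tau> i \<longleftrightarrow> \<not> p i \<le> j"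
    if "i \<le> n" "j < k" "d j < s" "s \<le> d (Suc j)" for i j s
  proof -
    have st: "s \<le> t" using mono[of "Suc j" k] that d(2) by simp
    have "\<tau> i < s" if "p i \<le> j"
    proof -
      have "d (p i) \<le> d j" using mono[OF that] \<open>j < k\<close> by simp
      then have "min (\<tau> i) t < s" using p(2)[OF \<open>i \<le> n\<close>] \<open>d j < s\<close> by simp
      then show ?thesis using st by (auto simp: min_def split: if_splits)
    qed
    moreover have "s \<le> \<tau> i" if "\<not> p i \<le> j"
    proof -
      have "d (Suc j) \<le> d (p i)" using that mono[of "Suc j" "p i"] p(1)[OF \<open>i \<le> n\<close>] by simp
      then have "s \<le> min (\<tau> i) t" using p(2)[OF \<open>i \<le> n\<close>] \<open>s \<le> d (Suc j)\<close> by simp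
      then show ?thesis by simp
    qed
    ultimately show "\<tau> i < s \<longleftrightarrow> p i \<le> j" "s \<le> \<tau> i \<longleftrightarrow> \<not> p i \<le> j" by force+
  qed
  have ind: "indicator {\<tau> i<..\<tau> (Suc i)} s = (of_bool (p i \<le> j \<and> j < p (Suc i)) :: real)"
    if "i < n" "j < k" "d j < s" "s \<le> d (Suc j)" for i j s
    using lt[of i j s] ge[of "Suc i" j s] that by (auto simp: indicator_def not_le)
  have dS: "d j < d (Suc j)" if "j < k" for j using d(3)[of j "Suc j"] that by simp
  have sp: "simple_process n \<tau> \<xi> s \<omega> = (\<Sum>i<n. \<xi> i \<omega> * of_bool (p i \<le> j \<and> j < p (Suc i)))"
    if "j < k" "d j < s" "s \<le> d (Suc j)" for j s \<omega>
    unfolding simple_process_def by (rule sum.cong) (use ind that in auto)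
  show "simple_process n \<tau> \<xi> s \<omega> = simple_process n \<tau> \<xi> (d (Suc j)) \<omega>"
    if "j < k" "d j < s" "s \<le> d (Suc j)" for j s
    using sp[OF that] sp[OF that(1) dS[OF that(1)] order_refl] by simp
  show "simple_process n \<tau> \<xi> (d (Suc j)) \<in> borel_measurable (\<F> (d j))" if j: "j < k" for j
  proof -
    have "simple_process n \<tau> \<xi> (d (Suc j)) = (\<lambda>\<omega>. \<Sum>i<n. if p i \<le> j \<and> j < p (Suc i) then \<xi> i \<omega> else 0)"
    proof
      fix \<omega> show "simple_process n \<tau> \<xi> (d (Suc j)) \<omega> = (\<Sum>i<n. if p i \<le> j \<and> j < p (Suc i) then \<xi> i \<omega> else 0)"
        unfolding sp[OF j dS[OF j] order_refl] by (rule sum.cong) simp_all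
    qed
    also have "\<dots> \<in> borel_measurable (\<F> (d j))"
    proof (rule borel_measurable_sum)
      fix i assume "i \<in> {..<n}"
      then have i: "i < n" by simp
      show "(\<lambda>\<omega>. if p i \<le> j \<and> j < p (Suc i) then \<xi> i \<omega> else 0) \<in> borel_measurable (\<F> (d j))"
      proof (cases "p i \<le> j \<and> j < p (Suc i)")
        case True
        have "d (p i) \<le> d j" using mono[of "p i" j] True j by simp
        moreover have "d j < t" using mono[of "Suc j" k] dS[OF j] j d(2) by simp
        ultimately have "\<tau> i \<le> d j" using p(2)[of i] i by (auto simp: min_def split: if_splits)
        then show ?thesis using True \<xi>[OF i] by (simp add: measurable_bm_filtration_mono)
      qed (auto intro: borel_measurable_const)
    qed
    finally show ?thesis .
  qed
  have tel: "(\<Sum>j<k. of_bool (p i \<le> j \<and> j < p (Suc i)) * (B (d (Suc j)) \<omega> - B (d j) \<omega>))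
      = B (min (\<tau> (Suc i)) t) \<omega> - B (min (\<tau> i) t) \<omega>" if i: "i < n" for i
  proof -
    have "(\<Sum>j<k. of_bool (p i \<le> j \<and> j < p (Suc i)) * (B (d (Suc j)) \<omega> - B (d j) \<omega>))
        = (\<Sum>j\<in>{p i..<p (Suc i)}. B (d (Suc j)) \<omega> - B (d j) \<omega>)"
      by (rule sum.mono_neutral_cong_right) (use p(1)[of "Suc i"] i in auto)
    also have "\<dots> = B (d (p (Suc i))) \<omega> - B (d (p i)) \<omega>"
      using sum_Suc_diff'[OF p_le[OF i], of "\<lambda>j. B (d j) \<omega>"] .
    finally show ?thesis using p(2)[of i] p(2)[of "Suc i"] i by simp
  qed
  have "(\<Sum>j<k. simple_process n \<tau> \<xi> (d (Suc j)) \<omega> * (B (d (Suc j)) \<omega> - B (d j) \<omega>))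
     = (\<Sum>j<k. \<Sum>i<n. \<xi> i \<omega> * (of_bool (p i \<le> j \<and> j < p (Suc i)) * (B (d (Suc j)) \<omega> - B (d j) \<omega>)))"
  proof (rule sum.cong[OF refl])
    fix j assume "j \<in> {..<k}"
    then have j: "j < k" by simp
    show "simple_process n \<tau> \<xi> (d (Suc j)) \<omega> * (B (d (Suc j)) \<omega> - B (d j) \<omega>) =
      (\<Sum>i<n. \<xi> i \<omega> * (of_bool (p i \<le> j \<and> j < p (Suc i)) * (B (d (Suc j)) \<omega> - B (d j) \<omega>)))"
      unfolding sp[OF j dS[OF j] order_refl] by (simp only: sum_distrib_right mult.assoc)
  qed
  also have "\<dots> = (\<Sum>i<n. \<xi> i \<omega> * (\<Sum>j<k. of_bool (p i \<le> j \<and> j < p (Suc i)) * (B (d (Suc j)) \<omega> - B (d j) \<omega>)))"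
    unfolding sum_distrib_left by (rule sum.swap)
  also have "\<dots> = simple_integral B n \<tau> \<xi> t \<omega>"
    unfolding simple_integral_def by (rule sum.cong) (use tel in auto)
  finally show "simple_integral B n \<tau> \<xi> t \<omega> = (\<Sum>j<k. simple_process n \<tau> \<xi> (d (Suc j)) \<omega> * (B (d (Suc j)) \<omega> - B (d j) \<omega>))" ..
qed

end

section \<open>The Ito integral compared with its left-point sums\<close>

lemma partition_locate:
  fixes d :: "nat \<Rightarrow> real"
  assumes "d 0 < s" "s \<le> d k"
  shows "\<exists>q<k. d q < s \<and> s \<le> d (Suc q)"
  using assms
proof (induction k)
  case (Suc k)
  then show ?case by (cases "s \<le> d k") (auto intro: less_SucI)
qed simp

lemma simple_process_eval:
  assumes \<tau>: "\<And>i j. i < j \<Longrightarrow> j \<le> N \<Longrightarrow> \<tau> i \<le> \<tau> j" and q: "q < N" "\<tau> q < s" "s \<le> \<tau> (Suc q)"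
  shows "simple_process N \<tau> \<xi> s \<omega> = \<xi> q \<omega>"
proof -
  have "simple_process N \<tau> \<xi> s \<omega> = (\<Sum>l<N. if l = q then \<xi> q \<omega> else 0)"
    unfolding simple_process_def
  proof (rule sum.cong[OF refl])
    fix l assume l: "l \<in> {..<N}"
    show "\<xi> l \<omega> * indicator {\<tau> l<..\<tau> (Suc l)} s = (if l = q then \<xi> q \<omega> else 0)"
    proof (cases l q rule: linorder_cases)
      case less
      then have "\<tau> (Suc l) \<le> \<tau> q" using \<tau>[of "Suc l" q] q(1) by (cases "Suc l = q") auto
      then show ?thesis using less q by (auto simp: indicator_def)
    next
      case equal
      then show ?thesis using q by (auto simp: indicator_def)
    next
      case greater
      then have "\<tau> (Suc q) \<le> \<tau> l" using \<tau>[of "Suc q" l] l by (cases "Suc q = l") auto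
      then show ?thesis using greater q by (auto simp: indicator_def)
    qed
  qed
  then show ?thesis using q(1) by (simp add: sum.delta)
qed

lemma mesh_tendsto_0: "(\<lambda>m. T / 2 ^ (n + m)) \<longlonglongrightarrow> (0::real)"
proof -
  have "(\<lambda>n. T / 2 ^ n) \<longlonglongrightarrow> 0"
    using tendsto_mult[OF tendsto_const[of T] LIMSEQ_inverse_realpow_zero[of 2]] by (simp add: divide_inverse)
  from LIMSEQ_ignore_initial_segment[OF this, of n] show ?thesis by (simp add: add.commute)
qed

context brownian_motion begin

text \<open>The definition supplies some approximating simple processes, not Riemann sums. A Riemann
  sum is itself the integral of a simple process, uniformly close to \<open>X\<close> once the mesh
  is below the modulus of continuity. On a good event the two simple processes are therefore close
  in mean square over time, and the stopped sum bound makes their integrals close.\<close>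

lemma ito_integral_riemann:
  assumes T: "0 < T" and i: "i \<le> 2 ^ n"
    and Xc: "AE \<omega> in P. continuous_on {0..T} (\<lambda>t. X t \<omega>)"
    and Xa: "\<And>s. s \<in> {0..T} \<Longrightarrow> X s \<in> borel_measurable (\<F> s)"
    and ito: "has_ito_integral P B X (grid T n i) I"
  shows "(\<lambda>m. l0 (space P) (\<lambda>\<omega>. I \<omega> - rsum T X (n + m) (i * 2 ^ m) \<omega>)) \<longlonglongrightarrow> 0"
proof -
  define t where "t = grid T n i"
  have t: "t \<in> {0..T}" unfolding t_def using grid_mem[of T i n] T i by simp
  have Xm: "\<And>s. s \<in> {0..T} \<Longrightarrow> X s \<in> borel_measurable P" using Xa measurable_filtration by blast
  obtain nn \<tau> \<xi> where simp: "\<And>k::nat. simple_adapted P \<F> (nn k) (\<tau> k) (\<xi> k)"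
    and conv: "conv_in_prob P (\<lambda>k \<omega>. LINT s:{0..t}|lborel. (simple_process (nn k) (\<tau> k) (\<xi> k) s \<omega> - X s \<omega>)\<^sup>2) (\<lambda>_. 0) sequentially"
    and convI: "conv_in_prob P (\<lambda>k. simple_integral B (nn k) (\<tau> k) (\<xi> k) t) I sequentially"
    using ito unfolding has_ito_integral_def t_def[symmetric] by blast
  define G where "G k \<omega> = (LINT s:{0..t}|lborel. (simple_process (nn k) (\<tau> k) (\<xi> k) s \<omega> - X s \<omega>)\<^sup>2)" for k \<omega>
  define J where "J k = simple_integral B (nn k) (\<tau> k) (\<xi> k) t" for k
  have Gm: "\<forall>\<^sub>F k in sequentially. G k \<in> borel_measurable P"
    and G0: "\<And>e. 0 < e \<Longrightarrow> (\<lambda>k. prob {\<omega>\<in>space P. e < \<bar>G k \<omega>\<bar>}) \<longlonglongrightarrow> 0"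
    using conv unfolding conv_in_prob_def G_def[symmetric] by auto
  have Jm: "\<forall>\<^sub>F k in sequentially. J k \<in> borel_measurable P" and Im: "I \<in> borel_measurable P"
    using convI unfolding conv_in_prob_def J_def[symmetric] by auto
  have J0: "(\<lambda>k. l0 (space P) (\<lambda>\<omega>. J k \<omega> - I \<omega>)) \<longlonglongrightarrow> 0"
    using conv_in_prob_l0[OF prob_space_axioms convI] unfolding J_def .
  obtain C where C: "C \<in> events" "prob (space P - C) = 0" "\<And>\<omega>. \<omega> \<in> C \<Longrightarrow> continuous_on {0..T} (\<lambda>t. X t \<omega>)"
    using AE_event[OF Xc] by metis
  show ?thesis
  proof (rule tendstoI)
    fix \<epsilon> :: real assume "0 < \<epsilon>"
    define \<eta> where "\<eta> = \<epsilon> / 5"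
    have \<eta>: "0 < \<eta>" using \<open>0 < \<epsilon>\<close> by (simp add: \<eta>_def)
    \<comment> \<open>\<open>e\<close> bounds the squared distance of the approximant from
      \<open>X\<close> and \<delta> the oscillation of \<open>X\<close>; each of the two contributes
      at most half of \<eta>^2 to the quadratic variation. Using T + 1 leaves slack in the
      second.\<close>
    define e where "e = \<eta>\<^sup>2 / 4"
    define \<delta> where "\<delta> = \<eta> / (2 * sqrt (T + 1))"
    have e: "0 < e" and \<delta>: "0 < \<delta>" using \<eta> T by (auto simp: e_def \<delta>_def)
    have e\<delta>: "2 * e + 2 * \<delta>\<^sup>2 * t \<le> \<eta>\<^sup>2"
    proof -
      have "2 * \<delta>\<^sup>2 * t \<le> 2 * \<delta>\<^sup>2 * (T + 1)" using t by (intro mult_left_mono) auto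
      also have "\<dots> = \<eta>\<^sup>2 / 2"      proof -
        have "\<delta>\<^sup>2 = \<eta>\<^sup>2 / (4 * (T + 1))" using T by (simp add: \<delta>_def power_divide power_mult_distrib)
        moreover have "T + 1 \<noteq> 0" using T by simp
        ultimately show ?thesis by (simp add: divide_simps) (simp add: algebra_simps)
      qed
      finally show ?thesis by (simp add: e_def)
    qed
    obtain h O3 where O3: "0 < h" "O3 \<in> events" "prob (space P - O3) \<le> \<eta>"
      "\<And>\<omega> s s'. \<omega> \<in> O3 \<Longrightarrow> s \<in> {0..T} \<Longrightarrow> s' \<in> {0..T} \<Longrightarrow> \<bar>s - s'\<bar> < h \<Longrightarrow> \<bar>X s \<omega> - X s' \<omega>\<bar> \<le> \<delta>"
      using modulus_path_event[OF Xm Xc \<eta> \<delta>] by metis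
    have "\<forall>\<^sub>F m in sequentially. T / 2 ^ (n + m) < h" by (rule order_tendstoD(2)[OF mesh_tendsto_0 O3(1)])
    then show "\<forall>\<^sub>F m in sequentially. dist (l0 (space P) (\<lambda>\<omega>. I \<omega> - rsum T X (n + m) (i * 2 ^ m) \<omega>)) 0 < \<epsilon>"
    proof eventually_elim
      case (elim m)
      note mh = elim
      define N where "N = i * 2 ^ m"
      define r where "r = grid T (n + m)"
      have rN: "r N = t" unfolding r_def N_def t_def by (rule grid_refine)
      have r0: "r 0 = 0" by (simp add: r_def)
      have rS: "r (Suc j) = r j + T / 2 ^ (n + m)" for j by (simp add: r_def grid_Suc)
      have rmono: "r j \<le> r l" if "j \<le> l" for j l unfolding r_def using T that by (intro grid_mono) auto
      have rmem: "r j \<in> {0..t}" if "j \<le> N" for j using rmono[of 0 j] rmono[OF that] r0 rN by simp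
      have rsum_eq: "rsum T X (n + m) N \<omega> = simple_integral B N r (\<lambda>j. X (r j)) t \<omega>" for \<omega>
        unfolding rsum_def simple_integral_def r_def[symmetric]
      proof (rule sum.cong[OF refl])
        fix j assume "j \<in> {..<N}"
        then have "min (r j) t = r j" "min (r (Suc j)) t = r (Suc j)" using rmem[of j] rmem[of "Suc j"] by auto
        then show "X (r j) \<omega> * (B (r (Suc j)) \<omega> - B (r j) \<omega>) = X (r j) \<omega> * (B (min (r (Suc j)) t) \<omega> - B (min (r j) t) \<omega>)" by simp
      qed
      \<comment> \<open>The approximant is picked after \<open>m\<close>: it is only a go-between
        for the integral and the Riemann sum, so its index may depend on the mesh.\<close>
      have "\<forall>\<^sub>F k in sequentially. G k \<in> borel_measurable P \<and> J k \<in> borel_measurable P \<and>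
          prob {\<omega>\<in>space P. e < \<bar>G k \<omega>\<bar>} < \<eta> \<and> l0 (space P) (\<lambda>\<omega>. J k \<omega> - I \<omega>) < \<eta>"
        using Gm Jm order_tendstoD(2)[OF G0[OF e] \<eta>] order_tendstoD(2)[OF J0 \<eta>]
        by eventually_elim simp
      then obtain k where k: "G k \<in> borel_measurable P" "J k \<in> borel_measurable P"
          "prob {\<omega>\<in>space P. e < \<bar>G k \<omega>\<bar>} < \<eta>" "l0 (space P) (\<lambda>\<omega>. J k \<omega> - I \<omega>) < \<eta>"
        by (auto simp: eventually_sequentially)
      have sa: "0 \<le> \<tau> k 0" "\<And>q. q < nn k \<Longrightarrow> \<tau> k q \<le> \<tau> k (Suc q)"
          "\<And>q. q < nn k \<Longrightarrow> \<xi> k q \<in> borel_measurable (\<F> (\<tau> k q))"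
        using simp[of k] unfolding simple_adapted_def by auto
      have \<tau>0: "0 \<le> \<tau> k q" if "q \<le> nn k" for q
        using that by (induction q) (use sa(1,2) in \<open>auto intro: order_trans\<close>)
      \<comment> \<open>The common refinement of the two partitions, with the nodes of the
        approximant cut off at \<open>t\<close>.\<close>
      define D where "D = insert 0 (insert t ((\<lambda>q. min (\<tau> k q) t) ` {..nn k} \<union> r ` {..N}))"
      have D: "finite D" "D \<noteq> {}" "D \<subseteq> {0..t}" "0 \<in> D" "t \<in> D"
        using t \<tau>0 rmem unfolding D_def by auto
      obtain K :: nat and d :: "nat \<Rightarrow> real" where d: "D = d ` {..K}" "\<And>i j. i < j \<Longrightarrow> j \<le> K \<Longrightarrow> d i < d j"
        using sorted_enum[OF D(1,2), of thesis] by blast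
      have dmono: "d i \<le> d j" if "i \<le> j" "j \<le> K" for i j using d(2)[of i j] that by (cases "i = j") auto
      have dD: "d j \<in> {0..t}" if "j \<le> K" for j using D(3) that unfolding d(1) by auto
      have d0: "d 0 = 0"
      proof -
        obtain q where "q \<le> K" "d q = 0" using D(4) unfolding d(1) by auto
        then show ?thesis using dmono[of 0 q] dD[of 0] by simp
      qed
      have dK: "d K = t"
      proof -
        obtain q where "q \<le> K" "d q = t" using D(5) unfolding d(1) by auto
        then show ?thesis using dmono[of q K] dD[of K] by simp
      qed
      have part1: "min (\<tau> k q) t \<in> d ` {..K}" if "q \<le> nn k" for q
        unfolding d(1)[symmetric] D_def using that by auto
      have part2: "min (r q) t \<in> d ` {..K}" if "q \<le> N" for q
      proof -
        have "min (r q) t = r q" using rmem[OF that] by simp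
        then show ?thesis unfolding d(1)[symmetric] D_def using that by auto
      qed
      have Xr: "X (r q) \<in> borel_measurable (\<F> (r q))" if "q < N" for q
        using rmem[of q] that t by (intro Xa) auto
      have rS': "r q \<le> r (Suc q)" if "q < N" for q using rmono[of q "Suc q"] by auto
      have r00: "0 \<le> r 0" using r0 by simp
      have ref1: "\<And>j. j < K \<Longrightarrow> simple_process (nn k) (\<tau> k) (\<xi> k) (d (Suc j)) \<in> borel_measurable (\<F> (d j))"
        "\<And>\<omega>. simple_integral B (nn k) (\<tau> k) (\<xi> k) t \<omega> =
           (\<Sum>j<K. simple_process (nn k) (\<tau> k) (\<xi> k) (d (Suc j)) \<omega> * (B (d (Suc j)) \<omega> - B (d j) \<omega>))"
        "\<And>j s \<omega>. j < K \<Longrightarrow> d j < s \<Longrightarrow> s \<le> d (Suc j) \<Longrightarrow>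
           simple_process (nn k) (\<tau> k) (\<xi> k) s \<omega> = simple_process (nn k) (\<tau> k) (\<xi> k) (d (Suc j)) \<omega>"
        by (rule simple_process_refine[where d=d and k=K and t=t, OF sa d0 dK d(2) part1]; assumption)+
      have ref2: "\<And>j. j < K \<Longrightarrow> simple_process N r (\<lambda>j. X (r j)) (d (Suc j)) \<in> borel_measurable (\<F> (d j))"
        "\<And>\<omega>. simple_integral B N r (\<lambda>j. X (r j)) t \<omega> =
           (\<Sum>j<K. simple_process N r (\<lambda>j. X (r j)) (d (Suc j)) \<omega> * (B (d (Suc j)) \<omega> - B (d j) \<omega>))"
        "\<And>j s \<omega>. j < K \<Longrightarrow> d j < s \<Longrightarrow> s \<le> d (Suc j) \<Longrightarrow>
           simple_process N r (\<lambda>j. X (r j)) s \<omega> = simple_process N r (\<lambda>j. X (r j)) (d (Suc j)) \<omega>"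
        by (rule simple_process_refine[where d=d and k=K and t=t and \<tau>=r and n=N and \<xi>="\<lambda>j. X (r j)", OF r00 rS' Xr d0 dK d(2) part2]; assumption)+
      define \<phi> where "\<phi> = simple_process (nn k) (\<tau> k) (\<xi> k)"
      define \<theta> where "\<theta> = simple_process N r (\<lambda>j. X (r j))"
      define \<psi> where "\<psi> j \<omega> = \<phi> (d (Suc j)) \<omega> - \<theta> (d (Suc j)) \<omega>" for j \<omega>
      have diff: "J k \<omega> - rsum T X (n + m) N \<omega> = (\<Sum>j<K. \<psi> j \<omega> * (B (d (Suc j)) \<omega> - B (d j) \<omega>))" for \<omega>
        unfolding J_def rsum_eq ref1(2) ref2(2) \<psi>_def \<phi>_def \<theta>_def sum_subtractf[symmetric]
        by (rule sum.cong) (auto simp: left_diff_distrib)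
      define O' where "O' = C \<inter> O3 \<inter> {\<omega>\<in>space P. \<bar>G k \<omega>\<bar> \<le> e}"
      have Ge: "{\<omega>\<in>space P. \<bar>G k \<omega>\<bar> \<le> e} \<in> events" "{\<omega>\<in>space P. e < \<bar>G k \<omega>\<bar>} \<in> events"
        using k(1) by measurable
      have O': "O' \<in> events" unfolding O'_def using C(1) O3(2) Ge by auto
      have small: "prob (space P - O') \<le> 2 * \<eta>"
      proof -
        have "prob (space P - O') \<le> prob ((space P - C) \<union> ((space P - O3) \<union> {\<omega>\<in>space P. e < \<bar>G k \<omega>\<bar>}))"
          using C(1) O3(2) Ge by (intro finite_measure_mono) (auto simp: O'_def)
        also have "\<dots> \<le> prob (space P - C) + prob ((space P - O3) \<union> {\<omega>\<in>space P. e < \<bar>G k \<omega>\<bar>})"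
          using C(1) O3(2) Ge by (intro measure_Un_le) auto
        also have "prob ((space P - O3) \<union> {\<omega>\<in>space P. e < \<bar>G k \<omega>\<bar>}) \<le> prob (space P - O3) + prob {\<omega>\<in>space P. e < \<bar>G k \<omega>\<bar>}"
          using O3(2) Ge by (intro measure_Un_le) auto
        finally show ?thesis using C(2) O3(3) k(3) by linarith
      qed
      have "l0 O' (\<lambda>\<omega>. \<Sum>j<K. \<psi> j \<omega> * (B (d (Suc j)) \<omega> - B (d j) \<omega>)) \<le> sqrt (\<eta>\<^sup>2)"
      proof (rule stopped_sum_l0_bound[OF _ d(2) _ O'])
        show "0 \<le> d 0" by (simp add: d0)
        show "\<psi> j \<in> borel_measurable (\<F> (d j))" if "j < K" for j
          unfolding \<psi>_def[abs_def] \<phi>_def \<theta>_def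
          by (rule borel_measurable_diff[OF ref1(1)[OF that] ref2(1)[OF that]])
        show "0 < \<eta>\<^sup>2" using \<eta> by simp
        fix \<omega> assume \<omega>: "\<omega> \<in> O'"
        have c: "continuous_on {0..t} (\<lambda>s. X s \<omega>)"
          using C(3)[of \<omega>] \<omega> t unfolding O'_def by (auto intro: continuous_on_subset)
        have "set_integrable lborel {0..t} (\<lambda>s. (\<phi> s \<omega> - X s \<omega>)\<^sup>2)"
          unfolding \<phi>_def simple_process_def by (rule set_integrable_step_minus_continuous[OF c])
        then have si1: "set_integrable lborel {0..t} (\<lambda>s. 2 * (\<phi> s \<omega> - X s \<omega>)\<^sup>2)" by simp
        have ci: "set_integrable lborel {0..t} (\<lambda>_. 2 * \<delta>\<^sup>2)"
          unfolding set_integrable_def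
          by (intro integrable_scaleR_left integrable_real_indicator) (auto simp: emeasure_lborel_Icc_eq)
        note si2 = set_integral_add(1)[OF si1 ci]
        have A1: "(LINT s:{0..t}|lborel. (\<phi> s \<omega> - \<theta> s \<omega>)\<^sup>2) = (\<Sum>j<K. (\<psi> j \<omega>)\<^sup>2 * (d (Suc j) - d j))"
        proof (rule integral_step_function[OF d0 dK d(2)])
          fix j s assume j: "j < K" "d j < s" "s \<le> d (Suc j)"
          show "(\<phi> s \<omega> - \<theta> s \<omega>)\<^sup>2 = (\<psi> j \<omega>)\<^sup>2"
            unfolding \<psi>_def \<phi>_def \<theta>_def using ref1(3)[OF j] ref2(3)[OF j] by simp
        qed
        have A2: "(LINT s:{0..t}|lborel. (\<phi> s \<omega> - \<theta> s \<omega>)\<^sup>2) \<le> (LINT s:{0..t}|lborel. 2 * (\<phi> s \<omega> - X s \<omega>)\<^sup>2 + 2 * \<delta>\<^sup>2)"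
          unfolding set_lebesgue_integral_def
        proof (rule integral_mono_AE'[OF si2[unfolded set_integrable_def]])
          have "AE s in lborel. s \<noteq> (0::real)" by (rule AE_lborel_singleton)
          then show "AE s in lborel. indicator {0..t} s *\<^sub>R (\<phi> s \<omega> - \<theta> s \<omega>)\<^sup>2 \<le> indicator {0..t} s *\<^sub>R (2 * (\<phi> s \<omega> - X s \<omega>)\<^sup>2 + 2 * \<delta>\<^sup>2)"
          proof eventually_elim
            case (elim s)
            show ?case
            proof (cases "s \<in> {0..t}")
              case True
              then have "r 0 < s" "s \<le> r N" using elim r0 rN by auto
              then obtain q where q: "q < N" "r q < s" "s \<le> r (Suc q)" using partition_locate by blast
              have "\<theta> s \<omega> = X (r q) \<omega>" unfolding \<theta>_def
                by (rule simple_process_eval[OF rmono[OF less_imp_le] q])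
              moreover have "\<bar>X s \<omega> - X (r q) \<omega>\<bar> \<le> \<delta>"
                using \<omega> True t rmem[of q] q rS[of q] mh by (intro O3(4)) (auto simp: O'_def)
              ultimately have "(X s \<omega> - \<theta> s \<omega>)\<^sup>2 \<le> \<delta>\<^sup>2" using power_mono[of "\<bar>X s \<omega> - X (r q) \<omega>\<bar>" \<delta> 2] by simp
              moreover have "(\<phi> s \<omega> - \<theta> s \<omega>)\<^sup>2 \<le> 2 * (\<phi> s \<omega> - X s \<omega>)\<^sup>2 + 2 * (X s \<omega> - \<theta> s \<omega>)\<^sup>2"
                using square_sum_le[of "\<phi> s \<omega> - X s \<omega>" "X s \<omega> - \<theta> s \<omega>"] by simp
              ultimately have "(\<phi> s \<omega> - \<theta> s \<omega>)\<^sup>2 \<le> 2 * (\<phi> s \<omega> - X s \<omega>)\<^sup>2 + 2 * \<delta>\<^sup>2" by linarith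
              then show ?thesis using True by simp
            qed simp
          qed
        qed (auto simp: indicator_def)
        have A3: "(LINT s:{0..t}|lborel. 2 * (\<phi> s \<omega> - X s \<omega>)\<^sup>2 + 2 * \<delta>\<^sup>2) = 2 * G k \<omega> + 2 * \<delta>\<^sup>2 * t"
        proof -
          have "(LINT s:{0..t}|lborel. 2 * (\<phi> s \<omega> - X s \<omega>)\<^sup>2 + 2 * \<delta>\<^sup>2)
            = (LINT s:{0..t}|lborel. 2 * (\<phi> s \<omega> - X s \<omega>)\<^sup>2) + (LINT s:{0..t}|lborel. 2 * \<delta>\<^sup>2)"
            by (rule set_integral_add(2)[OF si1 ci])
          also have "(LINT s:{0..t}|lborel. 2 * (\<phi> s \<omega> - X s \<omega>)\<^sup>2) = 2 * G k \<omega>"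
            unfolding G_def \<phi>_def by (rule set_integral_mult_right)
          also have "(LINT s:{0..t}|lborel. 2 * \<delta>\<^sup>2) = 2 * \<delta>\<^sup>2 * t"
            using t by (simp add: set_lebesgue_integral_def)
          finally show ?thesis .
        qed
        have A4: "G k \<omega> \<le> e" using \<omega> unfolding O'_def by auto
        show "(\<Sum>j<K. (\<psi> j \<omega>)\<^sup>2 * (d (Suc j) - d j)) \<le> \<eta>\<^sup>2"
          unfolding A1[symmetric] using A2 A4 e\<delta> unfolding A3 by linarith
      qed
      then have "l0 O' (\<lambda>\<omega>. J k \<omega> - rsum T X (n + m) N \<omega>) \<le> \<eta>" unfolding diff using \<eta> by simp
      moreover have rm: "rsum T X (n + m) N \<in> borel_measurable P"
        unfolding rsum_def[abs_def] r_def[symmetric]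
      proof (intro borel_measurable_sum borel_measurable_times borel_measurable_diff BM_measurable)
        fix j assume "j \<in> {..<N}"
        then show "X (r j) \<in> borel_measurable P" "0 \<le> r (Suc j)" "0 \<le> r j"
          using rmem[of j] rmem[of "Suc j"] t by (auto intro: Xm)
      qed
      ultimately have 1: "l0 (space P) (\<lambda>\<omega>. J k \<omega> - rsum T X (n + m) N \<omega>) \<le> 3 * \<eta>"
        using l0_split[OF sets.top O' sets.sets_into_space[OF O'] borel_measurable_diff[OF k(2) rm]] small by simp
      have "l0 (space P) (\<lambda>\<omega>. I \<omega> - rsum T X (n + m) N \<omega>)
          = l0 (space P) (\<lambda>\<omega>. (J k \<omega> - rsum T X (n + m) N \<omega>) - (J k \<omega> - I \<omega>))" by simp
      also have "\<dots> \<le> l0 (space P) (\<lambda>\<omega>. J k \<omega> - rsum T X (n + m) N \<omega>) + l0 (space P) (\<lambda>\<omega>. J k \<omega> - I \<omega>)"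
        by (rule l0_diff) (use k(2) rm Im in auto)
      finally have "l0 (space P) (\<lambda>\<omega>. I \<omega> - rsum T X (n + m) N \<omega>) < \<epsilon>"
        using 1 k(4) \<open>0 < \<epsilon>\<close> by (simp add: \<eta>_def)
      then show ?case using l0_nonneg[of "space P" "\<lambda>\<omega>. I \<omega> - rsum T X (n + m) N \<omega>"]
        by (simp add: dist_real_def N_def)
    qed
  qed
qed

end

section \<open>Forward integrals as limits of Riemann sums\<close>

text \<open>By continuity the process is the limit of its values at times rounded down to multiples
  of 1/(q+1). Each approximation is jointly measurable, since the rounded time takes countably many
  values. Tonelli's theorem for time averages rests on this.\<close>

lemma joint_measurable_continuous_paths:
  fixes Y :: "real \<Rightarrow> 'a \<Rightarrow> real"
  assumes Y: "\<And>t. t \<in> {0..T} \<Longrightarrow> Y t \<in> borel_measurable M" and O': "O' \<in> sets M"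
    and c: "\<And>\<omega>. \<omega> \<in> O' \<Longrightarrow> continuous_on {0..T} (\<lambda>t. Y t \<omega>)"
  shows "(\<lambda>(u, \<omega>). indicator O' \<omega> * (indicator {0..T} u * Y u \<omega>)) \<in> borel_measurable (lborel \<Otimes>\<^sub>M M)"
proof -
  \<comment> \<open>The countable gluing ranges over all integers, hence over times outside [0,T] as
    well, where nothing is assumed about \<open>Y\<close>; there it is set to 0.\<close>
  define Y' where "Y' s = (if s \<in> {0..T} then Y s else (\<lambda>_. 0))" for s
  have Y'[measurable]: "Y' s \<in> borel_measurable M" for s unfolding Y'_def using Y by auto
  define f where "f q = (\<lambda>(u, \<omega>). indicator O' \<omega> * (indicator {0..T} u * Y' (of_int \<lfloor>real (Suc q) * u\<rfloor> / real (Suc q)) \<omega>))" for q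
  show ?thesis
  proof (rule borel_measurable_LIMSEQ_real)
    fix q
    have 1: "(\<lambda>(u, \<omega>). Y' (of_int i / real (Suc q)) \<omega>) \<in> borel_measurable (lborel \<Otimes>\<^sub>M M)" for i :: int
      by measurable
    have 2: "(\<lambda>(u, \<omega>). \<lfloor>real (Suc q) * u\<rfloor>) \<in> measurable (lborel \<Otimes>\<^sub>M M) (count_space UNIV)"
      by measurable
    have "(\<lambda>x. (\<lambda>(u, \<omega>). Y' (of_int ((\<lambda>(u, \<omega>). \<lfloor>real (Suc q) * u\<rfloor>) x) / real (Suc q)) \<omega>) x) \<in> borel_measurable (lborel \<Otimes>\<^sub>M M)"
      by (rule measurable_compose_countable[OF 1 2])
    then have "(\<lambda>(u, \<omega>). Y' (of_int \<lfloor>real (Suc q) * u\<rfloor> / real (Suc q)) \<omega>) \<in> borel_measurable (lborel \<Otimes>\<^sub>M M)"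
      by (simp add: case_prod_beta')
    then show "f q \<in> borel_measurable (lborel \<Otimes>\<^sub>M M)"
      unfolding f_def case_prod_beta' using O' by measurable
  next
    fix x :: "real \<times> 'a"
    obtain u \<omega> where x: "x = (u, \<omega>)" by (cases x)
    show "(\<lambda>q. f q x) \<longlonglongrightarrow> (case x of (u, \<omega>) \<Rightarrow> indicator O' \<omega> * (indicator {0..T} u * Y u \<omega>))"
    proof (cases "\<omega> \<in> O' \<and> u \<in> {0..T}")
      case True
      then have u: "u \<in> {0..T}" and \<omega>: "\<omega> \<in> O'" by auto
      define r where "r q = of_int \<lfloor>real (Suc q) * u\<rfloor> / real (Suc q)" for q
      have r: "r \<longlonglongrightarrow> u" "\<And>q. r q \<in> {0..T}"
        unfolding r_def using floor_approx[of u] u by (auto intro: order_trans simp del: of_nat_Suc)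
      have "(\<lambda>q. Y (r q) \<omega>) \<longlonglongrightarrow> Y u \<omega>"
        by (rule continuous_on_tendsto_compose[OF c[OF \<omega>] r(1) u]) (use r(2) in auto)
      moreover have "f q x = indicator O' \<omega> * (indicator {0..T} u * Y' (r q) \<omega>)" for q
        by (simp add: f_def x r_def)
      then have "f q x = Y (r q) \<omega>" for q
        using r(2)[of q] u \<omega> by (simp add: Y'_def)
      ultimately show ?thesis using u \<omega> by (simp add: x)
    next
      case False
      then have "f q x = 0" for q by (auto simp: f_def x)
      moreover have "indicator O' \<omega> * (indicator {0..T} u * Y u \<omega>) = 0" using False by auto
      ultimately show ?thesis unfolding x by (simp only: prod.case tendsto_const)
    qed
  qed
qed

text \<open>Folding the interval onto its first cell turns an integral over time into an average,
  over a shift u, of sums along the shifted grid.\<close>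

lemma integral_sum_translates:
  fixes f :: "real \<Rightarrow> real"
  assumes "0 \<le> \<epsilon>" "continuous_on {0..real K * \<epsilon>} f"
  shows "integral {0..real K * \<epsilon>} f = integral {0..\<epsilon>} (\<lambda>u. \<Sum>j<K. f (real j * \<epsilon> + u))"
  using assms(2)
proof (induction K)
  case (Suc K)
  have eq: "real (Suc K) * \<epsilon> = real K * \<epsilon> + \<epsilon>" by (simp add: algebra_simps)
  have K: "0 \<le> real K * \<epsilon>" using assms(1) by simp
  have c1: "continuous_on {0..real K * \<epsilon>} f" and c2: "continuous_on {real K * \<epsilon>..real K * \<epsilon> + \<epsilon>} f"
  proof -
    have "{0..real K * \<epsilon>} \<subseteq> {0..real (Suc K) * \<epsilon>}" "{real K * \<epsilon>..real K * \<epsilon> + \<epsilon>} \<subseteq> {0..real (Suc K) * \<epsilon>}"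
      unfolding eq using K assms(1) by (auto intro: order_trans simp del: of_nat_Suc)
    then show "continuous_on {0..real K * \<epsilon>} f" "continuous_on {real K * \<epsilon>..real K * \<epsilon> + \<epsilon>} f"
      using continuous_on_subset[OF Suc.prems] by blast+
  qed
  have cj: "continuous_on {0..\<epsilon>} (\<lambda>u. f (real j * \<epsilon> + u))" if "j < Suc K" for j
  proof (rule continuous_on_compose2[OF Suc.prems])
    have "real j * \<epsilon> \<le> real K * \<epsilon>" using that assms(1) by (intro mult_right_mono) auto
    then show "(\<lambda>u. real j * \<epsilon> + u) ` {0..\<epsilon>} \<subseteq> {0..real (Suc K) * \<epsilon>}" using assms(1) unfolding eq by auto
  qed (intro continuous_intros)
  have "integral {0..real (Suc K) * \<epsilon>} f = integral {0..real K * \<epsilon>} f + integral {real K * \<epsilon>..real K * \<epsilon> + \<epsilon>} f"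
    unfolding eq using Suc.prems K assms(1) unfolding eq
    by (intro Henstock_Kurzweil_Integration.integral_combine[symmetric] integrable_continuous_real) auto
  also have "integral {real K * \<epsilon>..real K * \<epsilon> + \<epsilon>} f = integral {0..\<epsilon>} (\<lambda>u. f (real K * \<epsilon> + u))"
    using integral_shift_Icc_real[of 0 \<epsilon> f "real K * \<epsilon>"] by (simp add: comp_def add.commute)
  also have "integral {0..real K * \<epsilon>} f = integral {0..\<epsilon>} (\<lambda>u. \<Sum>j<K. f (real j * \<epsilon> + u))"
    by (rule Suc.IH[OF c1])
  also have "integral {0..\<epsilon>} (\<lambda>u. \<Sum>j<K. f (real j * \<epsilon> + u)) + integral {0..\<epsilon>} (\<lambda>u. f (real K * \<epsilon> + u))
    = integral {0..\<epsilon>} (\<lambda>u. (\<Sum>j<K. f (real j * \<epsilon> + u)) + f (real K * \<epsilon> + u))"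
    using cj by (intro integral_add[symmetric] integrable_continuous_real continuous_on_sum) auto
  finally show ?case by simp
qed simp

text \<open>Moves the difference from the noise to the coefficient, so that small increments of
  \<open>X\<close> appear in place of \<open>X\<close> itself.\<close>

lemma summation_by_parts:
  fixes x \<beta> :: "nat \<Rightarrow> real"
  shows "(\<Sum>j<Suc K. x j * (\<beta> (Suc j) - \<beta> j)) =
    x K * \<beta> (Suc K) - x 0 * \<beta> 0 - (\<Sum>j<K. (x (Suc j) - x j) * \<beta> (Suc j))"
  by (induction K) (simp_all add: algebra_simps)

section \<open>Mean bounds for averages over shifted grids\<close>

context prob_space begin

definition L2_le :: "'a set \<Rightarrow> real \<Rightarrow> ('a \<Rightarrow> real) \<Rightarrow> bool" where
  "L2_le A c Y \<longleftrightarrow> Y \<in> borel_measurable M \<and> integrable M (\<lambda>\<omega>. indicator A \<omega> * (Y \<omega>)\<^sup>2) \<and>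
     expectation (\<lambda>\<omega>. indicator A \<omega> * (Y \<omega>)\<^sup>2) \<le> c"

lemma L2_le_mono: "L2_le A c Y \<Longrightarrow> c \<le> c' \<Longrightarrow> L2_le A c' Y"
  unfolding L2_le_def by auto

lemma L2_le_uminus: "L2_le A c Y \<Longrightarrow> L2_le A c (\<lambda>\<omega>. - Y \<omega>)"
  unfolding L2_le_def by auto

lemma L2_le_add:
  assumes "A \<in> events" "L2_le A c Y" "L2_le A c' Y'"
  shows "L2_le A (2 * c + 2 * c') (\<lambda>\<omega>. Y \<omega> + Y' \<omega>)"
proof -
  have Y: "Y \<in> borel_measurable M" "Y' \<in> borel_measurable M"
    and i: "integrable M (\<lambda>\<omega>. indicator A \<omega> * (Y \<omega>)\<^sup>2)" "integrable M (\<lambda>\<omega>. indicator A \<omega> * (Y' \<omega>)\<^sup>2)"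
    and e: "expectation (\<lambda>\<omega>. indicator A \<omega> * (Y \<omega>)\<^sup>2) \<le> c" "expectation (\<lambda>\<omega>. indicator A \<omega> * (Y' \<omega>)\<^sup>2) \<le> c'"
    using assms(2,3) unfolding L2_le_def by auto
  define g where "g \<omega> = 2 * (indicator A \<omega> * (Y \<omega>)\<^sup>2) + 2 * (indicator A \<omega> * (Y' \<omega>)\<^sup>2)" for \<omega>
  have gi: "integrable M g" unfolding g_def[abs_def] using i by auto
  have le: "indicator A \<omega> * (Y \<omega> + Y' \<omega>)\<^sup>2 \<le> g \<omega>" for \<omega>
    unfolding g_def using square_sum_le[of "Y \<omega>" "Y' \<omega>"] by (auto simp: indicator_def)
  have m: "(\<lambda>\<omega>. indicator A \<omega> * (Y \<omega> + Y' \<omega>)\<^sup>2) \<in> borel_measurable M" using Y assms(1) by measurable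
  have int: "integrable M (\<lambda>\<omega>. indicator A \<omega> * (Y \<omega> + Y' \<omega>)\<^sup>2)"
  proof (rule Bochner_Integration.integrable_bound[OF gi m], rule AE_I2)
    fix \<omega>
    have "0 \<le> indicator A \<omega> * (Y \<omega> + Y' \<omega>)\<^sup>2" by simp
    with le[of \<omega>] show "norm (indicator A \<omega> * (Y \<omega> + Y' \<omega>)\<^sup>2) \<le> norm (g \<omega>)"
      unfolding real_norm_def by linarith
  qed
  have "expectation (\<lambda>\<omega>. indicator A \<omega> * (Y \<omega> + Y' \<omega>)\<^sup>2) \<le> expectation g"
    by (rule integral_mono[OF int gi le])
  also have "expectation g \<le> 2 * c + 2 * c'" unfolding g_def[abs_def] using i e by simp
  finally show ?thesis unfolding L2_le_def using int Y by simp
qed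

text \<open>The same quadratic inequality as in \<open>l0_le_L2\<close>, now without the cut-off at
  1 and phrased as a nonnegative integral, the form in which Tonelli's theorem will be
  applied.\<close>

lemma L2_le_imp_L1:
  assumes "A \<in> events" "L2_le A (c\<^sup>2) Y" "0 < c"
  shows "(\<integral>\<^sup>+\<omega>. ennreal (indicator A \<omega> * \<bar>Y \<omega>\<bar>) \<partial>M) \<le> ennreal c"
proof -
  have i: "integrable M (\<lambda>\<omega>. indicator A \<omega> * (Y \<omega>)\<^sup>2)" "expectation (\<lambda>\<omega>. indicator A \<omega> * (Y \<omega>)\<^sup>2) \<le> c\<^sup>2"
    using assms(2) unfolding L2_le_def by auto
  define g where "g \<omega> = c / 2 + (indicator A \<omega> * (Y \<omega>)\<^sup>2) / (2 * c)" for \<omega>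
  have gi: "integrable M g" unfolding g_def[abs_def] using i by auto
  have gp: "0 \<le> g \<omega>" for \<omega> unfolding g_def using assms(3) by (simp add: indicator_def)
  have le: "indicator A \<omega> * \<bar>Y \<omega>\<bar> \<le> g \<omega>" for \<omega>
  proof -
    have "0 \<le> (\<bar>Y \<omega>\<bar> - c)\<^sup>2 / (2 * c)" using assms(3) by simp
    also have "\<dots> = c / 2 + (Y \<omega>)\<^sup>2 / (2 * c) - \<bar>Y \<omega>\<bar>"
      using assms(3) by (simp add: power2_eq_square field_simps)
    finally show ?thesis unfolding g_def using assms(3) by (simp add: indicator_def)
  qed
  have "(\<integral>\<^sup>+\<omega>. ennreal (indicator A \<omega> * \<bar>Y \<omega>\<bar>) \<partial>M) \<le> (\<integral>\<^sup>+\<omega>. ennreal (g \<omega>) \<partial>M)"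
    by (intro nn_integral_mono ennreal_leI le)
  also have "\<dots> = ennreal (expectation g)" by (rule nn_integral_eq_integral[OF gi]) (use gp in simp)
  also have "expectation g = c / 2 + expectation (\<lambda>\<omega>. indicator A \<omega> * (Y \<omega>)\<^sup>2) / (2 * c)"
    unfolding g_def[abs_def] using i by (simp add: prob_space)
  also have "\<dots> \<le> c / 2 + c\<^sup>2 / (2 * c)" using i(2) assms(3) by (intro add_left_mono divide_right_mono) auto
  also have "\<dots> = c" using assms(3) by (simp add: power2_eq_square)
  finally show ?thesis by (simp add: ennreal_leI)
qed

text \<open>A first-moment bound that is uniform in u passes to the average over u by Tonelli's
  theorem. With nonnegative integrals this asks only for joint measurability, which the continuity
  of the paths on \<open>O'\<close> provides.\<close>

lemma l0_average_bound:
  fixes Y :: "real \<Rightarrow> 'a \<Rightarrow> real"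
  assumes O': "O' \<in> events" and \<epsilon>: "0 < \<epsilon>" and c: "0 \<le> c"
    and Y: "\<And>u. u \<in> {0..\<epsilon>} \<Longrightarrow> Y u \<in> borel_measurable M"
    and cont: "\<And>\<omega>. \<omega> \<in> O' \<Longrightarrow> continuous_on {0..\<epsilon>} (\<lambda>u. Y u \<omega>)"
    and bnd: "\<And>u. u \<in> {0..\<epsilon>} \<Longrightarrow> (\<integral>\<^sup>+\<omega>. ennreal (indicator O' \<omega> * \<bar>Y u \<omega>\<bar>) \<partial>M) \<le> ennreal c"
    and F: "F \<in> borel_measurable M" "\<And>\<omega>. \<omega> \<in> O' \<Longrightarrow> \<epsilon> * F \<omega> = integral {0..\<epsilon>} (\<lambda>u. Y u \<omega>)"
  shows "l0 O' F \<le> c"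
proof -
  interpret pair_sigma_finite lborel M by unfold_locales
  define h where "h = (\<lambda>(u, \<omega>). indicator O' \<omega> * (indicator {0..\<epsilon>} u * \<bar>Y u \<omega>\<bar>))"
  have hm: "h \<in> borel_measurable (lborel \<Otimes>\<^sub>M M)" unfolding h_def
    by (rule joint_measurable_continuous_paths[where Y="\<lambda>u \<omega>. \<bar>Y u \<omega>\<bar>"]) (use Y O' cont in \<open>auto intro: continuous_intros\<close>)
  have path: "ennreal (\<epsilon> * (indicator O' \<omega> * min 1 \<bar>F \<omega>\<bar>)) \<le> (\<integral>\<^sup>+u. ennreal (h (u, \<omega>)) \<partial>lborel)" for \<omega>
  proof (cases "\<omega> \<in> O'")
    case True
    have ca: "continuous_on {0..\<epsilon>} (\<lambda>u. \<bar>Y u \<omega>\<bar>)" using cont[OF True] by (intro continuous_intros)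
    have si: "integrable lborel (\<lambda>u. indicator {0..\<epsilon>} u *\<^sub>R \<bar>Y u \<omega>\<bar>)"
      using borel_integrable_atLeastAtMost'[OF ca] unfolding set_integrable_def .
    have "(\<integral>\<^sup>+u. ennreal (h (u, \<omega>)) \<partial>lborel) = (\<integral>\<^sup>+u. ennreal (indicator {0..\<epsilon>} u *\<^sub>R \<bar>Y u \<omega>\<bar>) \<partial>lborel)"
      using True by (simp add: h_def)
    also have "\<dots> = ennreal (LINT u:{0..\<epsilon>}|lborel. \<bar>Y u \<omega>\<bar>)"
      unfolding set_lebesgue_integral_def by (rule nn_integral_eq_integral[OF si]) simp
    also have "(LINT u:{0..\<epsilon>}|lborel. \<bar>Y u \<omega>\<bar>) = integral {0..\<epsilon>} (\<lambda>u. \<bar>Y u \<omega>\<bar>)"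
      by (rule set_lebesgue_integral_eq_integral[OF ca])
    finally have eq: "(\<integral>\<^sup>+u. ennreal (h (u, \<omega>)) \<partial>lborel) = ennreal (integral {0..\<epsilon>} (\<lambda>u. \<bar>Y u \<omega>\<bar>))" .
    have "\<epsilon> * min 1 \<bar>F \<omega>\<bar> \<le> \<bar>\<epsilon> * F \<omega>\<bar>" using \<epsilon> by (simp add: abs_mult)
    also have "\<dots> \<le> integral {0..\<epsilon>} (\<lambda>u. \<bar>Y u \<omega>\<bar>)"
      unfolding F(2)[OF True]
      using integral_norm_bound_integral[OF integrable_continuous_real[OF cont[OF True]] integrable_continuous_real[OF ca]] by simp
    finally show ?thesis unfolding eq using True by (simp add: ennreal_leI)
  qed simp
  have "ennreal (\<epsilon> * l0 O' F) = ennreal (expectation (\<lambda>\<omega>. \<epsilon> * (indicator O' \<omega> * min 1 \<bar>F \<omega>\<bar>)))" by (simp add: l0_def)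
  also have "\<dots> = (\<integral>\<^sup>+\<omega>. ennreal (\<epsilon> * (indicator O' \<omega> * min 1 \<bar>F \<omega>\<bar>)) \<partial>M)"
    using \<epsilon> by (intro nn_integral_eq_integral[symmetric] integrable_mult_right integrable_l0 O' F) auto
  also have "\<dots> \<le> (\<integral>\<^sup>+\<omega>. (\<integral>\<^sup>+u. ennreal (h (u, \<omega>)) \<partial>lborel) \<partial>M)"
    by (intro nn_integral_mono path)
  also have "\<dots> = (\<integral>\<^sup>+u. (\<integral>\<^sup>+\<omega>. ennreal (h (u, \<omega>)) \<partial>M) \<partial>lborel)"
    by (rule Fubini') (use hm in \<open>simp add: case_prod_beta'\<close>)
  also have "\<dots> \<le> (\<integral>\<^sup>+u. ennreal c * indicator {0..\<epsilon>} u \<partial>lborel)"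
  proof (rule nn_integral_mono)
    fix u
    show "(\<integral>\<^sup>+\<omega>. ennreal (h (u, \<omega>)) \<partial>M) \<le> ennreal c * indicator {0..\<epsilon>} u"
      using bnd[of u] by (cases "u \<in> {0..\<epsilon>}") (simp_all add: h_def)
  qed
  also have "\<dots> = ennreal (c * \<epsilon>)" using \<epsilon> c by (simp add: nn_integral_cmult ennreal_mult)
  finally have "\<epsilon> * l0 O' F \<le> c * \<epsilon>" using \<epsilon> c by (simp add: ennreal_le_iff)
  then show ?thesis using \<epsilon> by (simp add: mult.commute)
qed

end

context brownian_motion begin

lemma L2_le_stochastic_sum:
  fixes a b :: "nat \<Rightarrow> real"
  assumes A: "A \<in> events" "O' \<in> events" "O' \<subseteq> A"
    and ab: "\<And>i. i < N \<Longrightarrow> 0 \<le> a i \<and> a i \<le> b i" "\<And>i j. i < j \<Longrightarrow> j < N \<Longrightarrow> b i \<le> a j"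
    and \<xi>: "\<And>i. i < N \<Longrightarrow> \<xi> i \<in> borel_measurable P" "\<And>i. i < N \<Longrightarrow> locadapted A (a i) (\<xi> i)"
      "\<And>i \<omega>. i < N \<Longrightarrow> \<omega> \<in> O' \<Longrightarrow> \<bar>\<xi> i \<omega>\<bar> \<le> K" "0 \<le> K"
  shows "L2_le O' (K\<^sup>2 * (\<Sum>i<N. b i - a i)) (\<lambda>\<omega>. \<Sum>i<N. \<xi> i \<omega> * (B (b i) \<omega> - B (a i) \<omega>))"
  unfolding L2_le_def
proof (intro conjI)
  show "(\<lambda>\<omega>. \<Sum>i<N. \<xi> i \<omega> * (B (b i) \<omega> - B (a i) \<omega>)) \<in> borel_measurable P"
    using \<xi>(1) ab(1) by (intro borel_measurable_sum borel_measurable_times borel_measurable_diff BM_measurable)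
      (auto intro: order_trans)
qed (rule stochastic_sum_L2_bound[OF assms]; assumption)+

text \<open>Replacing X(r_j + u) by X(r_j) costs \<open>D1\<close>, whose coefficients are at most
  \<delta> on \<open>O'\<close>. What remains pairs X(r_j) with the difference of the noises \<beta>
  over [r_j, r_j + u] for neighbouring j. The two sums of X \<beta> need not be small separately,
  but summation by parts leaves \<open>D3\<close>, with coefficients at most \<delta>, and two
  boundary terms of second moment at most R^2 times the mesh. The constant 8 comes from adding the
  four pieces by (x + y)^2 \<le> 2 x^2 + 2 y^2, applied twice.\<close>

lemma shifted_sum_estimate:
  fixes X :: "real \<Rightarrow> 'a \<Rightarrow> real"
  assumes T: "0 < T" and K: "Suc K \<le> 2 ^ q" and u: "u \<in> {0..T / 2 ^ q}"
    and A: "A \<in> events" "O' \<in> events" "O' \<subseteq> A"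
    and X: "\<And>t. t \<in> {0..T} \<Longrightarrow> X t \<in> borel_measurable P" "\<And>t. t \<in> {0..T} \<Longrightarrow> locadapted A t (X t)"
    and path: "\<And>\<omega> t. \<omega> \<in> O' \<Longrightarrow> t \<in> {0..T} \<Longrightarrow> \<bar>X t \<omega>\<bar> \<le> R"
      "\<And>\<omega> s t. \<omega> \<in> O' \<Longrightarrow> s \<in> {0..T} \<Longrightarrow> t \<in> {0..T} \<Longrightarrow> \<bar>s - t\<bar> \<le> T / 2 ^ q \<Longrightarrow> \<bar>X s \<omega> - X t \<omega>\<bar> \<le> \<delta>"
    and R: "0 \<le> R" "0 \<le> \<delta>"
  shows "L2_le O' (8 * (\<delta>\<^sup>2 * T + R\<^sup>2 * (T / 2 ^ q))) (\<lambda>\<omega>.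
    (\<Sum>j<Suc K. X (grid T q j + u) \<omega> * (B (grid T q (Suc j) + u) \<omega> - B (grid T q j + u) \<omega>)) - rsum T X q (Suc K) \<omega>)"
proof -
  define \<epsilon> where "\<epsilon> = T / 2 ^ q"
  define r where "r = grid T q"
  have \<epsilon>: "0 < \<epsilon>" using T by (simp add: \<epsilon>_def)
  have u': "0 \<le> u" "u \<le> \<epsilon>" using u by (auto simp: \<epsilon>_def)
  have r0: "r 0 = 0" by (simp add: r_def)
  have rS: "r (Suc j) = r j + \<epsilon>" for j by (simp add: r_def \<epsilon>_def grid_Suc)
  have rmono: "r j \<le> r l" if "j \<le> l" for j l unfolding r_def using T that by (intro grid_mono) auto
  have rp: "0 \<le> r j" for j using rmono[of 0 j] r0 by simp
  have rT: "r j \<le> T" if "j \<le> Suc K" for j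
    using grid_mem[of T j q] that K T unfolding r_def by simp
  have rm: "r j \<in> {0..T}" if "j \<le> Suc K" for j using rp rT that by simp
  have rum: "r j + u \<in> {0..T}" if "j < Suc K" for j
    using rp[of j] rT[of "Suc j"] rS[of j] u' that by simp
  have rK: "r j = real j * \<epsilon>" for j by (simp add: r_def grid_def \<epsilon>_def)
  define \<beta> where "\<beta> j \<omega> = B (r j + u) \<omega> - B (r j) \<omega>" for j \<omega>
  define D1 where "D1 \<omega> = (\<Sum>j<Suc K. (X (r j + u) \<omega> - X (r j) \<omega>) * (B (r (Suc j) + u) \<omega> - B (r j + u) \<omega>))" for \<omega>
  define D3 where "D3 \<omega> = (\<Sum>j<K. (X (r (Suc j)) \<omega> - X (r j) \<omega>) * \<beta> (Suc j) \<omega>)" for \<omega>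
  have dec: "(\<Sum>j<Suc K. X (r j + u) \<omega> * (B (r (Suc j) + u) \<omega> - B (r j + u) \<omega>)) - rsum T X q (Suc K) \<omega>
     = (D1 \<omega> + X (r K) \<omega> * \<beta> (Suc K) \<omega>) + (- (X (r 0) \<omega> * \<beta> 0 \<omega>) + - D3 \<omega>)" for \<omega>
  proof -
    have "(\<Sum>j<Suc K. X (r j + u) \<omega> * (B (r (Suc j) + u) \<omega> - B (r j + u) \<omega>)) - rsum T X q (Suc K) \<omega>
      = D1 \<omega> + (\<Sum>j<Suc K. X (r j) \<omega> * (\<beta> (Suc j) \<omega> - \<beta> j \<omega>))"
      unfolding rsum_def r_def[symmetric] D1_def \<beta>_def sum_subtractf[symmetric] sum.distrib[symmetric]
      by (rule sum.cong[OF refl]) (simp add: algebra_simps)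
    also have "(\<Sum>j<Suc K. X (r j) \<omega> * (\<beta> (Suc j) \<omega> - \<beta> j \<omega>)) =
      X (r K) \<omega> * \<beta> (Suc K) \<omega> - X (r 0) \<omega> * \<beta> 0 \<omega> - D3 \<omega>"
      unfolding D3_def by (rule summation_by_parts)
    finally show ?thesis by simp
  qed
  have b1: "L2_le O' (\<delta>\<^sup>2 * T) D1"
  proof -
    have "L2_le O' (\<delta>\<^sup>2 * (\<Sum>j<Suc K. (r (Suc j) + u) - (r j + u))) D1"
      unfolding D1_def[abs_def]
    proof (rule L2_le_stochastic_sum[OF A])
      fix j assume j: "j < Suc K"
      show "0 \<le> r j + u \<and> r j + u \<le> r (Suc j) + u" using rp[of j] rS[of j] u' \<epsilon> by simp
      show "(\<lambda>\<omega>. X (r j + u) \<omega> - X (r j) \<omega>) \<in> borel_measurable P"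
        using X(1)[OF rum[OF j]] X(1)[OF rm[of j]] j by (intro borel_measurable_diff) auto
      show "locadapted A (r j + u) (\<lambda>\<omega>. X (r j + u) \<omega> - X (r j) \<omega>)"
        using j u' by (intro locadapted_diff X(2)[OF rum] locadapted_mono[OF X(2)[OF rm]]) auto
      fix \<omega> assume "\<omega> \<in> O'"
      then show "\<bar>X (r j + u) \<omega> - X (r j) \<omega>\<bar> \<le> \<delta>"
        using rum[OF j] rm[of j] j u' by (intro path(2)) (auto simp: \<epsilon>_def)
    next
      fix i j assume "i < j" "j < Suc K"
      then show "r (Suc i) + u \<le> r j + u" using rmono[of "Suc i" j] by simp
    qed (rule R(2))
    moreover have "\<delta>\<^sup>2 * (\<Sum>j<Suc K. (r (Suc j) + u) - (r j + u)) \<le> \<delta>\<^sup>2 * T"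
    proof (rule mult_left_mono)
      show "(\<Sum>j<Suc K. (r (Suc j) + u) - (r j + u)) \<le> T"
        using rT[of "Suc K"] rK[of "Suc K"] by (simp add: rS algebra_simps)
    qed simp
    ultimately show ?thesis by (rule L2_le_mono)
  qed
  have b3: "L2_le O' (\<delta>\<^sup>2 * T) D3"
  proof -
    have "L2_le O' (\<delta>\<^sup>2 * (\<Sum>j<K. (r (Suc j) + u) - r (Suc j))) D3"
      unfolding D3_def[abs_def] \<beta>_def
    proof (rule L2_le_stochastic_sum[OF A])
      fix j assume j: "j < K"
      show "0 \<le> r (Suc j) \<and> r (Suc j) \<le> r (Suc j) + u" using rp u' by simp
      show "(\<lambda>\<omega>. X (r (Suc j)) \<omega> - X (r j) \<omega>) \<in> borel_measurable P"
        using j by (intro borel_measurable_diff X(1) rm) auto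
      show "locadapted A (r (Suc j)) (\<lambda>\<omega>. X (r (Suc j)) \<omega> - X (r j) \<omega>)"
        using j rmono[of j "Suc j"] by (intro locadapted_diff X(2)[OF rm] locadapted_mono[OF X(2)[OF rm]]) auto
      fix \<omega> assume \<omega>: "\<omega> \<in> O'"
      show "\<bar>X (r (Suc j)) \<omega> - X (r j) \<omega>\<bar> \<le> \<delta>"
        using j rS[of j] \<epsilon> by (intro path(2)[OF \<omega>] rm) (auto simp: \<epsilon>_def)
    next
      fix i j assume "i < j" "j < K"
      then have "r (Suc (Suc i)) \<le> r (Suc j)" by (intro rmono) simp
      then show "r (Suc i) + u \<le> r (Suc j)" using rS[of "Suc i"] u' by simp
    qed (rule R(2))
    moreover have "\<delta>\<^sup>2 * (\<Sum>j<K. (r (Suc j) + u) - r (Suc j)) \<le> \<delta>\<^sup>2 * T"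
    proof (rule mult_left_mono)
      have "real K * u \<le> real K * \<epsilon>" using u' by (intro mult_left_mono) auto
      then show "(\<Sum>j<K. (r (Suc j) + u) - r (Suc j)) \<le> T" using rT[of K] rK[of K] by simp
    qed simp
    ultimately show ?thesis by (rule L2_le_mono)
  qed
  have bX: "L2_le O' (R\<^sup>2 * \<epsilon>) (\<lambda>\<omega>. X (r i) \<omega> * \<beta> j \<omega>)" if ij: "i \<le> j" "i \<le> Suc K" for i j
  proof -
    have "L2_le O' (R\<^sup>2 * (\<Sum>l<(1::nat). (r j + u) - r j)) (\<lambda>\<omega>. \<Sum>l<(1::nat). X (r i) \<omega> * (B (r j + u) \<omega> - B (r j) \<omega>))"
    proof (rule L2_le_stochastic_sum[where N=1 and a="\<lambda>_. r j" and b="\<lambda>_. r j + u" and \<xi>="\<lambda>_. X (r i)" and K=R, OF A])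
      show "0 \<le> r j \<and> r j \<le> r j + u" using rp u' by simp
      show "X (r i) \<in> borel_measurable P" by (intro X(1) rm ij)
      show "locadapted A (r j) (X (r i))" by (intro locadapted_mono[OF X(2)[OF rm[OF ij(2)]]] rmono ij)
      show "\<And>\<omega>. \<omega> \<in> O' \<Longrightarrow> \<bar>X (r i) \<omega>\<bar> \<le> R" by (intro path(1) rm ij)
    qed (use R in simp_all)
    then have "L2_le O' (R\<^sup>2 * u) (\<lambda>\<omega>. X (r i) \<omega> * \<beta> j \<omega>)" by (simp add: \<beta>_def)
    moreover have "R\<^sup>2 * u \<le> R\<^sup>2 * \<epsilon>" using u' by (intro mult_left_mono) auto
    ultimately show ?thesis by (rule L2_le_mono)
  qed
  have "L2_le O' (2 * (2 * (\<delta>\<^sup>2 * T) + 2 * (R\<^sup>2 * \<epsilon>)) + 2 * (2 * (R\<^sup>2 * \<epsilon>) + 2 * (\<delta>\<^sup>2 * T)))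
     (\<lambda>\<omega>. (D1 \<omega> + X (r K) \<omega> * \<beta> (Suc K) \<omega>) + (- (X (r 0) \<omega> * \<beta> 0 \<omega>) + - D3 \<omega>))"
    by (intro L2_le_add A(2) b1 bX L2_le_uminus b3) auto
  then show ?thesis unfolding r_def[symmetric] \<epsilon>_def[symmetric] dec by (simp add: algebra_simps)
qed

text \<open>Along the sequence of shifts equal to the mesh, the forward average is exactly the mean
  over u of Riemann sums along the grid shifted by u. Each of these is close to the unshifted sum,
  uniformly in u, so their mean is close to it too.\<close>

lemma forward_integral_riemann:
  fixes X :: "real \<Rightarrow> 'a \<Rightarrow> real"
  assumes T: "0 < T" and i: "i \<le> 2 ^ n" and A: "A \<in> events"
    and X: "\<And>t. t \<in> {0..T} \<Longrightarrow> X t \<in> borel_measurable P" "\<And>t. t \<in> {0..T} \<Longrightarrow> locadapted A t (X t)"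
      "AE \<omega> in P. continuous_on {0..T} (\<lambda>t. X t \<omega>)"
    and fwd: "has_forward_integral P B X (grid T n i) I"
  shows "(\<lambda>m. l0 A (\<lambda>\<omega>. I \<omega> - rsum T X (n + m) (i * 2 ^ m) \<omega>)) \<longlonglongrightarrow> 0"
proof -
  define t where "t = grid T n i"
  have t: "t \<in> {0..T}" unfolding t_def using grid_mem[of T i n] T i by simp
  define \<epsilon> where "\<epsilon> m = T / 2 ^ (n + m)" for m
  have \<epsilon>: "0 < \<epsilon> m" for m using T by (simp add: \<epsilon>_def)
  have \<epsilon>0: "\<epsilon> \<longlonglongrightarrow> 0" unfolding \<epsilon>_def[abs_def] by (rule mesh_tendsto_0)
  have \<epsilon>lim: "filterlim \<epsilon> (at_right 0) sequentially"
    unfolding filterlim_at using \<epsilon>0 \<epsilon> by (auto simp: less_imp_neq[OF \<epsilon>, symmetric])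
  define F where "F m \<omega> = (LINT s:{0..t}|lborel. X s \<omega> * ((B (s + \<epsilon> m) \<omega> - B s \<omega>) / \<epsilon> m))" for m \<omega>
  have cp: "conv_in_prob P (\<lambda>\<epsilon> \<omega>. LINT s:{0..t}|lborel. X s \<omega> * ((B (s + \<epsilon>) \<omega> - B s \<omega>) / \<epsilon>)) I (at_right 0)"
    using fwd unfolding has_forward_integral_def t_def .
  then have Im: "I \<in> borel_measurable P"
    and "\<forall>\<^sub>F \<epsilon> in at_right 0. (\<lambda>\<omega>. LINT s:{0..t}|lborel. X s \<omega> * ((B (s + \<epsilon>) \<omega> - B s \<omega>) / \<epsilon>)) \<in> borel_measurable P"
    unfolding conv_in_prob_def by auto
  then have Fm: "\<forall>\<^sub>F m in sequentially. F m \<in> borel_measurable P"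
    using eventually_compose_filterlim[OF _ \<epsilon>lim] unfolding F_def[abs_def] by blast
  have FI: "(\<lambda>m. l0 (space P) (\<lambda>\<omega>. F m \<omega> - I \<omega>)) \<longlonglongrightarrow> 0"
    using filterlim_compose[OF conv_in_prob_l0[OF prob_space_axioms cp] \<epsilon>lim] unfolding F_def .
  obtain C where C: "C \<in> events" "prob (space P - C) = 0" "\<And>\<omega>. \<omega> \<in> C \<Longrightarrow> continuous_on {0..} (\<lambda>t. B t \<omega>)"
    using AE_event[OF BM_continuous] by metis
  show ?thesis
  proof (rule tendstoI)
    fix e :: real assume "0 < e"
    define \<eta> where "\<eta> = e / 5"
    have \<eta>: "0 < \<eta>" using \<open>0 < e\<close> by (simp add: \<eta>_def)
    obtain R :: nat and O1 where O1: "O1 \<in> events" "prob (space P - O1) \<le> \<eta>"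
      "\<And>\<omega>. \<omega> \<in> O1 \<Longrightarrow> continuous_on {0..T} (\<lambda>t. X t \<omega>)"
      "\<And>\<omega> s. \<omega> \<in> O1 \<Longrightarrow> s \<in> {0..T} \<Longrightarrow> \<bar>X s \<omega>\<bar> \<le> R"
      using bounded_path_event[OF X(1,3) \<eta>] by metis
    \<comment> \<open>Chosen so that \<delta>^2 T is \<eta>^2 / 16. Together with R^2 times the mesh
      below \<eta>^2 / 16, the factor 8 in \<open>shifted_sum_estimate\<close> then yields
      \<eta>^2.\<close>
    define \<delta> where "\<delta> = \<eta> / (4 * sqrt T)"
    have \<delta>: "0 < \<delta>" using \<eta> T by (simp add: \<delta>_def)
    obtain h O3 where O3: "0 < h" "O3 \<in> events" "prob (space P - O3) \<le> \<eta>"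
      "\<And>\<omega> s s'. \<omega> \<in> O3 \<Longrightarrow> s \<in> {0..T} \<Longrightarrow> s' \<in> {0..T} \<Longrightarrow> \<bar>s - s'\<bar> < h \<Longrightarrow> \<bar>X s \<omega> - X s' \<omega>\<bar> \<le> \<delta>"
      using modulus_path_event[OF X(1,3) \<eta> \<delta>] by metis
    have "(\<lambda>m. (real R)\<^sup>2 * \<epsilon> m) \<longlonglongrightarrow> (real R)\<^sup>2 * 0" by (intro tendsto_mult tendsto_const \<epsilon>0)
    then have "\<forall>\<^sub>F m in sequentially. (real R)\<^sup>2 * \<epsilon> m < \<eta>\<^sup>2 / 16"
      using \<eta> by (intro order_tendstoD(2)) auto
    moreover have "\<forall>\<^sub>F m in sequentially. \<epsilon> m < h" by (rule order_tendstoD(2)[OF \<epsilon>0 O3(1)])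
    moreover have "\<forall>\<^sub>F m in sequentially. l0 (space P) (\<lambda>\<omega>. F m \<omega> - I \<omega>) < \<eta>"
      by (rule order_tendstoD(2)[OF FI \<eta>])
    ultimately show "\<forall>\<^sub>F m in sequentially. dist (l0 A (\<lambda>\<omega>. I \<omega> - rsum T X (n + m) (i * 2 ^ m) \<omega>)) 0 < e"
      using Fm
    proof eventually_elim
      case (elim m)
      define q where "q = n + m"
      define N where "N = i * 2 ^ m"
      have tN: "t = real N * \<epsilon> m" by (simp add: t_def grid_def N_def \<epsilon>_def power_add)
      have Nq: "N \<le> 2 ^ q" unfolding N_def q_def power_add using i by simp
      have rj: "grid T q j = real j * \<epsilon> m" for j by (simp add: grid_def q_def \<epsilon>_def)
      have rm: "rsum T X q N \<in> borel_measurable P"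
        unfolding rsum_def[abs_def]
      proof (intro borel_measurable_sum borel_measurable_times borel_measurable_diff BM_measurable)
        fix j assume "j \<in> {..<N}"
        then show "X (grid T q j) \<in> borel_measurable P"
          using grid_mem[of T j q] T Nq by (intro X(1)) auto
        show "0 \<le> grid T q (Suc j)" "0 \<le> grid T q j" using T by (auto simp: grid_def)
      qed
      define O' where "O' = A \<inter> C \<inter> (O1 \<inter> O3)"
      have O': "O' \<in> events" "O' \<subseteq> A" using A C(1) O1(1) O3(2) by (auto simp: O'_def)
      have small: "prob (A - O') \<le> 2 * \<eta>"
      proof -
        have "prob (A - O') \<le> prob ((space P - C) \<union> ((space P - O1) \<union> (space P - O3)))"
          using C(1) O1(1) O3(2) sets.sets_into_space[OF A] by (intro finite_measure_mono) (auto simp: O'_def)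
        also have "\<dots> \<le> prob (space P - C) + prob ((space P - O1) \<union> (space P - O3))"
          using C(1) O1(1) O3(2) by (intro measure_Un_le) auto
        also have "prob ((space P - O1) \<union> (space P - O3)) \<le> prob (space P - O1) + prob (space P - O3)"
          using O1(1) O3(2) by (intro measure_Un_le) auto
        finally show ?thesis using C(2) O1(2) O3(3) by linarith
      qed
      have est: "l0 O' (\<lambda>\<omega>. F m \<omega> - rsum T X q N \<omega>) \<le> \<eta>"
      proof (cases N)
        case 0
        then have "F m \<omega> = 0" for \<omega>
        proof -
          have "t = 0" using tN 0 by simp
          then have "F m \<omega> = (LINT s:{0..0}|lborel. X s \<omega> * ((B (s + \<epsilon> m) \<omega> - B s \<omega>) / \<epsilon> m))" by (simp add: F_def)
          also have "\<dots> = integral {0..0} (\<lambda>s. X s \<omega> * ((B (s + \<epsilon> m) \<omega> - B s \<omega>) / \<epsilon> m))"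
            by (rule set_lebesgue_integral_eq_integral) (simp add: continuous_on_sing)
          finally show ?thesis by simp
        qed
        then show ?thesis using \<eta> 0 by (simp add: rsum_def l0_def)
      next
        case (Suc K)
        define S where "S u \<omega> = (\<Sum>j<N. X (grid T q j + u) \<omega> * (B (grid T q (Suc j) + u) \<omega> - B (grid T q j + u) \<omega>))" for u \<omega>
        have mem: "grid T q j + u \<in> {0..T}" if "j < N" "u \<in> {0..\<epsilon> m}" for j u
        proof -
          have "grid T q (Suc j) \<le> T" using grid_mem[of T "Suc j" q] T Nq that(1) by simp
          then show ?thesis using that T by (simp add: grid_Suc \<epsilon>_def q_def) (simp add: grid_def)
        qed
        have gp: "0 \<le> grid T q j" for j using T by (simp add: grid_def)
        show ?thesis
        proof (rule l0_average_bound[where \<epsilon>="\<epsilon> m" and Y="\<lambda>u \<omega>. S u \<omega> - rsum T X q N \<omega>"])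
          show "0 < \<epsilon> m" "0 \<le> \<eta>" "O' \<in> events" using \<epsilon> \<eta> O' by auto
          show "(\<lambda>\<omega>. F m \<omega> - rsum T X q N \<omega>) \<in> borel_measurable P" using elim(4) rm by measurable
          show "(\<lambda>\<omega>. S u \<omega> - rsum T X q N \<omega>) \<in> borel_measurable P" if u: "u \<in> {0..\<epsilon> m}" for u
            unfolding S_def using u gp
            by (intro borel_measurable_diff borel_measurable_sum borel_measurable_times rm X(1) mem BM_measurable) auto
          show "(\<integral>\<^sup>+\<omega>. ennreal (indicator O' \<omega> * \<bar>S u \<omega> - rsum T X q N \<omega>\<bar>) \<partial>P) \<le> ennreal \<eta>" if u: "u \<in> {0..\<epsilon> m}" for u
          proof (rule L2_le_imp_L1[OF O'(1) _ \<eta>])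
            have "L2_le O' (8 * (\<delta>\<^sup>2 * T + (real R)\<^sup>2 * (T / 2 ^ q))) (\<lambda>\<omega>. S u \<omega> - rsum T X q N \<omega>)"
              unfolding S_def Suc
            proof (rule shifted_sum_estimate[OF T _ _ A O' X(1,2)])
              show "Suc K \<le> 2 ^ q" using Nq Suc by simp
              show "u \<in> {0..T / 2 ^ q}" using u by (simp add: \<epsilon>_def q_def)
              fix \<omega> s assume "\<omega> \<in> O'" "s \<in> {0..T}"
              then show "\<bar>X s \<omega>\<bar> \<le> real R" by (intro O1(4)) (auto simp: O'_def)
            next
              fix \<omega> s s' assume "\<omega> \<in> O'" "s \<in> {0..T}" "s' \<in> {0..T}" "\<bar>s - s'\<bar> \<le> T / 2 ^ q"
              then show "\<bar>X s \<omega> - X s' \<omega>\<bar> \<le> \<delta>" using elim(2) by (intro O3(4)) (auto simp: O'_def \<epsilon>_def q_def)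
            qed (use \<delta> in auto)
            moreover have "8 * (\<delta>\<^sup>2 * T + (real R)\<^sup>2 * (T / 2 ^ q)) \<le> \<eta>\<^sup>2"
            proof -
              have "\<delta>\<^sup>2 * T = \<eta>\<^sup>2 / 16" using T by (simp add: \<delta>_def power_divide power_mult_distrib)
              moreover have eq: "T / 2 ^ q = \<epsilon> m" by (simp add: \<epsilon>_def q_def)
              ultimately show ?thesis using elim(1) unfolding distrib_left eq by linarith
            qed
            ultimately show "L2_le O' (\<eta>\<^sup>2) (\<lambda>\<omega>. S u \<omega> - rsum T X q N \<omega>)" by (rule L2_le_mono)
          qed
          fix \<omega> assume \<omega>: "\<omega> \<in> O'"
          have cX: "continuous_on {0..T} (\<lambda>t. X t \<omega>)" and cB: "continuous_on {0..} (\<lambda>t. B t \<omega>)"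
            using O1(3) C(3) \<omega> by (auto simp: O'_def)
          have cs: "continuous_on {0..\<epsilon> m} (\<lambda>u. S u \<omega>)"
            unfolding S_def
          proof (intro continuous_on_sum continuous_on_mult continuous_on_diff)
            fix j assume "j \<in> {..<N}"
            then have "(\<lambda>u. grid T q j + u) ` {0..\<epsilon> m} \<subseteq> {0..T}" using mem[of j] by blast
            then show "continuous_on {0..\<epsilon> m} (\<lambda>u. X (grid T q j + u) \<omega>)"
              by (intro continuous_on_compose2[OF cX] continuous_intros)
            show "continuous_on {0..\<epsilon> m} (\<lambda>u. B (grid T q (Suc j) + u) \<omega>)" "continuous_on {0..\<epsilon> m} (\<lambda>u. B (grid T q j + u) \<omega>)"
              using gp by (intro continuous_on_compose2[OF cB] continuous_intros; auto)+
          qed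
          then show "continuous_on {0..\<epsilon> m} (\<lambda>u. S u \<omega> - rsum T X q N \<omega>)" by (intro continuous_intros)
          define f where "f s = X s \<omega> * ((B (s + \<epsilon> m) \<omega> - B s \<omega>) / \<epsilon> m)" for s
          have cf: "continuous_on {0..t} f"
            unfolding f_def using t \<epsilon>[of m]
            by (intro continuous_intros continuous_on_compose2[OF cB] continuous_on_subset[OF cX]) auto
          have "F m \<omega> = integral {0..real N * \<epsilon> m} f"
            unfolding F_def f_def[symmetric] tN[symmetric] by (rule set_lebesgue_integral_eq_integral[OF cf])
          \<comment> \<open>Because the shift in the forward quotient equals the mesh, the increment
            of \<open>B\<close> at the point j \<epsilon> + u is the one over a full cell of the
            grid shifted by u.\<close>
          also have "\<dots> = integral {0..\<epsilon> m} (\<lambda>u. \<Sum>j<N. f (real j * \<epsilon> m + u))"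
            using cf \<epsilon>[of m] unfolding tN by (intro integral_sum_translates) auto
          also have "(\<lambda>u. \<Sum>j<N. f (real j * \<epsilon> m + u)) = (\<lambda>u. S u \<omega> * (1 / \<epsilon> m))"
            unfolding S_def f_def rj sum_distrib_right
          proof (intro ext sum.cong refl)
            fix u j
            have "real j * \<epsilon> m + u + \<epsilon> m = real (Suc j) * \<epsilon> m + u" by (simp add: algebra_simps)
            then show "X (real j * \<epsilon> m + u) \<omega> * ((B (real j * \<epsilon> m + u + \<epsilon> m) \<omega> - B (real j * \<epsilon> m + u) \<omega>) / \<epsilon> m) =
              X (real j * \<epsilon> m + u) \<omega> * (B (real (Suc j) * \<epsilon> m + u) \<omega> - B (real j * \<epsilon> m + u) \<omega>) * (1 / \<epsilon> m)"
              by (simp only: times_divide_eq_right mult_1_right)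
          qed
          also have "integral {0..\<epsilon> m} (\<lambda>u. S u \<omega> * (1 / \<epsilon> m)) = integral {0..\<epsilon> m} (\<lambda>u. S u \<omega>) * (1 / \<epsilon> m)"
            by (rule integral_mult_left)
          finally have "\<epsilon> m * F m \<omega> = integral {0..\<epsilon> m} (\<lambda>u. S u \<omega>)" using \<epsilon>[of m] by simp
          moreover have "integral {0..\<epsilon> m} (\<lambda>u. S u \<omega> - rsum T X q N \<omega>) = integral {0..\<epsilon> m} (\<lambda>u. S u \<omega>) - \<epsilon> m * rsum T X q N \<omega>"
            using integral_diff[OF integrable_continuous_real[OF cs] integrable_const_ivl] \<epsilon>[of m] by simp
          ultimately show "\<epsilon> m * (F m \<omega> - rsum T X q N \<omega>) = integral {0..\<epsilon> m} (\<lambda>u. S u \<omega> - rsum T X q N \<omega>)"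
            by (simp add: right_diff_distrib)
        qed
      qed
      have 1: "l0 A (\<lambda>\<omega>. F m \<omega> - rsum T X q N \<omega>) \<le> 3 * \<eta>"
        using l0_split[OF A O' borel_measurable_diff[OF elim(4) rm]] est small by simp
      have 2: "l0 A (\<lambda>\<omega>. F m \<omega> - I \<omega>) < \<eta>"
        using l0_subset[OF sets.top A sets.sets_into_space[OF A] borel_measurable_diff[OF elim(4) Im]] elim(3) by simp
      have "l0 A (\<lambda>\<omega>. I \<omega> - rsum T X q N \<omega>) = l0 A (\<lambda>\<omega>. (F m \<omega> - rsum T X q N \<omega>) - (F m \<omega> - I \<omega>))" by simp
      also have "\<dots> \<le> l0 A (\<lambda>\<omega>. F m \<omega> - rsum T X q N \<omega>) + l0 A (\<lambda>\<omega>. F m \<omega> - I \<omega>)"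
        by (rule l0_diff[OF A]) (use elim(4) rm Im in auto)
      finally have "l0 A (\<lambda>\<omega>. I \<omega> - rsum T X q N \<omega>) < e"
        using 1 2 \<open>0 < e\<close> by (simp add: \<eta>_def)
      then show ?case using l0_nonneg[of A "\<lambda>\<omega>. I \<omega> - rsum T X q N \<omega>"]
        by (simp add: dist_real_def N_def q_def)
    qed
  qed
qed

end

section \<open>Gaussian tails, initial enlargement and explicit solutions\<close>

lemma ode_solution_exp:
  assumes "ode_solution r T y" "0 \<le> T" "t \<in> {0..T}"
  shows "y t = y 0 * exp (r * t)"
proof -
  have "\<exists>c. \<forall>x\<in>{0..T}. y x * exp (- (r * x)) = c"
  proof (rule has_field_derivative_zero_constant)
    fix x assume "x \<in> {0..T}"
    then have "(y has_real_derivative r * y x) (at x within {0..T})"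
      using assms(1) by (auto simp: ode_solution_def)
    moreover have "((\<lambda>x. exp (- (r * x))) has_real_derivative exp (- (r * x)) * (- r)) (at x within {0..T})"
      by (auto intro!: derivative_eq_intros)
    ultimately show "((\<lambda>x. y x * exp (- (r * x))) has_field_derivative 0) (at x within {0..T})"
      using DERIV_mult[of y "r * y x" x "{0..T}" "\<lambda>x. exp (- (r * x))" "exp (- (r * x)) * (- r)"]
      by (simp add: algebra_simps)
  qed simp
  then obtain c where c: "\<And>x. x \<in> {0..T} \<Longrightarrow> y x * exp (- (r * x)) = c" by blast
  have "y t * exp (- (r * t)) = y 0" using c[of t] c[of 0] assms(2,3) by simp
  then show ?thesis by (simp add: exp_minus field_simps)
qed

lemma erf_minus: "erf (- x) = - erf x"
proof -
  have "(LBINT y=0..ereal (- x). exp (- (y\<^sup>2))) = (LBINT y=ereal x..0. exp (- (y\<^sup>2)) :: real)"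
    by (subst interval_integral_reflect) (simp add: zero_ereal_def)
  also have "\<dots> = - (LBINT y=0..ereal x. exp (- (y\<^sup>2)))"
    by (rule interval_integral_endpoints_reverse)
  finally show ?thesis by (simp add: erf_def)
qed

lemma integrable_exp_minus_square: "integrable lborel (\<lambda>y::real. exp (- y\<^sup>2))"
  using has_bochner_integral_even_function[OF gaussian_moment_0] by (simp add: has_bochner_integral_iff)

lemma gaussian_tail_erf:
  "(LINT y:{x<..}|lborel. exp (- y\<^sup>2)) = sqrt pi / 2 * (1 - erf x)"
proof -
  have int: "interval_lebesgue_integrable lborel a b (\<lambda>y::real. exp (- y\<^sup>2))" for a b
    unfolding interval_lebesgue_integrable_def set_integrable_def
    using integrable_mult_indicator[OF _ integrable_exp_minus_square] by simp
  have "(LBINT y=0..ereal x. exp (- y\<^sup>2)) + (LBINT y=ereal x..\<infinity>. exp (- y\<^sup>2)) = (LBINT y=0..\<infinity>. exp (- y\<^sup>2) :: real)"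
    by (rule interval_integral_sum[OF int])
  moreover have "(LBINT y=0..\<infinity>. exp (- y\<^sup>2) :: real) = sqrt pi / 2"
  proof -
    have "(LBINT y=ereal 0..\<infinity>. exp (- y\<^sup>2) :: real) = (LINT y:{0<..}|lborel. exp (- y\<^sup>2))"
      by (rule interval_integral_to_infinity_eq)
    also have "\<dots> = (LINT y|lborel. indicator {0..} y *\<^sub>R exp (- y\<^sup>2))"
      unfolding set_lebesgue_integral_def
    proof (rule integral_cong_AE)
      show "AE y in lborel. indicator {0<..} y *\<^sub>R exp (- y\<^sup>2) = (indicator {0..} y *\<^sub>R exp (- y\<^sup>2) :: real)"
        using AE_lborel_singleton[of "0::real"] by eventually_elim (auto simp: indicator_def)
    qed measurable
    also have "\<dots> = sqrt pi / 2" using gaussian_moment_0 by (simp add: has_bochner_integral_iff)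
    finally show ?thesis by (simp add: zero_ereal_def)
  qed
  moreover have "(LBINT y=ereal x..\<infinity>. exp (- y\<^sup>2) :: real) = (LINT y:{x<..}|lborel. exp (- y\<^sup>2))"
    by (rule interval_integral_to_infinity_eq)
  ultimately have "(LINT y:{x<..}|lborel. exp (- y\<^sup>2)) = sqrt pi / 2 - (LBINT y=0..ereal x. exp (- y\<^sup>2))" by simp
  also have "\<dots> = sqrt pi / 2 * (1 - erf x)" by (simp add: erf_def field_simps)
  finally show ?thesis .
qed

text \<open>The substitution x = m + sqrt 2 s y turns the density into exp(-y^2) / sqrt pi.\<close>

lemma normal_density_tail:
  assumes s: "0 < s"
  shows "(LINT x|lborel. normal_density m s x * indicator {c<..} x) = 1 / 2 * (1 - erf ((c - m) / (sqrt 2 * s)))"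
proof -
  define k where "k = sqrt 2 * s"
  have k: "0 < k" using s by (simp add: k_def)
  have "(LINT x|lborel. normal_density m s x * indicator {c<..} x)
    = \<bar>k\<bar> *\<^sub>R (LINT y|lborel. normal_density m s (m + k * y) * indicator {c<..} (m + k * y))"
    by (rule lborel_integral_real_affine) (use k in simp)
  also have "(\<lambda>y. normal_density m s (m + k * y) * indicator {c<..} (m + k * y))
     = (\<lambda>y. 1 / (k * sqrt pi) * (indicator {(c - m) / k<..} y *\<^sub>R exp (- y\<^sup>2)))"
  proof
    fix y
    have "normal_density m s (m + k * y) = 1 / (k * sqrt pi) * exp (- y\<^sup>2)"
      using s by (simp add: normal_density_def k_def power_mult_distrib real_sqrt_mult field_simps)
    moreover have "(c < m + k * y) \<longleftrightarrow> (c - m) / k < y" using k by (simp add: pos_divide_less_eq algebra_simps)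
    ultimately show "normal_density m s (m + k * y) * indicator {c<..} (m + k * y)
      = 1 / (k * sqrt pi) * (indicator {(c - m) / k<..} y *\<^sub>R exp (- y\<^sup>2))" by (simp add: indicator_def)
  qed
  also have "\<bar>k\<bar> *\<^sub>R (LINT y|lborel. 1 / (k * sqrt pi) * (indicator {(c - m) / k<..} y *\<^sub>R exp (- y\<^sup>2)))
      = 1 / sqrt pi * (LINT y:{(c - m) / k<..}|lborel. exp (- y\<^sup>2))"
    using k by (simp add: set_lebesgue_integral_def)
  also have "\<dots> = 1 / 2 * (1 - erf ((c - m) / k))" unfolding gaussian_tail_erf by (simp add: field_simps)
  finally show ?thesis by (simp add: k_def)
qed

section \<open>Initial enlargement seen on an event, and the explicit solutions\<close>

lemma space_enlarged_filtration [simp]: "space (enlarged_filtration P B \<xi> t) = space P"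
  unfolding enlarged_filtration_def by (rule space_measure_of) (use sets.sets_into_space in force)

lemma sets_enlarged_filtration:
  "sets (enlarged_filtration P B \<xi> t) = sigma_sets (space P)
     (sets (bm_filtration P B t) \<union> {\<xi> -` A \<inter> space P |A. A \<in> sets borel})"
  unfolding enlarged_filtration_def
proof (rule sets_measure_of)
  have "sets (bm_filtration P B t) \<subseteq> Pow (space P)"
    using sets.space_closed[of "bm_filtration P B t"] by simp
  then show "sets (bm_filtration P B t) \<union> {\<xi> -` A \<inter> space P |A. A \<in> sets borel} \<subseteq> Pow (space P)" by auto
qed

context brownian_motion begin

lemma measurable_enlarged_filtration:
  assumes \<xi>: "\<xi> \<in> borel_measurable P" and f: "f \<in> measurable (enlarged_filtration P B \<xi> t) N"
  shows "f \<in> measurable P N"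
proof -
  have "{\<xi> -` A \<inter> space P |A. A \<in> sets borel} \<subseteq> events" using measurable_sets[OF \<xi>] by auto
  then have "sets (enlarged_filtration P B \<xi> t) \<subseteq> events"
    unfolding sets_enlarged_filtration using sets_filtration_subset[of t]
    by (intro sets.sigma_sets_subset) simp
  from measurable_mono[OF order_refl refl this, of N] show ?thesis using f by auto
qed

text \<open>On an event where the initial value is constant, the enlargement adds nothing.\<close>

lemma enlarged_trace:
  assumes S: "S \<subseteq> space P" "\<And>\<omega>. \<omega> \<in> S \<Longrightarrow> \<xi> \<omega> = c" and C: "C \<in> sets (enlarged_filtration P B \<xi> t)"
  shows "\<exists>C'\<in>sets (\<F> t). C \<inter> S = C' \<inter> S"
  using C unfolding sets_enlarged_filtration
proof (induction rule: sigma_sets.induct)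
  case (Basic C)
  then show ?case
  proof
    assume "C \<in> {\<xi> -` A \<inter> space P |A. A \<in> sets borel}"
    then obtain A where "C = \<xi> -` A \<inter> space P" by blast
    then have "C \<inter> S = (if c \<in> A then space P else {}) \<inter> S" using S by auto
    moreover have "(if c \<in> A then space P else {}) \<in> sets (\<F> t)"
      using sets.top[of "\<F> t"] by simp
    ultimately show ?thesis by blast
  qed blast
next
  case Empty
  then show ?case by (intro bexI[of _ "{}"]) auto
next
  case (Compl C)
  then obtain C' where C': "C' \<in> sets (\<F> t)" "C \<inter> S = C' \<inter> S" by blast
  have "space P - C' \<in> sets (\<F> t)" using sets.compl_sets[OF C'(1)] by simp
  moreover have "(space P - C) \<inter> S = (space P - C') \<inter> S" using C'(2) by blast
  ultimately show ?case by blast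
next
  case (Union C)
  then obtain C' where C': "\<And>i. C' i \<in> sets (\<F> t)" "\<And>i. C i \<inter> S = C' i \<inter> S" by metis
  have "(\<Union>i. C' i) \<in> sets (\<F> t)" using C'(1) by blast
  moreover have "(\<Union>i. C i) \<inter> S = (\<Union>i. C' i) \<inter> S" using C'(2) by blast
  ultimately show ?case by blast
qed

text \<open>The trace statement for sets is lifted to functions by the standard induction over
  nonnegative measurable functions. Working in \<open>ennreal\<close> lets the supremum of the
  chosen representatives exist even off \<open>S\<close>, where they are unrelated to one
  another.\<close>

lemma enlarged_trace_ennreal:
  fixes f :: "'a \<Rightarrow> ennreal"
  assumes S: "S \<subseteq> space P" "\<And>\<omega>. \<omega> \<in> S \<Longrightarrow> \<xi> \<omega> = c"
    and f: "f \<in> borel_measurable (enlarged_filtration P B \<xi> t)"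
  shows "\<exists>g\<in>borel_measurable (\<F> t). \<forall>\<omega>\<in>S. f \<omega> = g \<omega>"
  using f
proof (induction rule: borel_measurable_induct)
  case (cong f g)
  then show ?case using S(1) by (metis space_enlarged_filtration subsetD)
next
  case (set C)
  obtain C' where C': "C' \<in> sets (\<F> t)" "C \<inter> S = C' \<inter> S" using enlarged_trace[OF S set] by blast
  have "indicator C' \<in> borel_measurable (\<F> t)" using C'(1) by simp
  moreover have "\<forall>\<omega>\<in>S. indicator C \<omega> = (indicator C' \<omega> :: ennreal)" using C'(2) by (auto simp: indicator_def)
  ultimately show ?case by blast
next
  case (mult u k)
  then obtain g where g: "g \<in> borel_measurable (\<F> t)" "\<forall>\<omega>\<in>S. u \<omega> = g \<omega>" by blast
  have "(\<lambda>\<omega>. k * g \<omega>) \<in> borel_measurable (\<F> t)" using g(1) by measurable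
  then show ?case using g(2) by (intro bexI[of _ "\<lambda>\<omega>. k * g \<omega>"]) auto
next
  case (add u v)
  then obtain g g' where g: "g \<in> borel_measurable (\<F> t)" "\<forall>\<omega>\<in>S. u \<omega> = g \<omega>"
    "g' \<in> borel_measurable (\<F> t)" "\<forall>\<omega>\<in>S. v \<omega> = g' \<omega>" by blast
  have "(\<lambda>\<omega>. g' \<omega> + g \<omega>) \<in> borel_measurable (\<F> t)" using g(1,3) by measurable
  then show ?case using g(2,4) by (intro bexI[of _ "\<lambda>\<omega>. g' \<omega> + g \<omega>"]) auto
next
  case (seq U)
  then have "\<forall>i. \<exists>g. g \<in> borel_measurable (\<F> t) \<and> (\<forall>\<omega>\<in>S. U i \<omega> = g \<omega>)" by blast
  then obtain g where g: "\<And>i. g i \<in> borel_measurable (\<F> t)" "\<And>i. \<forall>\<omega>\<in>S. U i \<omega> = g i \<omega>" by metis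
  have "(\<lambda>\<omega>. SUP i. g i \<omega>) \<in> borel_measurable (\<F> t)" using g(1) by measurable
  then show ?case using g(2) by (intro bexI[of _ "\<lambda>\<omega>. SUP i. g i \<omega>"]) (auto simp: image_comp)
qed

lemma enlarged_locadapted:
  assumes f: "f \<in> borel_measurable (enlarged_filtration P B \<xi> t)" and A: "A \<subseteq> space P"
    and c: "AE \<omega> in P. \<omega> \<in> A \<longrightarrow> \<xi> \<omega> = c"
  shows "locadapted A t f"
proof -
  \<comment> \<open>The initial value is constant on \<open>A\<close> only almost surely.
    \<open>S\<close> is the part where it is literally \<open>c\<close>; it serves as a plain subset
    of the space.\<close>
  define S where "S = {\<omega>\<in>A. \<xi> \<omega> = c}"
  have S: "S \<subseteq> space P" "\<And>\<omega>. \<omega> \<in> S \<Longrightarrow> \<xi> \<omega> = c" using A by (auto simp: S_def)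
  have "(\<lambda>\<omega>. ennreal (f \<omega>)) \<in> borel_measurable (enlarged_filtration P B \<xi> t)"
    "(\<lambda>\<omega>. ennreal (- f \<omega>)) \<in> borel_measurable (enlarged_filtration P B \<xi> t)" using f by measurable
  from enlarged_trace_ennreal[OF S this(1)] enlarged_trace_ennreal[OF S this(2)]
  obtain g g' where g: "g \<in> borel_measurable (\<F> t)" "\<And>\<omega>. \<omega> \<in> S \<Longrightarrow> ennreal (f \<omega>) = g \<omega>"
    and g': "g' \<in> borel_measurable (\<F> t)" "\<And>\<omega>. \<omega> \<in> S \<Longrightarrow> ennreal (- f \<omega>) = g' \<omega>" by blast
  have "f \<omega> = enn2real (g \<omega>) - enn2real (g' \<omega>)" if "\<omega> \<in> S" for \<omega>
    using g(2)[OF that, symmetric] g'(2)[OF that, symmetric] by (cases "0 \<le> f \<omega>") (auto simp: ennreal_neg)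
  then have "AE \<omega> in P. \<omega> \<in> A \<longrightarrow> f \<omega> = enn2real (g \<omega>) - enn2real (g' \<omega>)"
    using c by (auto simp: S_def elim!: eventually_mono)
  moreover have "(\<lambda>\<omega>. enn2real (g \<omega>) - enn2real (g' \<omega>)) \<in> borel_measurable (\<F> t)" using g(1) g'(1) by measurable
  ultimately show ?thesis unfolding locadapted_def by (rule bexI)
qed

lemma ito_solution_exp:
  assumes T: "0 < T" and \<sigma>: "0 < \<sigma>" and sol: "ito_solution P B \<mu> \<sigma> T X"
  shows "AE \<omega> in P. X T \<omega> = X 0 \<omega> * exp ((\<mu> - \<sigma>\<^sup>2 / 2) * T + \<sigma> * B T \<omega>)"
proof -
  have Xc: "AE \<omega> in P. continuous_on {0..T} (\<lambda>t. X t \<omega>)" and Xa: "\<And>t. t \<in> {0..T} \<Longrightarrow> X t \<in> borel_measurable (\<F> t)"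
    and "\<forall>t\<in>{0..T}. \<exists>I. has_ito_integral P B X t I \<and>
        (AE \<omega> in P. X t \<omega> = X 0 \<omega> + \<mu> * (LINT s:{0..t}|lborel. X s \<omega>) + \<sigma> * I \<omega>)"
    using sol unfolding ito_solution_def by auto
  then obtain I where "\<forall>t\<in>{0..T}. has_ito_integral P B X t (I t) \<and>
        (AE \<omega> in P. X t \<omega> = X 0 \<omega> + \<mu> * (LINT s:{0..t}|lborel. X s \<omega>) + \<sigma> * I t \<omega>)"
    by (elim bchoice[THEN exE])
  then have I: "\<And>t. t \<in> {0..T} \<Longrightarrow> has_ito_integral P B X t (I t)"
    "\<And>t. t \<in> {0..T} \<Longrightarrow> AE \<omega> in P. X t \<omega> = X 0 \<omega> + \<mu> * (LINT s:{0..t}|lborel. X s \<omega>) + \<sigma> * I t \<omega>"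
    by blast+
  have "AE \<omega> in P. \<omega> \<in> space P \<longrightarrow> X T \<omega> = X 0 \<omega> * exp ((\<mu> - \<sigma>\<^sup>2 / 2) * T + \<sigma> * B T \<omega>)"
  proof (rule linear_sde_unique[OF T \<sigma> sets.top _ _ Xc])
    fix t assume t: "t \<in> {0..T}"
    show "X t \<in> borel_measurable P" "locadapted (space P) t (X t)"
      using Xa[OF t] measurable_filtration locadapted_adapted by auto
    show "I t \<in> borel_measurable P" using I(1)[OF t] unfolding has_ito_integral_def conv_in_prob_def by auto
    show "AE \<omega> in P. \<omega> \<in> space P \<longrightarrow> X t \<omega> = X 0 \<omega> + \<mu> * (LINT s:{0..t}|lborel. X s \<omega>) + \<sigma> * I t \<omega>"
      using I(2)[OF t] by eventually_elim simp
  next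
    fix n i :: nat assume i: "i \<le> 2 ^ n"
    show "(\<lambda>m. l0 (space P) (\<lambda>\<omega>. I (grid T n i) \<omega> - rsum T X (n + m) (i * 2 ^ m) \<omega>)) \<longlonglongrightarrow> 0"
      by (rule ito_integral_riemann[OF T i Xc Xa I(1)]) (use grid_mem[of T i n] T i in auto)
  qed
  then show ?thesis using AE_space by eventually_elim simp
qed

text \<open>On \<open>A\<close> the initial value is constant, so the solution is locally adapted
  there although it is only adapted to the enlarged filtration. Hence uniqueness can be invoked on
  one level set of the initial value at a time.\<close>

lemma forward_solution_exp:
  assumes T: "0 < T" and \<sigma>: "0 < \<sigma>" and sol: "forward_solution P B \<mu> \<sigma> T X"
    and A: "A \<in> events" and c: "AE \<omega> in P. \<omega> \<in> A \<longrightarrow> X 0 \<omega> = c"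
  shows "AE \<omega> in P. \<omega> \<in> A \<longrightarrow> X T \<omega> = c * exp ((\<mu> - \<sigma>\<^sup>2 / 2) * T + \<sigma> * B T \<omega>)"
proof -
  have X0: "X 0 \<in> borel_measurable P" and Xc: "AE \<omega> in P. continuous_on {0..T} (\<lambda>t. X t \<omega>)"
    and Xa: "\<And>t. t \<in> {0..T} \<Longrightarrow> X t \<in> borel_measurable (enlarged_filtration P B (X 0) t)"
    and "\<forall>t\<in>{0..T}. \<exists>I. has_forward_integral P B X t I \<and>
        (AE \<omega> in P. X t \<omega> = X 0 \<omega> + \<mu> * (LINT s:{0..t}|lborel. X s \<omega>) + \<sigma> * I \<omega>)"
    using sol unfolding forward_solution_def by auto
  then obtain I where "\<forall>t\<in>{0..T}. has_forward_integral P B X t (I t) \<and>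
        (AE \<omega> in P. X t \<omega> = X 0 \<omega> + \<mu> * (LINT s:{0..t}|lborel. X s \<omega>) + \<sigma> * I t \<omega>)"
    by (elim bchoice[THEN exE])
  then have I: "\<And>t. t \<in> {0..T} \<Longrightarrow> has_forward_integral P B X t (I t)"
    "\<And>t. t \<in> {0..T} \<Longrightarrow> AE \<omega> in P. X t \<omega> = X 0 \<omega> + \<mu> * (LINT s:{0..t}|lborel. X s \<omega>) + \<sigma> * I t \<omega>"
    by blast+
  have Xm: "X t \<in> borel_measurable P" if "t \<in> {0..T}" for t
    by (rule measurable_enlarged_filtration[OF X0 Xa[OF that]])
  have Xl: "locadapted A t (X t)" if "t \<in> {0..T}" for t
    by (rule enlarged_locadapted[OF Xa[OF that] sets.sets_into_space[OF A] c])
  have "AE \<omega> in P. \<omega> \<in> A \<longrightarrow> X T \<omega> = X 0 \<omega> * exp ((\<mu> - \<sigma>\<^sup>2 / 2) * T + \<sigma> * B T \<omega>)"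
  proof (rule linear_sde_unique[OF T \<sigma> A Xm Xl Xc])
    fix t assume t: "t \<in> {0..T}"
    show "I t \<in> borel_measurable P" using I(1)[OF t] unfolding has_forward_integral_def conv_in_prob_def by auto
    show "AE \<omega> in P. \<omega> \<in> A \<longrightarrow> X t \<omega> = X 0 \<omega> + \<mu> * (LINT s:{0..t}|lborel. X s \<omega>) + \<sigma> * I t \<omega>"
      using I(2)[OF t] by eventually_elim simp
  next
    fix n i :: nat assume i: "i \<le> 2 ^ n"
    show "(\<lambda>m. l0 A (\<lambda>\<omega>. I (grid T n i) \<omega> - rsum T X (n + m) (i * 2 ^ m) \<omega>)) \<longlonglongrightarrow> 0"
      by (rule forward_integral_riemann[OF T i A Xm Xl Xc I(1)]) (use grid_mem[of T i n] T i in auto)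
  qed
  then show ?thesis using c by eventually_elim simp
qed

text \<open>The law is prescribed for B t - B 0, which agrees with \<open>B t\<close> only almost
  surely; hence the passage through almost everywhere congruence.\<close>

lemma BM_expectation:
  assumes t: "0 < t" and g: "g \<in> borel_measurable borel"
  shows "integrable P (\<lambda>\<omega>. g (B t \<omega>)) \<longleftrightarrow> integrable lborel (\<lambda>x. normal_density 0 (sqrt t) x * g x)"
    "expectation (\<lambda>\<omega>. g (B t \<omega>)) = (LINT x|lborel. normal_density 0 (sqrt t) x * g x)"
proof -
  have d: "distributed P lborel (\<lambda>\<omega>. B t \<omega> - B 0 \<omega>) (normal_density 0 (sqrt t))"
    using BM_increment[of 0 t] t by simp
  have m: "(\<lambda>\<omega>. g (B t \<omega>)) \<in> borel_measurable P" "(\<lambda>\<omega>. g (B t \<omega> - B 0 \<omega>)) \<in> borel_measurable P"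
    using BM_measurable[of t] BM_measurable[of 0] t
    by (auto intro!: measurable_compose[OF _ g] borel_measurable_diff)
  have ae: "AE \<omega> in P. g (B t \<omega> - B 0 \<omega>) = g (B t \<omega>)" using BM_zero by eventually_elim simp
  show "integrable P (\<lambda>\<omega>. g (B t \<omega>)) \<longleftrightarrow> integrable lborel (\<lambda>x. normal_density 0 (sqrt t) x * g x)"
    using distributed_integrable[OF d, of g] g integrable_cong_AE[OF m(2,1) ae] by simp
  show "expectation (\<lambda>\<omega>. g (B t \<omega>)) = (LINT x|lborel. normal_density 0 (sqrt t) x * g x)"
    using distributed_integral[OF d, of g] g integral_cong_AE[OF m(2,1) ae] by simp
qed

lemma expectation_skorokhod_integral:
  assumes "has_skorokhod_integral P B T u V"
  shows "expectation V = 0"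
proof -
  \<comment> \<open>The constant 1 is a smooth functional of zero Wiener integrals, so its
    derivative is an empty sum.\<close>
  have "smooth_poly_growth 0 (\<lambda>_. 1)"
    unfolding smooth_poly_growth_def
  proof (intro conjI allI impI)
    fix js :: "nat list" assume "set js \<subseteq> {..<0}"
    then have js: "js = []" by simp
    show "continuous_on UNIV (fold pd js (\<lambda>_. 1))" by (simp add: js)
    show "\<exists>C k. \<forall>x. \<bar>fold pd js (\<lambda>_. 1) x\<bar> \<le> C * (1 + (\<Sum>i<0. \<bar>x i\<bar>)) ^ k"
      by (rule exI[of _ 1], rule exI[of _ 0]) (simp add: js)
  qed simp_all
  then have "smooth_functional P B T (\<lambda>_. 1) (\<lambda>_ _. 0)"
    unfolding smooth_functional_def by (intro exI[of _ 0] exI[of _ "\<lambda>_. 1"]) auto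
  then have "has_malliavin_derivative P B T (\<lambda>_. 1) (\<lambda>_ _. 0)"
    unfolding has_malliavin_derivative_def square_integrable_def
    by (intro conjI exI[of _ "\<lambda>_ _. 1"] exI[of _ "\<lambda>_ _ _. 0"]) (auto simp: case_prod_beta')
  then have "(\<integral>\<omega>. 1 * V \<omega> \<partial>P) = (\<integral>\<omega>. (LINT s:{0..T}|lborel. 0 * u s \<omega>) \<partial>P)"
    using assms unfolding has_skorokhod_integral_def by blast
  then show ?thesis by (simp add: set_lebesgue_integral_def)
qed

end

section \<open>Expectations\<close>

context brownian_motion begin

text \<open>Square integrability of the Skorokhod integrand over time and chance allows Fubini's
  theorem, and the Skorokhod integrals have mean zero; so the mean \<open>e\<close> solves e t = e 0
  + \<mu> times its own integral.\<close>

lemma skorokhod_solution_expectation: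
  assumes T: "0 < T" and sol: "skorokhod_solution P B \<mu> \<sigma> T X" and X0: "integrable P (X 0)"
  shows "integrable P (X T)" "expectation (X T) = expectation (X 0) * exp (\<mu> * T)"
proof -
  define \<nu> where "\<nu> = time_space T"
  interpret \<nu>: finite_measure \<nu>
    unfolding \<nu>_def by (rule finite_measureI) (simp add: emeasure_restrict_space space_restrict_space emeasure_lborel_Icc_eq)
  interpret \<nu>P: pair_sigma_finite \<nu> P by unfold_locales
  interpret \<nu>PP: finite_measure "\<nu> \<Otimes>\<^sub>M P" by (rule finite_measure_pair_measure) unfold_locales
  have Xm: "X t \<in> borel_measurable P" if "t \<in> {0..T}" for t
    using sol that unfolding skorokhod_solution_def by blast
  have "\<forall>t\<in>{0..T}. \<exists>V. has_skorokhod_integral P B T (\<lambda>s \<omega>. X s \<omega> * indicator {0..t} s) V \<and>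
        (AE \<omega> in P. X t \<omega> = X 0 \<omega> + \<mu> * (LINT s:{0..t}|lborel. X s \<omega>) + \<sigma> * V \<omega>)"
    using sol unfolding skorokhod_solution_def by blast
  then obtain V where "\<forall>t\<in>{0..T}. has_skorokhod_integral P B T (\<lambda>s \<omega>. X s \<omega> * indicator {0..t} s) (V t) \<and>
        (AE \<omega> in P. X t \<omega> = X 0 \<omega> + \<mu> * (LINT s:{0..t}|lborel. X s \<omega>) + \<sigma> * V t \<omega>)"
    by (elim bchoice[THEN exE])
  then have V: "\<And>t. t \<in> {0..T} \<Longrightarrow> has_skorokhod_integral P B T (\<lambda>s \<omega>. X s \<omega> * indicator {0..t} s) (V t)"
    and eq: "\<And>t. t \<in> {0..T} \<Longrightarrow> AE \<omega> in P. X t \<omega> = X 0 \<omega> + \<mu> * (LINT s:{0..t}|lborel. X s \<omega>) + \<sigma> * V t \<omega>"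
    by blast+
  have V0: "expectation (V t) = 0" if "t \<in> {0..T}" for t by (rule expectation_skorokhod_integral[OF V[OF that]])
  have Vi: "integrable P (V t)" if "t \<in> {0..T}" for t
    using V[OF that] unfolding has_skorokhod_integral_def square_integrable_def
    by (auto intro: square_integrable_imp_integrable)
  define f where "f t = (\<lambda>(s, \<omega>). X s \<omega> * indicator {0..t} s)" for t
  have fi: "integrable (\<nu> \<Otimes>\<^sub>M P) (f t)" if "t \<in> {0..T}" for t
    using V[OF that] unfolding has_skorokhod_integral_def square_integrable_def \<nu>_def[symmetric] f_def
    by (auto intro: \<nu>PP.square_integrable_imp_integrable)
  have LINT_eq: "(LINT s:{0..t}|lborel. h s) = (LINT s|\<nu>. h s * indicator {0..t} s)" if "t \<in> {0..T}" for t and h :: "real \<Rightarrow> real"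
  proof -
    have "(LINT s|\<nu>. h s * indicator {0..t} s) = (LINT s|lborel. indicator {0..T} s *\<^sub>R (h s * indicator {0..t} s))"
      unfolding \<nu>_def by (rule integral_restrict_space) simp
    also have "(\<lambda>s. indicator {0..T} s *\<^sub>R (h s * indicator {0..t} s)) = (\<lambda>s. indicator {0..t} s *\<^sub>R h s)"
      using that by (auto simp: indicator_def)
    finally show ?thesis by (simp add: set_lebesgue_integral_def)
  qed
  define e where "e t = expectation (X t)" for t
  have int: "integrable P (\<lambda>\<omega>. LINT s:{0..t}|lborel. X s \<omega>)"
    and Eint: "expectation (\<lambda>\<omega>. LINT s:{0..t}|lborel. X s \<omega>) = (LINT s:{0..t}|lborel. e s)" if t: "t \<in> {0..T}" for t
  proof -
    have fc: "integrable (\<nu> \<Otimes>\<^sub>M P) (\<lambda>(s, \<omega>). X s \<omega> * indicator {0..t} s)" using fi[OF t] by (simp add: f_def)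
    show "integrable P (\<lambda>\<omega>. LINT s:{0..t}|lborel. X s \<omega>)"
      unfolding LINT_eq[OF t] using \<nu>P.integrable_snd[OF fc] .
    have "expectation (\<lambda>\<omega>. LINT s:{0..t}|lborel. X s \<omega>) = (LINT s|\<nu>. (LINT \<omega>|P. X s \<omega> * indicator {0..t} s))"
      unfolding LINT_eq[OF t] by (rule \<nu>P.Fubini_integral[OF fc])
    also have "\<dots> = (LINT s:{0..t}|lborel. e s)" unfolding LINT_eq[OF t] e_def by simp
    finally show "expectation (\<lambda>\<omega>. LINT s:{0..t}|lborel. X s \<omega>) = (LINT s:{0..t}|lborel. e s)" .
  qed
  have Xi: "integrable P (X t)" and eqe: "e t = e 0 + \<mu> * (LINT s:{0..t}|lborel. e s)" if t: "t \<in> {0..T}" for t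
  proof -
    have i: "integrable P (\<lambda>\<omega>. X 0 \<omega> + \<mu> * (LINT s:{0..t}|lborel. X s \<omega>) + \<sigma> * V t \<omega>)"
      using X0 int[OF t] Vi[OF t] by auto
    have m: "(\<lambda>\<omega>. X 0 \<omega> + \<mu> * (LINT s:{0..t}|lborel. X s \<omega>) + \<sigma> * V t \<omega>) \<in> borel_measurable P"
      using i by simp
    show "integrable P (X t)" using i integrable_cong_AE[OF Xm[OF t] m eq[OF t]] by simp
    have "e t = expectation (\<lambda>\<omega>. X 0 \<omega> + \<mu> * (LINT s:{0..t}|lborel. X s \<omega>) + \<sigma> * V t \<omega>)"
      unfolding e_def by (rule integral_cong_AE[OF Xm[OF t] m eq[OF t]])
    then show "e t = e 0 + \<mu> * (LINT s:{0..t}|lborel. e s)"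
      using X0 int[OF t] Vi[OF t] Eint[OF t] V0[OF t] by (simp add: e_def)
  qed
  have TT: "T \<in> {0..T}" using T by simp
  have "integrable \<nu> (\<lambda>s. LINT \<omega>|P. X s \<omega> * indicator {0..T} s)"
    using \<nu>P.integrable_fst[of "\<lambda>s \<omega>. X s \<omega> * indicator {0..T} s"] fi[OF TT] by (simp add: f_def)
  then have "integrable \<nu> (\<lambda>s. e s * indicator {0..T} s)" by (simp add: e_def)
  then have "integrable lborel (\<lambda>s. indicator {0..T} s *\<^sub>R (e s * indicator {0..T} s))"
    unfolding \<nu>_def by (subst (asm) integrable_restrict_space) simp_all
  moreover have "(\<lambda>s. indicator {0..T} s *\<^sub>R (e s * indicator {0..T} s)) = (\<lambda>s. indicator {0..T} s *\<^sub>R e s)"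
    by (auto simp: indicator_def)
  ultimately have si: "set_integrable lborel {0..T} e" by (simp add: set_integrable_def)
  have e_int: "e integrable_on {0..T}" by (rule set_borel_integral_eq_integral(1)[OF si])
  have eH: "e t = e 0 + \<mu> * integral {0..t} e" if t: "t \<in> {0..T}" for t
  proof -
    have "set_integrable lborel {0..t} e" by (rule set_integrable_subset[OF si]) (use t in auto)
    then show ?thesis using eqe[OF t] set_borel_integral_eq_integral(2)[of "{0..t}" e] by simp
  qed
  \<comment> \<open>So far \<open>e\<close> is merely integrable. The integral equation makes it
    continuous, and then a second use of the equation makes it differentiable.\<close>
  have "continuous_on {0..T} (\<lambda>t. e 0 + \<mu> * integral {0..t} e)"
    by (intro continuous_intros indefinite_integral_continuous_1[OF e_int])
  then have ce: "continuous_on {0..T} e" by (rule continuous_on_eq) (rule eH[symmetric])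
  have "ode_solution \<mu> T e"
    unfolding ode_solution_def
  proof
    fix t assume t: "t \<in> {0..T}"
    have "((\<lambda>u. integral {0..u} e) has_real_derivative e t) (at t within {0..T})"
      using integral_has_real_derivative[OF ce t] .
    then have "((\<lambda>u. e 0 + \<mu> * integral {0..u} e) has_real_derivative \<mu> * e t) (at t within {0..T})"
      by (auto intro!: derivative_eq_intros)
    then show "(e has_real_derivative \<mu> * e t) (at t within {0..T})"
      by (rule has_field_derivative_transform_within[OF _ zero_less_one t]) (rule eH[symmetric])
  qed
  then show "expectation (X T) = expectation (X 0) * exp (\<mu> * T)"
    using ode_solution_exp[of \<mu> T e T] T by (simp add: e_def)
  show "integrable P (X T)" by (rule Xi[OF TT])
qed

text \<open>Completing the square: weighting the law of \<open>B T\<close> by exp(a B_T) shifts its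
  mean from 0 to a T and produces the factor exp(a^2 T / 2).\<close>

lemma BM_exp_tail:
  assumes T: "0 < T"
  shows "expectation (\<lambda>\<omega>. exp (a * B T \<omega>) * indicator {c<..} (B T \<omega>))
      = exp (a\<^sup>2 * T / 2) * (1 / 2 * (1 - erf ((c - a * T) / (sqrt 2 * sqrt T))))"
    "integrable P (\<lambda>\<omega>. exp (a * B T \<omega>) * indicator {c<..} (B T \<omega>))"
proof -
  have eq: "normal_density 0 (sqrt T) x * (exp (a * x) * indicator {c<..} x) =
      exp (a\<^sup>2 * T / 2) * (normal_density (a * T) (sqrt T) x * indicator {c<..} x)" for x
  proof -
    have "- (x - 0)\<^sup>2 / (2 * (sqrt T)\<^sup>2) + a * x = a\<^sup>2 * T / 2 + - (x - a * T)\<^sup>2 / (2 * (sqrt T)\<^sup>2)"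
      using T by (simp add: power2_eq_square field_simps)
    then have "exp (- (x - 0)\<^sup>2 / (2 * (sqrt T)\<^sup>2)) * exp (a * x) = exp (a\<^sup>2 * T / 2) * exp (- (x - a * T)\<^sup>2 / (2 * (sqrt T)\<^sup>2))"
      by (simp only: exp_add[symmetric])
    then show ?thesis unfolding normal_density_def by (simp only: mult_ac) (simp add: mult_ac)
  qed
  have g: "(\<lambda>x. exp (a * x) * indicator {c<..} x) \<in> borel_measurable borel" by measurable
  have sT: "0 < sqrt T" using T by simp
  show "expectation (\<lambda>\<omega>. exp (a * B T \<omega>) * indicator {c<..} (B T \<omega>))
      = exp (a\<^sup>2 * T / 2) * (1 / 2 * (1 - erf ((c - a * T) / (sqrt 2 * sqrt T))))"
    unfolding BM_expectation(2)[OF T g] eq normal_density_tail[OF sT, symmetric] by simp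
  have "integrable lborel (\<lambda>x. indicator {c<..} x *\<^sub>R normal_density (a * T) (sqrt T) x)"
    by (rule integrable_mult_indicator) (use sT in auto)
  then have "integrable lborel (\<lambda>x. exp (a\<^sup>2 * T / 2) * (normal_density (a * T) (sqrt T) x * indicator {c<..} x))"
    by (intro integrable_mult_right) (simp add: mult.commute)
  then show "integrable P (\<lambda>\<omega>. exp (a * B T \<omega>) * indicator {c<..} (B T \<omega>))"
    unfolding BM_expectation(1)[OF T g] eq .
qed

end

theorem theorem2p1:
  fixes P :: "'a measure" and B :: "real \<Rightarrow> 'a \<Rightarrow> real"
    and M \<rho> \<mu> \<sigma> T :: real
    and Sbar0 :: "real \<Rightarrow> real" and Sbar1 S0 :: "real \<Rightarrow> 'a \<Rightarrow> real"
  assumes "0 < M" "0 < \<rho>" "0 < \<mu>" "0 < \<sigma>" "0 < T" "\<rho> < \<mu>"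
    and "brownian_motion P B"
    and "ode_solution \<rho> T Sbar0" "Sbar0 0 = 1"
    and "ito_solution P B \<mu> \<sigma> T Sbar1" "AE \<omega> in P. Sbar1 0 \<omega> = 1"
    and "random_ode_solution P \<rho> T S0"
    and "AE \<omega> in P. S0 0 \<omega> = M * indicator {\<omega>. Sbar1 T \<omega> \<le> Sbar0 T} \<omega>"
  shows
    "(\<forall>S1. skorokhod_solution P B \<mu> \<sigma> T S1 \<longrightarrow>
        (AE \<omega> in P. S1 0 \<omega> = M * indicator {\<omega>. Sbar1 T \<omega> > Sbar0 T} \<omega>) \<longrightarrow>
        prob_space.expectation P (\<lambda>\<omega>. S0 T \<omega> + S1 T \<omega>) =
          M / 2 * (1 + erf ((\<sigma>\<^sup>2 + 2 * \<rho> - 2 * \<mu>) * sqrt T / (2 * sqrt 2 * \<sigma>))) * exp (\<rho> * T) +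
          M / 2 * (1 - erf ((\<sigma>\<^sup>2 + 2 * \<rho> - 2 * \<mu>) * sqrt T / (2 * sqrt 2 * \<sigma>))) * exp (\<mu> * T)) \<and>
     (\<forall>S1. forward_solution P B \<mu> \<sigma> T S1 \<longrightarrow>
        (AE \<omega> in P. S1 0 \<omega> = M * indicator {\<omega>. Sbar1 T \<omega> > Sbar0 T} \<omega>) \<longrightarrow>
        prob_space.expectation P (\<lambda>\<omega>. S0 T \<omega> + S1 T \<omega>) =
          M / 2 * (1 + erf ((\<sigma>\<^sup>2 + 2 * \<rho> - 2 * \<mu>) * sqrt T / (2 * sqrt 2 * \<sigma>))) * exp (\<rho> * T) +
          M / 2 * (1 + erf ((\<sigma>\<^sup>2 - 2 * \<rho> + 2 * \<mu>) * sqrt T / (2 * sqrt 2 * \<sigma>))) * exp (\<mu> * T))"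
proof -
  note \<sigma> = \<open>0 < \<sigma>\<close> and T = \<open>0 < T\<close>
  interpret brownian_motion P B by fact
  have TT: "T \<in> {0..T}" using T by simp
  define \<theta> where "\<theta> = (\<sigma>\<^sup>2 + 2 * \<rho> - 2 * \<mu>) * sqrt T / (2 * sqrt 2 * \<sigma>)"
  \<comment> \<open>The threshold for B_T: taking logarithms, the stock beats the bond exactly when
    (\<mu> - \<sigma>^2 / 2) T + \<sigma> B_T exceeds \<rho> T.\<close>
  define c where "c = (\<rho> - \<mu> + \<sigma>\<^sup>2 / 2) * T / \<sigma>"
  have sqT: "T = sqrt T * sqrt T" using T by simp
  have c\<theta>: "c / (sqrt 2 * sqrt T) = \<theta>"
  proof -
    have "c / (sqrt 2 * sqrt T) = (\<rho> - \<mu> + \<sigma>\<^sup>2 / 2) * (sqrt T * sqrt T) / \<sigma> / (sqrt 2 * sqrt T)"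
      unfolding c_def by (simp add: T less_imp_le)
    also have "\<dots> = \<theta>"
    proof -
      have "(\<rho> - \<mu> + \<sigma>\<^sup>2 / 2) * (q * q) / \<sigma> / (w * q) = (\<sigma>\<^sup>2 + 2 * \<rho> - 2 * \<mu>) * q / (2 * w * \<sigma>)"
        if "q \<noteq> 0" "w \<noteq> 0" for q w :: real
        using that \<sigma> by (simp add: field_simps)
      from this[of "sqrt T" "sqrt 2"] show ?thesis using T by (simp add: \<theta>_def)
    qed
    finally show ?thesis .
  qed
  \<comment> \<open>The weight exp(\<sigma> B_T) lowers the threshold by \<sigma> T. The resulting
    argument is the negative of the one in (b), and oddness of \<open>erf\<close> then turns 1 - erf
    into 1 + erf.\<close>
  have c\<theta>': "(c - \<sigma> * T) / (sqrt 2 * sqrt T) = - ((\<sigma>\<^sup>2 - 2 * \<rho> + 2 * \<mu>) * sqrt T / (2 * sqrt 2 * \<sigma>))"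
  proof -
    have "(c - \<sigma> * T) / (sqrt 2 * sqrt T) = \<theta> - \<sigma> * (sqrt T * sqrt T) / (sqrt 2 * sqrt T)"
      unfolding diff_divide_distrib c\<theta> by (simp add: T less_imp_le)
    also have "\<dots> = - ((\<sigma>\<^sup>2 - 2 * \<rho> + 2 * \<mu>) * sqrt T / (2 * sqrt 2 * \<sigma>))"
    proof -
      have "(\<sigma>\<^sup>2 + 2 * \<rho> - 2 * \<mu>) * q / (2 * w * \<sigma>) - \<sigma> * (q * q) / (w * q) = - ((\<sigma>\<^sup>2 - 2 * \<rho> + 2 * \<mu>) * q / (2 * w * \<sigma>))"
        if "q \<noteq> 0" "w \<noteq> 0" for q w :: real
        using that \<sigma> by (simp add: field_simps power2_eq_square)
      from this[of "sqrt T" "sqrt 2"] show ?thesis unfolding \<theta>_def using T by simp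
    qed
    finally show ?thesis .
  qed
  have S0bar: "Sbar0 T = exp (\<rho> * T)"
    using ode_solution_exp[OF \<open>ode_solution \<rho> T Sbar0\<close> _ TT] \<open>Sbar0 0 = 1\<close> T by simp
  have ev: "AE \<omega> in P. (Sbar1 T \<omega> > Sbar0 T) = (c < B T \<omega>)"
    using ito_solution_exp[OF T \<sigma> \<open>ito_solution P B \<mu> \<sigma> T Sbar1\<close>] \<open>AE \<omega> in P. Sbar1 0 \<omega> = 1\<close>
  proof eventually_elim
    case (elim \<omega>)
    have "(Sbar1 T \<omega> > Sbar0 T) = (\<rho> * T < (\<mu> - \<sigma>\<^sup>2 / 2) * T + \<sigma> * B T \<omega>)" using elim S0bar by simp
    also have "\<dots> = ((\<rho> - \<mu> + \<sigma>\<^sup>2 / 2) * T < \<sigma> * B T \<omega>)" by (auto simp: algebra_simps)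
    also have "\<dots> = (c < B T \<omega>)" unfolding c_def using \<sigma> by (simp add: pos_divide_less_eq mult.commute)
    finally show ?case .
  qed
  have [measurable]: "B T \<in> borel_measurable P" using BM_measurable T by simp
  define p :: real where "p = expectation (\<lambda>\<omega>. indicator {c<..} (B T \<omega>))"
  have p: "p = 1 / 2 * (1 - erf \<theta>)"
    using BM_exp_tail(1)[OF T, of 0 c] unfolding p_def by (simp add: c\<theta>)
  have ip: "integrable P (\<lambda>\<omega>. indicator {c<..} (B T \<omega>) :: real)"
    using BM_exp_tail(2)[OF T, of 0 c] by simp
  have S0T: "AE \<omega> in P. S0 T \<omega> = M * exp (\<rho> * T) * (1 - indicator {c<..} (B T \<omega>))"
  proof -
    have "AE \<omega> in P. ode_solution \<rho> T (\<lambda>t. S0 t \<omega>)" using \<open>random_ode_solution P \<rho> T S0\<close> unfolding random_ode_solution_def by simp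
    then show ?thesis using \<open>AE \<omega> in P. S0 0 \<omega> = M * indicator {\<omega>. Sbar1 T \<omega> \<le> Sbar0 T} \<omega>\<close> ev
    proof eventually_elim
      case (elim \<omega>)
      have "S0 T \<omega> = S0 0 \<omega> * exp (\<rho> * T)" by (rule ode_solution_exp[OF elim(1) _ TT]) (use T in simp)
      moreover have "indicator {\<omega>. Sbar1 T \<omega> \<le> Sbar0 T} \<omega> = 1 - (indicator {c<..} (B T \<omega>) :: real)"
        using elim(3) by (auto simp: indicator_def)
      ultimately show ?case using elim(2) by simp
    qed
  qed
  have S0m: "S0 T \<in> borel_measurable P"
    using \<open>random_ode_solution P \<rho> T S0\<close> TT unfolding random_ode_solution_def by simp
  have i0: "integrable P (\<lambda>\<omega>. M * exp (\<rho> * T) * (1 - indicator {c<..} (B T \<omega>)))" using ip by simp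
  have S0i: "integrable P (S0 T)" using i0 integrable_cong_AE[OF S0m _ S0T] by simp
  have S0E: "expectation (S0 T) = M / 2 * (1 + erf \<theta>) * exp (\<rho> * T)"
  proof -
    have "expectation (S0 T) = expectation (\<lambda>\<omega>. M * exp (\<rho> * T) * (1 - indicator {c<..} (B T \<omega>)))"
      by (rule integral_cong_AE[OF S0m _ S0T]) measurable
    also have "\<dots> = M * exp (\<rho> * T) * (1 - p)" using ip by (simp add: p_def prob_space)
    finally show ?thesis unfolding p by (simp add: field_simps)
  qed
  have init: "AE \<omega> in P. S1 0 \<omega> = M * indicator {c<..} (B T \<omega>)"
    if "AE \<omega> in P. S1 0 \<omega> = M * indicator {\<omega>. Sbar1 T \<omega> > Sbar0 T} \<omega>" for S1 :: "real \<Rightarrow> 'a \<Rightarrow> real"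
    using that ev by eventually_elim (simp add: indicator_def)
  show ?thesis
    unfolding \<theta>_def[symmetric]
  proof (intro conjI allI impI)
    fix S1 assume sol: "skorokhod_solution P B \<mu> \<sigma> T S1"
      and "AE \<omega> in P. S1 0 \<omega> = M * indicator {\<omega>. Sbar1 T \<omega> > Sbar0 T} \<omega>"
    then have S10: "AE \<omega> in P. S1 0 \<omega> = M * indicator {c<..} (B T \<omega>)" by (intro init)
    have m: "S1 0 \<in> borel_measurable P" using sol T unfolding skorokhod_solution_def by simp
    have i: "integrable P (S1 0)" using ip integrable_cong_AE[OF m _ S10] by simp
    have "expectation (S1 0) = expectation (\<lambda>\<omega>. M * indicator {c<..} (B T \<omega>))"
      by (rule integral_cong_AE[OF m _ S10]) measurable
    also have "\<dots> = M * p" using ip by (simp add: p_def)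
    finally have "expectation (S1 0) = M * p" .
    then have "expectation (S1 T) = M * p * exp (\<mu> * T)" "integrable P (S1 T)"
      using skorokhod_solution_expectation[OF T sol i] by auto
    then show "expectation (\<lambda>\<omega>. S0 T \<omega> + S1 T \<omega>) =
        M / 2 * (1 + erf \<theta>) * exp (\<rho> * T) + M / 2 * (1 - erf \<theta>) * exp (\<mu> * T)"
      using S0i S0E unfolding p by simp
  next
    fix S1 assume sol: "forward_solution P B \<mu> \<sigma> T S1"
      and "AE \<omega> in P. S1 0 \<omega> = M * indicator {\<omega>. Sbar1 T \<omega> > Sbar0 T} \<omega>"
    then have S10: "AE \<omega> in P. S1 0 \<omega> = M * indicator {c<..} (B T \<omega>)" by (intro init)
    \<comment> \<open>The initial value is M on \<open>A\<close> and 0 on its complement, up to a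
      null set; the forward equation is solved on each of the two events.\<close>
    define A where "A = {\<omega>\<in>space P. c < B T \<omega>}"
    have A: "A \<in> events" unfolding A_def by measurable
    have c1: "AE \<omega> in P. \<omega> \<in> A \<longrightarrow> S1 0 \<omega> = M" and c2: "AE \<omega> in P. \<omega> \<in> space P - A \<longrightarrow> S1 0 \<omega> = 0"
      using S10 by (eventually_elim, simp add: A_def)+
    define g where "g = (\<lambda>\<omega>. M * exp ((\<mu> - \<sigma>\<^sup>2 / 2) * T) * (exp (\<sigma> * B T \<omega>) * indicator {c<..} (B T \<omega>)))"
    have S1T: "AE \<omega> in P. S1 T \<omega> = g \<omega>"
      using forward_solution_exp[OF T \<sigma> sol A c1] forward_solution_exp[OF T \<sigma> sol sets.compl_sets[OF A] c2] AE_space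
    proof eventually_elim
      case (elim \<omega>)
      then show ?case by (cases "\<omega> \<in> A") (auto simp: A_def g_def exp_add)
    qed
    have m: "S1 T \<in> borel_measurable P"
      using sol TT measurable_enlarged_filtration[of "S1 0" "S1 T" T] unfolding forward_solution_def by blast
    have gi: "integrable P g" unfolding g_def by (intro integrable_mult_right BM_exp_tail(2) T)
    have S1i: "integrable P (S1 T)" using gi integrable_cong_AE[OF m _ S1T] by auto
    have "expectation (S1 T) = expectation g" by (rule integral_cong_AE[OF m _ S1T]) (use gi in auto)
    also have "\<dots> = M * exp ((\<mu> - \<sigma>\<^sup>2 / 2) * T) * (exp (\<sigma>\<^sup>2 * T / 2) *
        (1 / 2 * (1 - erf ((c - \<sigma> * T) / (sqrt 2 * sqrt T)))))"
      unfolding g_def using BM_exp_tail(1)[OF T, of \<sigma> c] by simp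
    also have "\<dots> = M * (exp ((\<mu> - \<sigma>\<^sup>2 / 2) * T) * exp (\<sigma>\<^sup>2 * T / 2)) *
        (1 / 2 * (1 + erf ((\<sigma>\<^sup>2 - 2 * \<rho> + 2 * \<mu>) * sqrt T / (2 * sqrt 2 * \<sigma>))))"
      unfolding c\<theta>' erf_minus by simp
    also have "exp ((\<mu> - \<sigma>\<^sup>2 / 2) * T) * exp (\<sigma>\<^sup>2 * T / 2) = exp (\<mu> * T)"
      by (simp add: exp_add[symmetric] algebra_simps)
    finally have E1: "expectation (S1 T) =
       M / 2 * (1 + erf ((\<sigma>\<^sup>2 - 2 * \<rho> + 2 * \<mu>) * sqrt T / (2 * sqrt 2 * \<sigma>))) * exp (\<mu> * T)" by (simp only: mult_ac) simp
    show "expectation (\<lambda>\<omega>. S0 T \<omega> + S1 T \<omega>) = M / 2 * (1 + erf \<theta>) * exp (\<rho> * T) +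
       M / 2 * (1 + erf ((\<sigma>\<^sup>2 - 2 * \<rho> + 2 * \<mu>) * sqrt T / (2 * sqrt 2 * \<sigma>))) * exp (\<mu> * T)"
      unfolding S0E[symmetric] E1[symmetric] using S0i S1i by simp
  qed
qed

end
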